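(* Assume the standing setting with $I=(0,\infty)$, and that $X$ a.s. has no negative jumps. Suppose there exist $Q\in(0,\infty)$, $z_0\in[0,\infty)$, $\theta\in(z_0,\infty)$ and a $C^1$ map $g:[z_0,\infty)\to[0,\infty)$ with $g>0$ on $(z_0,\infty)$, $g(z_0)=0$, $\lim_{z\to\infty}g(z)=\infty$ and $\int_\theta^\infty\frac{dz}{g(z)}=\infty$, such that $$\mathbb{P}_x[e^{-qT_\ell^-};T_\ell^-<\zeta]=\frac{\int_{z_0}^\infty\frac{1}{g(z)}\exp\big(-xz+\int_\theta^z\frac{q}{g}\big)dz}{\int_{z_0}^\infty\frac{1}{g(z)}\exp\big(-\ell z+\int_\theta^z\frac{q}{g}\big)dz}\quad\text{for all }0<\ell\le x\text{ and all }q\in(Q,\infty).$$ Then there exist a Laplace exponent $\psi$ of a spectrally positive Lévy process and $p\in[0,\infty)$, with $\int^\infty_{\psi^{-1}(0)+1}\frac{dz}{\psi(z)}=\infty$, such that $X$ under $(\mathbb{P}_x)_{x\in(0,\infty)}$ has the law of a continuous-state branching process with branching mechanism $\psi-p$ (with state space $(0,\infty)$ and cemetery $\infty$); necessarily $z_0=\psi^{-1}(p)$ and $g=(\psi-p)|_{[\psi^{-1}(p),\infty)}$. In particular the laws of $X$ are uniquely determined by $z_0$ and $g$.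
   Context: Standing setting: $I\subset\mathbb{R}$ is an interval unbounded above. $X=(X_t)_{t\in[0,\zeta)}$ is a process under complete probability measures $(\mathbb{P}_x)_{x\in I}$ (whose domains all contain $\mathcal{F}_\infty$), adapted to a filtration $\mathcal{F}=(\mathcal{F}_t)_{t\ge0}$ that is complete in the sense that each $\mathcal{F}_t$ contains every set differing from an event of $\mathcal{F}_t$ by a set that is $\mathbb{P}_x$-null for all $x\in I$. The lifetime $\zeta$ is an $\mathcal{F}$-stopping time with $\zeta>0$ a.s., and $X_t:=\infty$ (cemetery) for $t\ge\zeta$. "a.s." means $\mathbb{P}_x$-a.s. for every $x\in I$, and "negligible" means $\mathbb{P}_x$-null for every $x$. Assumptions: paths of $X$ are càdlàg in $I$ on $[0,\zeta)$; on $\{0<\zeta<\infty\}$ the limit $X_{\zeta-}$ exists in $I\cup\{\infty\}$ a.s. (set $X_{\zeta-}:=\infty$ when it does not exist); $x\mapsto\mathbb{P}_x(t<\zeta,X_t\in A)$ is universally measurable for Borel $A\subset I$; normality: $X_0=x$ $\mathbb{P}_x$-a.s.; strong Markov: for every $\mathcal{F}$-stopping time $S$ and measurable $H\ge0$, $\mathbb{P}_x[H(X_{S+\cdot})\mid\mathcal{F}_S]=\mathbb{P}_{X_S}[H(X)]$ $\mathbb{P}_x$-a.s. on $\{S<\zeta\}$; quasi left-continuity: if $\mathcal{F}$-stopping times $T_n$ increase a.s. to $T$ then $X_{T_n}\to X_T$ a.s. on $\{T<\zeta\}$; non-announceability: for every a.s. nondecreasing sequence $(T_n)$ of $\mathcal{F}$-stopping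 times, the event $\{T_n<\zeta\ \forall n\}\cap\{\lim_n T_n=\zeta\}\cap\{\zeta<\infty,X_{\zeta-}<\infty\}$ is negligible. Notation: $\mathbb{P}_x[Y;A]:=\mathbb{E}_x[Y\mathbf{1}_A]$; for $\ell\in I$, $T_\ell^-:=\inf\{t\in[0,\zeta):X_t\le\ell\}$ ($\inf\emptyset=\infty$). A spectrally positive Lévy process is a Lévy process with no negative jumps that is not a subordinator; its Laplace exponent is $\psi(z)=\log\mathbb{E}_0[e^{-z\xi_1}]=-\gamma z+\frac{\sigma^2}{2}z^2+\int_{(0,\infty)}(e^{-zh}+zh\mathbf{1}_{(0,1]}(h)-1)\,\mathsf{m}(dh)$, $z\ge0$, so $\psi(0)=0$; $\psi^{-1}$ is its right-continuous inverse. A continuous-state branching process with branching mechanism $\psi-p$ ($p\ge0$) is a Markov process with values in $[0,\infty]$ (with $\infty$ absorbing/cemetery) such that $\mathbb{E}_x[e^{-\lambda X_t}]=e^{-xu_t(\lambda)}$ for $x,\lambda,t\ge0$ (with $e^{-\lambda\infty}:=0$), where $u_t(\lambda)$ solves $\partial_tu_t(\lambda)+\psi(u_t(\lambda))-p=0$, $u_0(\lambda)=\lambda$; equivalently it has the branching property $\mathbb{P}_{x_1+x_2}\circ X_t^{-1}=(\mathbb{P}_{x_1}\circ X_t^{-1})*(\mathbb{P}_{x_2}\circ X_t^{-1})$. When $\int^\infty_{\psi^{-1}(0)+1}\frac{1}{\psi}=\infty$ it does not hit $0$ from $x>0$, so its state space may be taken to be $(0,\infty)$. *)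

theory Defs
  imports "HOL-Analysis.Analysis" "HOL-Probability.Probability"
begin

text \<open>Time is modelled by ennreal (t in [0,infinity]); the lifetime zeta and all stopping
  times take values in [0,infinity].  The process X t w is only meaningful for t < zeta w;
  the path with cemetery infinity is the following ereal-valued function.\<close>

definition killed_path :: "(ennreal \<Rightarrow> 'a \<Rightarrow> real) \<Rightarrow> ('a \<Rightarrow> ennreal) \<Rightarrow> 'a \<Rightarrow> ennreal \<Rightarrow> ereal"
  where "killed_path X \<zeta> w = (\<lambda>t. if t < \<zeta> w then ereal (X t w) else \<infinity>)"

definition left_limit_at_zeta :: "(ennreal \<Rightarrow> 'a \<Rightarrow> real) \<Rightarrow> ('a \<Rightarrow> ennreal) \<Rightarrow> 'a \<Rightarrow> ereal"
  where "left_limit_at_zeta X \<zeta> w =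
    (if \<exists>l::ereal. ((\<lambda>s. ereal (X s w)) \<longlongrightarrow> l) (at_left (\<zeta> w))
     then Lim (at_left (\<zeta> w)) (\<lambda>s. ereal (X s w)) else \<infinity>)"

definition first_passage_below :: "(ennreal \<Rightarrow> 'a \<Rightarrow> real) \<Rightarrow> ('a \<Rightarrow> ennreal) \<Rightarrow> real \<Rightarrow> 'a \<Rightarrow> ennreal"
  where "first_passage_below X \<zeta> l w = Inf {t. t < \<zeta> w \<and> X t w \<le> l}"

definition universally_measurable_on :: "real set \<Rightarrow> (real \<Rightarrow> real) \<Rightarrow> bool"
  where "universally_measurable_on I f \<longleftrightarrow>
    (\<forall>\<mu>::real measure. finite_measure \<mu> \<longrightarrow> sets \<mu> = sets (restrict_space borel I) \<longrightarrow>
       f \<in> borel_measurable (completion \<mu>))"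

definition standing_setting ::
  "'a set \<Rightarrow> (real \<Rightarrow> 'a measure) \<Rightarrow> (ennreal \<Rightarrow> 'a measure) \<Rightarrow> (ennreal \<Rightarrow> 'a \<Rightarrow> real)
    \<Rightarrow> ('a \<Rightarrow> ennreal) \<Rightarrow> bool" where
  "standing_setting \<Omega> P F X \<zeta> \<longleftrightarrow>
    \<comment> \<open>complete probability measures on a common sample space, domains containing F_infinity\<close>
    (\<forall>x>0. prob_space (P x) \<and> complete_measure (P x) \<and> space (P x) = \<Omega>
            \<and> sets (F \<infinity>) \<subseteq> sets (P x)) \<and>
    \<comment> \<open>filtration, F_infinity generated by the F_t\<close>
    filtration \<Omega> F \<and>
    sets (F \<infinity>) = sigma_sets \<Omega> (\<Union>t\<in>{t. t < \<infinity>}. sets (F t)) \<and>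
    \<comment> \<open>completeness of the filtration\<close>
    (\<forall>t A B. A \<subseteq> \<Omega> \<longrightarrow> B \<in> sets (F t) \<longrightarrow>
        (\<forall>x>0. (A - B) \<union> (B - A) \<in> null_sets (P x)) \<longrightarrow> A \<in> sets (F t)) \<and>
    \<comment> \<open>adaptedness (with cemetery)\<close>
    (\<forall>t<\<infinity>. (\<lambda>w. killed_path X \<zeta> w t) \<in> borel_measurable (F t)) \<and>
    \<comment> \<open>lifetime\<close>
    stopping_time F \<zeta> \<and>
    (\<forall>x>0. AE w in P x. 0 < \<zeta> w) \<and>
    \<comment> \<open>cadlag paths in I on [0,zeta)\<close>
    (\<forall>w\<in>\<Omega>. \<forall>t. t < \<zeta> w \<longrightarrow>
        0 < X t w \<and> ((\<lambda>s. X s w) \<longlongrightarrow> X t w) (at_right t) \<and>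
        (0 < t \<longrightarrow> (\<exists>l>0. ((\<lambda>s. X s w) \<longlongrightarrow> l) (at_left t)))) \<and>
    \<comment> \<open>left limit at zeta exists in I union {infinity} a.s. on 0 < zeta < infinity\<close>
    (\<forall>x>0. AE w in P x. 0 < \<zeta> w \<and> \<zeta> w < \<infinity> \<longrightarrow>
        (\<exists>l::ereal. 0 < l \<and> ((\<lambda>s. ereal (X s w)) \<longlongrightarrow> l) (at_left (\<zeta> w)))) \<and>
    \<comment> \<open>universal measurability\<close>
    (\<forall>t<\<infinity>. \<forall>A\<in>sets borel. A \<subseteq> {0<..} \<longrightarrow>
        universally_measurable_on {0<..}
          (\<lambda>x. measure (P x) {w\<in>\<Omega>. t < \<zeta> w \<and> X t w \<in> A})) \<and>
    \<comment> \<open>normality\<close>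
    (\<forall>x>0. AE w in P x. X 0 w = x) \<and>
    \<comment> \<open>strong Markov property\<close>
    (\<forall>S H x. stopping_time F S \<longrightarrow> x > 0 \<longrightarrow>
        H \<in> borel_measurable (PiM UNIV (\<lambda>_::ennreal. (borel :: ereal measure))) \<longrightarrow>
        (AE w in P x. S w < \<zeta> w \<longrightarrow>
           nn_cond_exp (P x) (filtration.pre_sigma \<Omega> F S)
              (\<lambda>w'. H (\<lambda>t. killed_path X \<zeta> w' (S w' + t))) w
           = (\<integral>\<^sup>+ w'. H (killed_path X \<zeta> w') \<partial>P (X (S w) w)))) \<and>
    \<comment> \<open>quasi left-continuity\<close>
    (\<forall>T Tl. (\<forall>n. stopping_time F (T n)) \<longrightarrow> stopping_time F Tl \<longrightarrow>
        (\<forall>x>0. AE w in P x. incseq (\<lambda>n. T n w) \<and> (\<lambda>n. T n w) \<longlonglongrightarrow> Tl w) \<longrightarrow>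
        (\<forall>x>0. AE w in P x. Tl w < \<zeta> w \<longrightarrow> (\<lambda>n. X (T n w) w) \<longlonglongrightarrow> X (Tl w) w)) \<and>
    \<comment> \<open>non-announceability\<close>
    (\<forall>T. (\<forall>n. stopping_time F (T n)) \<longrightarrow>
        (\<forall>x>0. AE w in P x. incseq (\<lambda>n. T n w)) \<longrightarrow>
        (\<forall>x>0. AE w in P x.
           \<not> ((\<forall>n. T n w < \<zeta> w) \<and> (\<lambda>n. T n w) \<longlonglongrightarrow> \<zeta> w \<and>
              \<zeta> w < \<infinity> \<and> left_limit_at_zeta X \<zeta> w < \<infinity>)))"

definition no_negative_jumps ::
  "(real \<Rightarrow> 'a measure) \<Rightarrow> (ennreal \<Rightarrow> 'a \<Rightarrow> real) \<Rightarrow> ('a \<Rightarrow> ennreal) \<Rightarrow> bool" where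
  "no_negative_jumps P X \<zeta> \<longleftrightarrow>
    (\<forall>x>0. AE w in P x. \<forall>t l. 0 < t \<longrightarrow> t < \<zeta> w \<longrightarrow>
        ((\<lambda>s. X s w) \<longlongrightarrow> l) (at_left t) \<longrightarrow> l \<le> X t w)"

text \<open>Laplace exponent of a spectrally positive Levy process that is not a subordinator,
  via the Levy-Khintchine triple (gamma, sigma, m).  The process is a subordinator iff
  sigma = 0, int_(0,1] h m(dh) < infinity and gamma - int_(0,1] h m(dh) >= 0.\<close>
definition sp_levy_laplace_exponent :: "(real \<Rightarrow> real) \<Rightarrow> bool" where
  "sp_levy_laplace_exponent \<psi> \<longleftrightarrow>
    (\<exists>(\<gamma>::real) (\<sigma>::real) (m::real measure).
       sets m = sets borel \<and> emeasure m {..0} = 0 \<and>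
       (\<integral>\<^sup>+ h. ennreal (min 1 (h\<^sup>2)) \<partial>m) < \<infinity> \<and>
       \<not> (\<sigma> = 0 \<and> set_integrable m {0<..1} (\<lambda>h. h) \<and> (LINT h:{0<..1}|m. h) \<le> \<gamma>) \<and>
       (\<forall>z\<ge>0. \<psi> z = - \<gamma> * z + \<sigma>\<^sup>2 / 2 * z\<^sup>2
            + (\<integral> h. (exp (- z * h) + z * h * indicator {0<..1} h - 1) \<partial>m)))"

definition rc_inverse :: "(real \<Rightarrow> real) \<Rightarrow> real \<Rightarrow> real" where
  "rc_inverse \<psi> p = Inf {z. 0 \<le> z \<and> p < \<psi> z}"

text \<open>X under (P_x)_(x>0) is a continuous-state branching process with branching mechanism
  psi - p: E_x[exp(-lambda X_t)] = exp(-x u_t(lambda)) (with exp(-lambda infinity) = 0),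
  where u solves d/dt u_t(lambda) + psi(u_t(lambda)) - p = 0, u_0(lambda) = lambda.
  (X is already a Markov process by the standing setting.)\<close>
definition is_CSBP ::
  "(real \<Rightarrow> 'a measure) \<Rightarrow> (ennreal \<Rightarrow> 'a \<Rightarrow> real) \<Rightarrow> ('a \<Rightarrow> ennreal)
     \<Rightarrow> (real \<Rightarrow> real) \<Rightarrow> real \<Rightarrow> bool" where
  "is_CSBP P X \<zeta> \<psi> p \<longleftrightarrow>
    (\<exists>u :: real \<Rightarrow> real \<Rightarrow> real.
       (\<forall>lam\<ge>0. u 0 lam = lam \<and>
          (\<forall>t\<ge>0. 0 \<le> u t lam \<and>
             ((\<lambda>s. u s lam) has_real_derivative (p - \<psi> (u t lam))) (at t within {0..}))) \<and>
       (\<forall>x>0. \<forall>t\<ge>0. \<forall>lam\<ge>0.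
          (\<integral> w. (if ennreal t < \<zeta> w then exp (- lam * X (ennreal t) w) else 0) \<partial>P x)
            = exp (- x * u t lam)))"

end

theory Submission
  imports Defs "HOL-Complex_Analysis.Complex_Analysis" "HOL-Real_Asymp.Real_Asymp"
begin

text \<open>Let \<open>G(z) = \<integral>\<^sub>\<theta>\<^sup>z 1/g\<close> and let \<open>\<Phi>\<^sub>q(x)\<close> be the numerator in the assumed formula.  Splitting the first passage
  time at a fixed time \<open>t\<close> with the Markov property and letting \<open>l \<rightarrow> 0\<close> (where \<open>\<Phi>\<^sub>q(l) / \<Phi>\<^sub>q\<^sub>'(l) \<rightarrow> 0\<close> for
  \<open>q < q'\<close>) gives \<open>E\<^sub>x[\<Phi>\<^sub>q(X\<^sub>t); t < \<zeta>] = exp (q t) \<Phi>\<^sub>q(x)\<close>.  In the variable \<open>s = G(z)\<close> this is an identity of two-sided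
  Laplace transforms in \<open>q\<close>, so uniqueness yields \<open>E\<^sub>x[exp (- z X\<^sub>t); t < \<zeta>] = exp (- x u\<^sub>t(z))\<close> with
  \<open>u\<^sub>t(z) = G\<^sup>-\<^sup>1(G(z) - t)\<close> for \<open>z > z0\<close>.  Hence the laws of \<open>X\<^sub>t\<close> form a convolution semigroup in \<open>x\<close>, which extends the formula
  to all \<open>z \<ge> 0\<close>.  Finally \<open>(z - u\<^sub>t(z)) / t\<close> is, up to \<open>o(1)\<close>, the exponent of a killed compound Poisson process with
  drift and positive jumps; by compactness and uniqueness of such exponents it converges as \<open>t \<rightarrow> 0\<close> to some
  \<open>\<psi>(z) - p\<close> for every \<open>z > 0\<close>, and \<open>u\<^sub>t \<circ> u\<^sub>s = u\<^sub>t\<^sub>+\<^sub>s\<close> turns this into the differential equation.\<close>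

section \<open>Uniqueness for exponential transforms\<close>

text \<open>The hypothesis only involves arguments z > z0, so nothing about the transforms on
  [0, z0] can be read off directly. The descent below z0 is made twice, each time by a uniqueness
  theorem: for the laws of X_t, by identifying finite measures from their transforms on (z0, z0 +
  1); for the small-time exponents, by identifying the measure in their kernel form from its values
  above z0. A second obstacle is that a passage time is an infimum over uncountably many times,
  whereas the Markov property speaks of functionals that are measurable for the product
  sigma-algebra. Passage strictly below a level, observed at countably many times, replaces it;
  continuity in the level closes the gap between strict and weak passage.\<close>

lemma holomorphic_on_exp_transform:
  fixes M :: "real measure"
  assumes sets_M [measurable_cong]: "sets M = sets borel"
    and int: "\<And>r. a < r \<Longrightarrow> r < b \<Longrightarrow> integrable M (\<lambda>s. exp (r * s))"
  shows "(\<lambda>z::complex. \<integral>s. exp (z * of_real s) \<partial>M) holomorphic_on {z. a < Re z \<and> Re z < b}"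
proof (rule holomorphic_onI)
  fix z :: complex assume z: "z \<in> {z. a < Re z \<and> Re z < b}"
  define d where "d = min (Re z - a) (b - Re z) / 3"
  have d: "0 < d" "a < Re z - 2 * d" "Re z + 2 * d < b"
    using z by (auto simp: d_def min_def field_simps)
  have int_ball: "integrable M (\<lambda>s. exp (y * of_real s))" if "y \<in> ball z d" for y :: complex
  proof -
    have "\<bar>Re (y - z)\<bar> < d"
      using that abs_Re_le_cmod[of "y - z"] by (simp add: dist_norm norm_minus_commute)
    then have "integrable M (\<lambda>s. exp (Re y * s))"
      using d by (intro int) auto
    then show ?thesis
      by (rule Bochner_Integration.integrable_bound) (auto simp: norm_exp_eq_Re)
  qed
  let ?F = "\<lambda>z::complex. \<integral>s. exp (z * of_real s) \<partial>M"
  \<comment> \<open>The difference quotient is at most exp (Re z s) |s| exp (d |s|), and |s| is at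
    most exp (d |s|) / d. The two summands cover both signs of s; taking a third in d leaves room
    for the shift by 2 d inside the strip.\<close>
  let ?w = "\<lambda>s. (exp ((Re z + 2 * d) * s) + exp ((Re z - 2 * d) * s)) / d"
  have "((\<lambda>y. (?F y - ?F z) / (y - z)) \<longlongrightarrow> (\<integral>s. of_real s * exp (z * of_real s) \<partial>M)) (at z within ball z d)"
    unfolding tendsto_at_iff_sequentially comp_def
  proof safe
    fix Y assume Y: "\<forall>i. Y i \<in> ball z d - {z}" and lim: "Y \<longlonglongrightarrow> z"
    have "(\<lambda>i. \<integral>s. (exp (Y i * of_real s) - exp (z * of_real s)) / (Y i - z) \<partial>M)
          \<longlonglongrightarrow> (\<integral>s. of_real s * exp (z * of_real s) \<partial>M)"
    proof (rule integral_dominated_convergence[where w="?w"])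
      show "integrable M ?w"
        using d by (intro integrable_divide Bochner_Integration.integrable_add int) auto
      show "AE s in M. (\<lambda>i. (exp (Y i * of_real s) - exp (z * of_real s)) / (Y i - z))
              \<longlonglongrightarrow> complex_of_real s * exp (z * of_real s)"
      proof (rule AE_I2)
        fix s :: real
        have "((\<lambda>y. exp (y * of_real s)) has_field_derivative of_real s * exp (z * of_real s)) (at z)"
          by (auto intro!: derivative_eq_intros)
        then show "(\<lambda>i. (exp (Y i * of_real s) - exp (z * of_real s)) / (Y i - z))
              \<longlonglongrightarrow> complex_of_real s * exp (z * of_real s)"
          using Y lim unfolding has_field_derivative_iff tendsto_at_iff_sequentially comp_def by auto
      qed
      fix i
      have Yi: "Y i \<noteq> z" "cmod (Y i - z) \<le> d"
        using Y[rule_format, of i] by (auto simp: dist_norm norm_minus_commute)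
      show "AE s in M. norm ((exp (Y i * of_real s) - exp (z * of_real s)) / (Y i - z)) \<le> ?w s"
      proof (rule AE_I2)
        fix s :: real
        let ?h = "(Y i - z) * of_real s"
        have "cmod (exp ?h - 1) \<le> exp \<bar>Re ?h\<bar> * cmod ?h"
          using Taylor_exp[of ?h 0] by simp
        also have "\<dots> \<le> exp (d * \<bar>s\<bar>) * cmod ?h"
        proof (intro mult_right_mono)
          have "\<bar>Re ?h\<bar> \<le> cmod (Y i - z) * \<bar>s\<bar>"
            using abs_Re_le_cmod[of ?h] by (simp add: norm_mult)
          also have "\<dots> \<le> d * \<bar>s\<bar>"
            using Yi by (intro mult_right_mono) auto
          finally show "exp \<bar>Re ?h\<bar> \<le> exp (d * \<bar>s\<bar>)" by simp
        qed auto
        finally have 1: "cmod (exp ?h - 1) / cmod (Y i - z) \<le> exp (d * \<bar>s\<bar>) * \<bar>s\<bar>"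
          using Yi by (simp add: norm_mult pos_divide_le_eq mult.assoc mult.commute mult.left_commute del: left_diff_distrib)
        have "d * \<bar>s\<bar> \<le> exp (d * \<bar>s\<bar>)"
          using exp_ge_add_one_self[of "d * \<bar>s\<bar>"] by linarith
        then have "\<bar>s\<bar> \<le> exp (d * \<bar>s\<bar>) / d"
          using d by (simp add: field_simps)
        then have "exp (d * \<bar>s\<bar>) * \<bar>s\<bar> \<le> exp (d * \<bar>s\<bar>) * (exp (d * \<bar>s\<bar>) / d)"
          by (intro mult_left_mono) auto
        also have "\<dots> = exp (2 * d * \<bar>s\<bar>) / d"
          by (simp add: exp_add[symmetric])
        finally have 2: "cmod (exp ?h - 1) / cmod (Y i - z) \<le> exp (2 * d * \<bar>s\<bar>) / d"
          using 1 by linarith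
        have "exp (Y i * of_real s) - exp (z * of_real s) = exp (z * of_real s) * (exp ?h - 1)"
          by (simp add: algebra_simps exp_add[symmetric])
        then have "norm ((exp (Y i * of_real s) - exp (z * of_real s)) / (Y i - z))
            = exp (Re z * s) * (cmod (exp ?h - 1) / cmod (Y i - z))"
          by (simp add: norm_divide norm_mult norm_exp_eq_Re)
        also have "\<dots> \<le> exp (Re z * s) * (exp (2 * d * \<bar>s\<bar>) / d)"
          by (intro mult_left_mono 2) auto
        also have "\<dots> = exp (Re z * s + 2 * d * \<bar>s\<bar>) / d"
          by (simp add: exp_add)
        also have "\<dots> \<le> ?w s"
          using d by (intro divide_right_mono) (auto simp: abs_if algebra_simps)
        finally show "norm ((exp (Y i * of_real s) - exp (z * of_real s)) / (Y i - z)) \<le> ?w s" .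
      qed
    qed measurable
    moreover have "(\<integral>s. (exp (Y i * of_real s) - exp (z * of_real s)) / (Y i - z) \<partial>M)
        = (?F (Y i) - ?F z) / (Y i - z)" for i
      using Y d by (subst integral_divide_zero, subst Bochner_Integration.integral_diff)
        (auto intro!: int_ball)
    ultimately show "(\<lambda>i. (?F (Y i) - ?F z) / (Y i - z)) \<longlonglongrightarrow> (\<integral>s. of_real s * exp (z * of_real s) \<partial>M)"
      by (simp only:)
  qed
  then have "(?F has_field_derivative (\<integral>s. of_real s * exp (z * of_real s) \<partial>M)) (at z)"
    unfolding has_field_derivative_iff using d at_within_open[of z "ball z d"] by simp
  then show "?F field_differentiable at z within {z. a < Re z \<and> Re z < b}"
    using field_differentiable_at_within field_differentiable_def by blast
qed

text \<open>Tilting by exp (q s) turns possibly infinite measures into finite ones. On the vertical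
  line through q the holomorphic extension of the transform is, up to normalisation, the
  characteristic function of the tilted measure; Levy's uniqueness theorem applies and the tilt is
  divided out again.\<close>

lemma exp_transform_unique:
  fixes M N :: "real measure"
  assumes sets_M [measurable_cong]: "sets M = sets borel"
    and sets_N [measurable_cong]: "sets N = sets borel"
    and ab: "a < b"
    and eq: "\<And>r. a < r \<Longrightarrow> r < b \<Longrightarrow> (\<integral>\<^sup>+s. ennreal (exp (r * s)) \<partial>M) = (\<integral>\<^sup>+s. ennreal (exp (r * s)) \<partial>N)"
    and fin: "\<And>r. a < r \<Longrightarrow> r < b \<Longrightarrow> (\<integral>\<^sup>+s. ennreal (exp (r * s)) \<partial>M) < \<infinity>"
  shows "M = N"
proof -
  define q where "q = (a + b) / 2"
  have q: "a < q" "q < b" using ab by (auto simp: q_def)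
  define c where "c = enn2real (\<integral>\<^sup>+s. ennreal (exp (q * s)) \<partial>M)"
  have c_M: "(\<integral>\<^sup>+s. ennreal (exp (q * s)) \<partial>M) = ennreal c"
    and c_N: "(\<integral>\<^sup>+s. ennreal (exp (q * s)) \<partial>N) = ennreal c"
    using fin[OF q] eq[OF q] by (auto simp: c_def)
  have c0: "0 \<le> c" by (simp add: c_def)
  have sp: "space M = UNIV" "space N = UNIV"
    using sets_eq_imp_space_eq[OF sets_M] sets_eq_imp_space_eq[OF sets_N] by auto
  show ?thesis
  \<comment> \<open>The normalisation below divides by c; if c = 0 both measures vanish.\<close>
  proof (cases "c = 0")
    case True
    then have "AE s in M. False" "AE s in N. False"
      using c_M c_N by (auto simp: nn_integral_0_iff_AE)
    then have "emeasure M (space M) = 0" "emeasure N (space N) = 0"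
      by (auto simp: AE_iff_measurable[OF _ refl])
    then have "emeasure M A = 0" "emeasure N A = 0" for A
      using emeasure_space[of M A] emeasure_space[of N A] by auto
    then show ?thesis
      by (intro measure_eqI) (auto simp: sets_M sets_N)
  next
    case False
    then have c: "0 < c" using c0 by simp
    have int_M: "integrable M (\<lambda>s. exp (r * s))" if "a < r" "r < b" for r
      using fin[OF that] by (intro integrableI_nonneg) auto
    have int_N: "integrable N (\<lambda>s. exp (r * s))" if "a < r" "r < b" for r
      using fin[OF that] eq[OF that] by (intro integrableI_nonneg) auto
    let ?S = "{z::complex. a < Re z \<and> Re z < b}"
    let ?FM = "\<lambda>z::complex. \<integral>s. exp (z * of_real s) \<partial>M"
    let ?FN = "\<lambda>z::complex. \<integral>s. exp (z * of_real s) \<partial>N"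
    have S: "?S = {z. a < Re z} \<inter> {z. Re z < b}" by auto
    have FMN: "?FM z = ?FN z" if z: "z \<in> ?S" for z
    proof -
      have "?FM z - ?FN z = 0"
      proof (rule analytic_continuation[where S="?S" and U="of_real ` {a<..<b}" and \<xi>="of_real q"
              and f="\<lambda>z. ?FM z - ?FN z"])
        show "(\<lambda>z. ?FM z - ?FN z) holomorphic_on ?S"
          by (intro holomorphic_intros holomorphic_on_exp_transform sets_M sets_N int_M int_N)
        show "open ?S"
          unfolding S by (intro open_Int open_halfspace_Re_gt open_halfspace_Re_lt)
        show "connected ?S"
          unfolding S
          by (intro convex_connected convex_Int convex_halfspace_Re_gt convex_halfspace_Re_lt)
        show "complex_of_real ` {a<..<b} \<subseteq> ?S" "complex_of_real q \<in> ?S"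
          using q by auto
        have "q islimpt {a<..<b}"
          using q by (simp add: open_imp_islimpt)
        then show "complex_of_real q islimpt of_real ` {a<..<b}"
          using islimpt_isCont_image[of q "{a<..<b}" complex_of_real]
          by (auto simp: eventually_at_filter)
        show "?FM z - ?FN z = 0" if "z \<in> complex_of_real ` {a<..<b}" for z
        proof -
          from that obtain r where r: "a < r" "r < b" "z = of_real r" by auto
          have FM: "?FM z = of_real (\<integral>s. exp (r * s) \<partial>M)"
            unfolding r(3) integral_complex_of_real[symmetric]
            by (simp only: of_real_mult[symmetric] exp_of_real)
          have FN: "?FN z = of_real (\<integral>s. exp (r * s) \<partial>N)"
            unfolding r(3) integral_complex_of_real[symmetric]
            by (simp only: of_real_mult[symmetric] exp_of_real)
          show ?thesis
            unfolding FM FN using eq[OF r(1,2)] by (simp add: integral_eq_nn_integral)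
        qed
      qed (use z in auto)
      then show ?thesis by simp
    qed
    define M' where "M' = density M (\<lambda>s. ennreal (exp (q * s) / c))"
    define N' where "N' = density N (\<lambda>s. ennreal (exp (q * s) / c))"
    have [measurable_cong]: "sets M' = sets borel" "sets N' = sets borel"
      by (auto simp: M'_def N'_def sets_M sets_N)
    have one: "ennreal c / ennreal c = 1"
      using c by (simp add: divide_ennreal)
    have "emeasure M' (space M') = 1"
      using c one by (simp add: M'_def emeasure_density divide_ennreal[symmetric] nn_integral_divide c_M sp)
    moreover have "emeasure N' (space N') = 1"
      using c one by (simp add: N'_def emeasure_density divide_ennreal[symmetric] nn_integral_divide c_N sp)
    ultimately have pr: "prob_space M'" "prob_space N'"
      by (auto intro: prob_spaceI)
    have "real_distribution M'" "real_distribution N'"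
      using pr by (auto intro!: real_distribution.intro real_distribution_axioms.intro
          simp: M'_def N'_def sets_M sets_N sp)
    moreover have "char M' = char N'"
    proof
      fix t
      have e: "(exp (q * s) / c) *\<^sub>R iexp (t * s) = exp (Complex q t * of_real s) / c" for s
      proof -
        have "Complex q t * of_real s = of_real (q * s) + \<i> * of_real (t * s)"
          by (simp add: complex_eq_iff)
        then have "exp (Complex q t * of_real s) = of_real (exp (q * s)) * iexp (t * s)"
          by (simp only: exp_add exp_of_real)
        then show ?thesis
          by (simp add: scaleR_conv_of_real)
      qed
      have "char M' t = ?FM (Complex q t) / c"
      proof -
        have "char M' t = (\<integral>s. (exp (q * s) / c) *\<^sub>R iexp (t * s) \<partial>M)"
          unfolding char_def M'_def using c by (subst integral_density) auto
        then show ?thesis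
          by (simp only: e integral_divide_zero)
      qed
      moreover have "char N' t = ?FN (Complex q t) / c"
      proof -
        have "char N' t = (\<integral>s. (exp (q * s) / c) *\<^sub>R iexp (t * s) \<partial>N)"
          unfolding char_def N'_def using c by (subst integral_density) auto
        then show ?thesis
          by (simp only: e integral_divide_zero)
      qed
      ultimately show "char M' t = char N' t"
        using FMN[of "Complex q t"] q by simp
    qed
    ultimately have "M' = N'"
      by (rule Levy_uniqueness)
    have inv: "ennreal (exp (q * s) / c) * ennreal (c / exp (q * s)) = 1" for s
      using c by (simp add: ennreal_mult[symmetric])
    have "M = density M' (\<lambda>s. ennreal (c / exp (q * s)))"
      unfolding M'_def by (subst density_density_eq) (auto simp: inv density_1)
    also have "\<dots> = density N' (\<lambda>s. ennreal (c / exp (q * s)))"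
      by (simp add: \<open>M' = N'\<close>)
    also have "\<dots> = N"
      unfolding N'_def by (subst density_density_eq) (auto simp: inv density_1)
    finally show ?thesis .
  qed
qed

section \<open>Limits of Levy exponents\<close>

text \<open>The integrand exp (-z h) - 1 + z (1 - exp (-h)) divided by (1 - exp (-h))^2, in the
  variable y = exp (-h). The smooth compensator 1 - exp (-h) lets it extend to y = 0 (infinite
  jumps) and y = 1 (vanishing jumps). The outer branches hold the limits there, so that for z > 0
  the function is bounded and continuous on the whole line, as weak convergence demands.\<close>

definition levy_kernel :: "real \<Rightarrow> real \<Rightarrow> real" where
  "levy_kernel z y =
    (if y \<le> 0 then z - 1 else if 1 \<le> y then (z\<^sup>2 - z) / 2
     else (y powr z - 1 + z * (1 - y)) / (1 - y)\<^sup>2)"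

lemma levy_kernel_exp:
  assumes "0 < h"
  shows "(1 - exp (- h))\<^sup>2 * levy_kernel z (exp (- h)) = exp (- z * h) - 1 + z * (1 - exp (- h))"
proof -
  have "exp (- h) < 1" using assms by simp
  then have "(1 - exp (- h))\<^sup>2 \<noteq> 0" "\<not> 1 \<le> exp (- h)"
    by auto
  then show ?thesis
    using exp_gt_zero[of "- h"] by (simp add: levy_kernel_def powr_def not_le mult.commute)
qed

text \<open>Second differences in z annihilate affine terms and leave the powers y^z, that is, an
  exponential transform in ln y. This opens the way to \<open>exp_transform_unique\<close>.\<close>

lemma levy_kernel_second_difference:
  "levy_kernel z y - 2 * levy_kernel (z + 1) y + levy_kernel (z + 2) y
   = (if y \<le> 0 then 0 else if 1 \<le> y then 1 else y powr z)"
proof (cases "0 < y \<and> y < 1")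
  case True
  have comb: "p / d - 2 * (q / d) + r / d = (p - 2 * q + r) / d" for p q r d :: real
    by (simp add: add_divide_distrib diff_divide_distrib)
  have "levy_kernel z y = (y powr z - 1 + z * (1 - y)) / (1 - y)\<^sup>2"
    "levy_kernel (z + 1) y = (y powr z * y - 1 + (z + 1) * (1 - y)) / (1 - y)\<^sup>2"
    "levy_kernel (z + 2) y = (y powr z * y\<^sup>2 - 1 + (z + 2) * (1 - y)) / (1 - y)\<^sup>2"
    using True by (simp_all add: levy_kernel_def powr_add)
  moreover have "y powr z - 1 + z * (1 - y) - 2 * (y powr z * y - 1 + (z + 1) * (1 - y))
      + (y powr z * y\<^sup>2 - 1 + (z + 2) * (1 - y)) = y powr z * (1 - y)\<^sup>2"
    by (simp add: power2_eq_square algebra_simps)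
  ultimately have "levy_kernel z y - 2 * levy_kernel (z + 1) y + levy_kernel (z + 2) y
      = y powr z * (1 - y)\<^sup>2 / (1 - y)\<^sup>2"
    by (simp only: comb)
  then show ?thesis using True by simp
next
  case False
  then show ?thesis
    by (auto simp: levy_kernel_def power2_eq_square field_simps)
qed

text \<open>Continuity at y = 0 rests on y^z tending to 0, which is where z > 0 enters: for z = 0
  the kernel jumps there from -1 to 0.\<close>

lemma isCont_levy_kernel:
  assumes z: "0 < z"
  shows "isCont (levy_kernel z) y"
proof -
  let ?f = "\<lambda>y. (y powr z - 1 + z * (1 - y)) / (1 - y)\<^sup>2"
  have split: "isCont (levy_kernel z) y"
    if "(levy_kernel z \<longlongrightarrow> levy_kernel z y) (at_left y)" "(levy_kernel z \<longlongrightarrow> levy_kernel z y) (at_right y)" for y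
    using that unfolding isCont_def filterlim_at_split by simp
  consider "y < 0" | "y = 0" | "0 < y" "y < 1" | "y = 1" | "1 < y" by linarith
  then show ?thesis
  proof cases
    case 1
    have "\<forall>\<^sub>F x in nhds y. levy_kernel z x = z - 1"
      using eventually_nhds_in_open[of "{..<0}" y] 1
      by (auto elim!: eventually_mono simp: levy_kernel_def)
    then show ?thesis by (simp add: isCont_cong)
  next
    case 2
    show ?thesis
    proof (rule split)
      have "\<forall>\<^sub>F x in at_left 0. levy_kernel z x = z - 1"
        by (auto simp: eventually_at_filter levy_kernel_def)
      then show "(levy_kernel z \<longlongrightarrow> levy_kernel z y) (at_left y)"
        using 2 by (simp add: tendsto_cong levy_kernel_def)
      have "\<forall>\<^sub>F x in at_right 0. x < (1::real)"
        by (rule order_tendstoD(2)[OF tendsto_ident_at]) simp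
      then have "\<forall>\<^sub>F x in at_right 0. levy_kernel z x = ?f x"
        using eventually_at_right_less[of 0] by eventually_elim (auto simp: levy_kernel_def)
      moreover have "(?f \<longlongrightarrow> z - 1) (at_right 0)"
        using z by real_asymp
      ultimately show "(levy_kernel z \<longlongrightarrow> levy_kernel z y) (at_right y)"
        using 2 by (simp add: tendsto_cong levy_kernel_def)
    qed
  next
    case 3
    have "\<forall>\<^sub>F x in nhds y. levy_kernel z x = ?f x"
      using eventually_nhds_in_open[of "{0<..<1}" y] 3
      by (auto elim!: eventually_mono simp: levy_kernel_def)
    moreover have "isCont ?f y"
      using 3 by (intro continuous_intros) auto
    ultimately show ?thesis by (simp add: isCont_cong)
  next
    case 4
    show ?thesis
    proof (rule split)
      show "(levy_kernel z \<longlongrightarrow> levy_kernel z y) (at_right y)"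
        using 4 by (intro tendsto_eventually) (auto simp: eventually_at_filter levy_kernel_def)
      have "\<forall>\<^sub>F x in at_left 1. 0 < (x::real)"
        by (rule order_tendstoD(1)[OF tendsto_ident_at]) simp
      moreover have "\<forall>\<^sub>F x in at_left 1. x < (1::real)"
        by (auto simp: eventually_at_filter)
      ultimately have "\<forall>\<^sub>F x in at_left 1. levy_kernel z x = ?f x"
        by eventually_elim (auto simp: levy_kernel_def)
      moreover have "(?f \<longlongrightarrow> (z - 1) * z / 2) (at_left 1)"
        using z by real_asymp
      moreover have "levy_kernel z y = (z - 1) * z / 2"
        using 4 by (simp add: levy_kernel_def power2_eq_square algebra_simps)
      ultimately show "(levy_kernel z \<longlongrightarrow> levy_kernel z y) (at_left y)"
        using 4 by (simp only: tendsto_cong)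
    qed
  next
    case 5
    have "\<forall>\<^sub>F x in nhds y. levy_kernel z x = levy_kernel z y"
      using eventually_nhds_in_open[of "{1<..}" y] 5
      by (auto elim!: eventually_mono simp: levy_kernel_def)
    from isCont_cong[OF this] show ?thesis by simp
  qed
qed

lemma borel_measurable_levy_kernel [measurable]: "levy_kernel z \<in> borel_measurable borel"
  unfolding levy_kernel_def by measurable

lemma levy_kernel_bounded:
  assumes z: "0 < z"
  obtains B where "\<And>y. \<bar>levy_kernel z y\<bar> \<le> B"
proof -
  have "compact (levy_kernel z ` {0..1})"
    using z by (intro compact_continuous_image continuous_at_imp_continuous_on)
      (auto intro: isCont_levy_kernel)
  then obtain B where B: "\<forall>y\<in>{0..1}. \<bar>levy_kernel z y\<bar> \<le> B"
    by (auto dest!: compact_imp_bounded simp: bounded_iff)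
  have "\<bar>levy_kernel z y\<bar> \<le> B" for y
  proof -
    have "levy_kernel z y = levy_kernel z (max 0 (min 1 y))"
      by (auto simp: levy_kernel_def)
    then show ?thesis using B by auto
  qed
  then show ?thesis by (rule that)
qed

text \<open>With \<open>y = exp (-h)\<close> the jump sizes \<open>h \<in> [0, \<infinity>]\<close> become the compact interval \<open>[0, 1]\<close>: in the limit the
  mass at \<open>y = 1\<close> is the Gaussian part and the mass at \<open>y = 0\<close> the killing rate.\<close>

lemma levy_exponent_sequence_compact:
  fixes a b :: "nat \<Rightarrow> real" and N :: "nat \<Rightarrow> real measure" and g :: "real \<Rightarrow> real"
  defines "L \<equiv> \<lambda>n z. - a n + b n * z + (\<integral>h. exp (- z * h) - 1 \<partial>N n)"
  assumes fin: "\<And>n. finite_measure (N n)" and sets_N: "\<And>n. sets (N n) = sets borel"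
    and pos: "\<And>n. AE h in N n. 0 < h" and a: "\<And>n. 0 \<le> a n"
    and conv: "\<And>z. z0 < z \<Longrightarrow> (\<lambda>n. L n z) \<longlonglongrightarrow> g z"
  obtains r A \<beta> c M where "strict_mono (r :: nat \<Rightarrow> nat)" "0 \<le> A" "0 \<le> c" "real_distribution M"
    "AE y in M. 0 \<le> y \<and> y \<le> 1"
    "\<And>z. 0 < z \<Longrightarrow> (\<lambda>n. L (r n) z) \<longlonglongrightarrow> - A + \<beta> * z + c * (\<integral>y. levy_kernel z y \<partial>M)"
proof -
  note [measurable_cong] = sets_N
  \<comment> \<open>\<open>m n\<close> is the mass after weighting by (1 - exp (-h))^2,
    \<open>b'\<close> is the drift with the compensator absorbed, and \<open>M n\<close> is the
    normalised weighted measure in the variable y. If \<open>m n\<close> is 0, the Dirac mass is a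
    placeholder: it only occurs multiplied by \<open>m n\<close>.\<close>
  define m where "m n = (\<integral>h. (1 - exp (- h))\<^sup>2 \<partial>N n)" for n
  define b' where "b' n = b n - (\<integral>h. 1 - exp (- h) \<partial>N n)" for n
  define M where "M n = (if m n = 0 then return borel 0
     else distr (density (N n) (\<lambda>h. ennreal ((1 - exp (- h))\<^sup>2 / m n))) borel (\<lambda>h. exp (- h)))" for n
  have int_bdd: "integrable (N n) f" if "f \<in> borel_measurable borel" "\<And>h. 0 < h \<Longrightarrow> \<bar>f h\<bar> \<le> B"
    for f :: "real \<Rightarrow> real" and B n
    using pos[of n] that by (intro finite_measure.integrable_const_bound[OF fin, where B=B]) auto
  have exp_le1: "\<bar>exp (- (z * h)) - 1\<bar> \<le> 1" "\<bar>1 - exp (- (z * h))\<bar> \<le> 1" if "0 \<le> z" "0 < h" for z h :: real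
  proof -
    have "0 \<le> z * h" using that by simp
    then show "\<bar>exp (- (z * h)) - 1\<bar> \<le> 1" "\<bar>1 - exp (- (z * h))\<bar> \<le> 1"
      using exp_gt_zero[of "- (z * h)"] exp_le_one_iff[of "- (z * h)"] by linarith+
  qed
  have sq_le1: "(1 - exp (- (z * h)))\<^sup>2 \<le> 1" if "0 \<le> z" "0 < h" for z h :: real
    using exp_le1[OF that] by (simp add: abs_square_le_1)
  have int_exp: "integrable (N n) (\<lambda>h. exp (- z * h) - 1)" if "0 \<le> z" for n z
    using exp_le1[OF that] by (intro int_bdd[where B=1]) auto
  have int_sq: "integrable (N n) (\<lambda>h. (1 - exp (- z * h))\<^sup>2)" if "0 \<le> z" for n z
    using sq_le1[OF that] by (intro int_bdd[where B=1]) auto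
  have int_one: "integrable (N n) (\<lambda>h. 1 - exp (- h))" for n
    using exp_le1[of 1] by (intro int_bdd[where B=1]) auto
  have m0: "0 \<le> m n" for n by (simp add: m_def)
  have rd: "real_distribution (M n)" for n
  proof (cases "m n = 0")
    case True
    then show ?thesis
      by (auto simp: M_def intro!: real_distribution.intro real_distribution_axioms.intro prob_space_return)
  next
    case False
    have "(\<integral>\<^sup>+h. ennreal ((1 - exp (- h))\<^sup>2 / m n) \<partial>N n) = ennreal (\<integral>h. (1 - exp (- h))\<^sup>2 / m n \<partial>N n)"
      using int_sq[of 1 n] m0[of n] by (intro nn_integral_eq_integral) auto
    also have "\<dots> = 1"
      using False by (simp add: m_def)
    finally have "prob_space (density (N n) (\<lambda>h. ennreal ((1 - exp (- h))\<^sup>2 / m n)))"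
      by (intro prob_spaceI) (simp add: emeasure_density sets_eq_imp_space_eq[OF sets_N])
    then have "prob_space (M n)"
      using False by (auto simp: M_def intro!: prob_space.prob_space_distr)
    then show ?thesis
      using False by (auto simp: M_def intro!: real_distribution.intro real_distribution_axioms.intro)
  qed
  have supp: "AE y in M n. 0 \<le> y \<and> y \<le> 1" for n
  proof (cases "m n = 0")
    case False
    have "AE h in N n. 0 \<le> exp (- h) \<and> exp (- h) \<le> 1"
      using pos[of n] by eventually_elim auto
    then have "AE h in density (N n) (\<lambda>h. ennreal ((1 - exp (- h))\<^sup>2 / m n)). 0 \<le> exp (- h) \<and> exp (- h) \<le> 1"
      by (subst AE_density) (auto elim!: eventually_mono)
    then have "AE y in distr (density (N n) (\<lambda>h. ennreal ((1 - exp (- h))\<^sup>2 / m n))) borel (\<lambda>h. exp (- h)).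
        0 \<le> y \<and> y \<le> 1"
      by (subst AE_distr_iff) auto
    then show ?thesis
      using False by (simp only: M_def if_False)
  next
    case True
    then show ?thesis
      by (simp only: M_def if_True) (simp add: AE_return)
  qed
  have L_eq: "L n z = - a n + b' n * z + m n * (\<integral>y. levy_kernel z y \<partial>M n)" if z: "0 \<le> z" for n z
  proof -
    have "(\<integral>h. exp (- z * h) - 1 \<partial>N n) + z * (\<integral>h. 1 - exp (- h) \<partial>N n)
        = (\<integral>h. exp (- z * h) - 1 + z * (1 - exp (- h)) \<partial>N n)"
      using int_exp[OF z] int_one by (subst Bochner_Integration.integral_add) auto
    also have "\<dots> = (\<integral>h. (1 - exp (- h))\<^sup>2 * levy_kernel z (exp (- h)) \<partial>N n)"
      using pos[of n] levy_kernel_exp by (intro integral_cong_AE) (auto elim!: eventually_mono)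
    also have "\<dots> = m n * (\<integral>y. levy_kernel z y \<partial>M n)"
    proof (cases "m n = 0")
      case True
      then have "AE h in N n. (1 - exp (- h))\<^sup>2 = 0"
        using integral_nonneg_eq_0_iff_AE[of "N n" "\<lambda>h. (1 - exp (- h))\<^sup>2"] int_sq[of 1 n]
        by (auto simp: m_def)
      then have "(\<integral>h. (1 - exp (- h))\<^sup>2 * levy_kernel z (exp (- h)) \<partial>N n) = 0"
        by (intro integral_eq_zero_AE) (auto elim!: eventually_mono)
      then show ?thesis using True by simp
    next
      case False
      have "(\<integral>y. levy_kernel z y \<partial>M n)
          = (\<integral>h. (1 - exp (- h))\<^sup>2 / m n * levy_kernel z (exp (- h)) \<partial>N n)"
        using False m0[of n] by (simp add: M_def integral_distr integral_density)
      also have "\<dots> = (\<integral>h. (1 - exp (- h))\<^sup>2 * levy_kernel z (exp (- h)) \<partial>N n) / m n"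
        by (subst integral_divide_zero[symmetric]) (simp add: mult.commute)
      finally show ?thesis using False by simp
    qed
    finally show ?thesis
      by (simp add: L_def b'_def algebra_simps)
  qed
  \<comment> \<open>Both w and 2 w exceed z0, where L converges; w >= 1 makes (1 - exp (-w h))^2
    dominate the weight (1 - exp (-h))^2.\<close>
  define w where "w = max 1 (z0 + 1)"
  have w: "1 \<le> w" "z0 < w" "z0 < 2 * w" by (auto simp: w_def max_def)
  obtain C where C: "\<And>n. \<bar>L n w\<bar> \<le> C" "\<And>n. \<bar>L n (2 * w)\<bar> \<le> C"
  proof -
    obtain C1 C2 where "\<And>n. \<bar>L n w\<bar> \<le> C1" "\<And>n. \<bar>L n (2 * w)\<bar> \<le> C2"
      using convergent_imp_Bseq[OF convergentI[OF conv[OF w(2)]]] convergent_imp_Bseq[OF convergentI[OF conv[OF w(3)]]]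
      unfolding Bseq_def real_norm_def by blast
    then show ?thesis
      by (intro that[of "max C1 C2"]) (auto simp: le_max_iff_disj)
  qed
  \<comment> \<open>The second difference with step w started at 0, where L equals -a: the drift
    cancels and a nonnegative integral remains. Its sign bounds \<open>a\<close>, its size bounds
    \<open>m\<close>.\<close>
  have second_diff: "- a n - 2 * L n w + L n (2 * w) = (\<integral>h. (1 - exp (- w * h))\<^sup>2 \<partial>N n)" for n
  proof -
    have "(1 - exp (- w * h))\<^sup>2 = (exp (- (2 * w) * h) - 1) - 2 * (exp (- w * h) - 1)" for h
      by (simp add: power2_eq_square algebra_simps exp_add[symmetric])
    then show ?thesis
      using w by (simp only: Bochner_Integration.integral_diff[OF int_exp integrable_mult_right[OF int_exp]]
          integral_mult_right_zero L_def) (simp add: Bochner_Integration.integral_diff int_exp)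
  qed
  have sq_nonneg: "0 \<le> (\<integral>h. (1 - exp (- w * h))\<^sup>2 \<partial>N n)" for n
    by simp
  have a_le: "\<bar>a n\<bar> \<le> 3 * C" for n
    using second_diff[of n] sq_nonneg[of n] C(1,2)[of n] a[of n] by linarith
  have m_le: "\<bar>m n\<bar> \<le> 3 * C" for n
  proof -
    have "m n \<le> (\<integral>h. (1 - exp (- w * h))\<^sup>2 \<partial>N n)"
      unfolding m_def
    proof (rule integral_mono_AE)
      show "AE h in N n. (1 - exp (- h))\<^sup>2 \<le> (1 - exp (- w * h))\<^sup>2"
        using pos[of n]
      proof eventually_elim
        case (elim h)
        then have "1 * h \<le> w * h" using w by (intro mult_right_mono) auto
        then show ?case
          using elim by (intro power_mono) auto
      qed
    qed (use int_sq[of 1] int_sq[of w] w in auto)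
    then show ?thesis
      using second_diff[of n] C(1,2)[of n] a[of n] m0[of n] by linarith
  qed
  obtain B where B: "\<And>y. \<bar>levy_kernel w y\<bar> \<le> B"
    using levy_kernel_bounded[of w] w by auto
  have int_K: "\<bar>\<integral>y. levy_kernel w y \<partial>M n\<bar> \<le> B" for n
  proof -
    interpret real_distribution "M n" by (rule rd)
    have "\<bar>\<integral>y. levy_kernel w y \<partial>M n\<bar> \<le> (\<integral>y. \<bar>levy_kernel w y\<bar> \<partial>M n)"
      by (rule integral_abs_bound)
    also have "\<dots> \<le> (\<integral>y. B \<partial>M n)"
      using B by (intro integral_mono) (auto intro!: integrable_const_bound[where B=B])
    finally show ?thesis using prob_space by simp
  qed
  have b_le: "\<bar>b' n\<bar> \<le> C + 3 * C + 3 * C * B" for n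
  proof -
    have "\<bar>b' n\<bar> * 1 \<le> \<bar>b' n\<bar> * w"
      using w by (intro mult_left_mono) auto
    also have "\<dots> = \<bar>b' n * w\<bar>"
      using w by (simp add: abs_mult)
    also have "b' n * w = L n w + a n - m n * (\<integral>y. levy_kernel w y \<partial>M n)"
      using L_eq[of w n] w by simp
    also have "\<bar>\<dots>\<bar> \<le> \<bar>L n w\<bar> + \<bar>a n\<bar> + \<bar>m n\<bar> * \<bar>\<integral>y. levy_kernel w y \<partial>M n\<bar>"
      by (simp add: abs_mult[symmetric])
    also have "\<dots> \<le> C + 3 * C + 3 * C * B"
      using m_le[of n] int_K[of n] a_le[of n] C(1)[of n]
      by (intro add_mono mult_mono) auto
    finally show ?thesis by simp
  qed
  have "bounded (range (\<lambda>n. (a n, b' n, m n)))"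
  proof -
    have "range (\<lambda>n. (a n, b' n, m n)) \<subseteq> cball 0 (3*C) \<times> cball 0 (C + 3 * C + 3 * C * B) \<times> cball 0 (3*C)"
      using a_le b_le m_le by auto
    then show ?thesis
      by (rule bounded_subset[rotated]) (intro bounded_Times bounded_cball)
  qed
  then obtain l s where s: "strict_mono (s :: nat \<Rightarrow> nat)" and l: "((\<lambda>n. (a n, b' n, m n)) \<circ> s) \<longlonglongrightarrow> l"
    using bounded_imp_convergent_subsequence by blast
  obtain A \<beta> c where labc: "l = (A, \<beta>, c)" by (cases l) auto
  have lims: "(\<lambda>n. a (s n)) \<longlonglongrightarrow> A" "(\<lambda>n. b' (s n)) \<longlonglongrightarrow> \<beta>" "(\<lambda>n. m (s n)) \<longlonglongrightarrow> c"
    using tendsto_fst[OF l] tendsto_fst[OF tendsto_snd[OF l]] tendsto_snd[OF tendsto_snd[OF l]]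
    by (auto simp: labc comp_def)
  have "tight M"
    unfolding tight_def
  proof (intro conjI allI impI rd)
    fix \<epsilon> :: real assume "0 < \<epsilon>"
    \<comment> \<open>All \<open>M n\<close> live on [0, 1]; the left end lies below 0 because
      tightness is stated with left-open intervals and an atom at 0 is possible.\<close>
    have "measure (M n) {-1<..1} = 1" for n
    proof -
      interpret real_distribution "M n" by (rule rd)
      show ?thesis using supp[of n] by (subst prob_eq_1) (auto elim!: eventually_mono)
    qed
    then show "\<exists>a b. a < b \<and> (\<forall>n. 1 - \<epsilon> < measure (M n) {a<..b})"
      using \<open>0 < \<epsilon>\<close> by (intro exI[of _ "-1"] exI[of _ 1]) auto
  qed
  then obtain r M0 where r: "strict_mono (r :: nat \<Rightarrow> nat)" and M0: "real_distribution M0"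
    and weak: "weak_conv_m (M \<circ> s \<circ> r) M0"
    using tight_imp_convergent_subsubsequence s by blast
  have weak_int: "(\<lambda>n. \<integral>y. f y \<partial>M (s (r n))) \<longlonglongrightarrow> (\<integral>y. f y \<partial>M0)"
    if "\<And>y. isCont f y" "\<And>y. \<bar>f y\<bar> \<le> B" for f :: "real \<Rightarrow> real" and B
    using weak_conv_imp_integral_bdd_continuous_conv[OF _ M0 weak, of f B] that rd
    by (auto simp: comp_def)
  interpret M0: real_distribution M0 by (rule M0)
  \<comment> \<open>A bounded continuous function that vanishes exactly on [0, 1]. Its integrals are
    0 along the sequence, so the weak limit also lives on [0, 1].\<close>
  let ?out = "\<lambda>y::real. min 1 (max 0 (- y) + max 0 (y - 1))"
  have out_int: "integrable M0 ?out"
    by (intro M0.integrable_const_bound[where B=1]) auto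
  have "(\<lambda>n. \<integral>y. ?out y \<partial>M (s (r n))) \<longlonglongrightarrow> (\<integral>y. ?out y \<partial>M0)"
    by (rule weak_int[where B=1]) (auto intro!: continuous_intros)
  moreover have "(\<integral>y. ?out y \<partial>M (s (r n))) = 0" for n
    using supp[of "s (r n)"] by (intro integral_eq_zero_AE, elim eventually_mono) auto
  ultimately have "(\<integral>y. ?out y \<partial>M0) = 0"
    using LIMSEQ_unique[OF _ tendsto_const] by simp
  then have "AE y in M0. ?out y = 0"
    using out_int by (subst (asm) integral_nonneg_eq_0_iff_AE) auto
  then have supp0: "AE y in M0. 0 \<le> y \<and> y \<le> 1"
    by eventually_elim (auto simp: min_def max_def split: if_splits)
  show ?thesis
  proof (rule that[of "s \<circ> r" A c M0 \<beta>])
    show "strict_mono (s \<circ> r)" using s r by (rule strict_mono_o)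
    show "0 \<le> A" using lims(1) a by (intro LIMSEQ_le_const[OF lims(1)]) auto
    show "0 \<le> c" using m0 by (intro LIMSEQ_le_const[OF lims(3)]) auto
    show "real_distribution M0" by (rule M0)
    show "AE y in M0. 0 \<le> y \<and> y \<le> 1" by (rule supp0)
    fix z :: real assume z: "0 < z"
    obtain B where "\<And>y. \<bar>levy_kernel z y\<bar> \<le> B"
      using levy_kernel_bounded[OF z] by auto
    then have "(\<lambda>n. \<integral>y. levy_kernel z y \<partial>M (s (r n))) \<longlonglongrightarrow> (\<integral>y. levy_kernel z y \<partial>M0)"
      by (intro weak_int isCont_levy_kernel z)
    then have "(\<lambda>n. - a (s (r n)) + b' (s (r n)) * z + m (s (r n)) * (\<integral>y. levy_kernel z y \<partial>M (s (r n))))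
        \<longlonglongrightarrow> - A + \<beta> * z + c * (\<integral>y. levy_kernel z y \<partial>M0)"
      using lims[THEN LIMSEQ_subseq_LIMSEQ, OF r] by (intro tendsto_intros) (auto simp: comp_def)
    then show "(\<lambda>n. L ((s \<circ> r) n) z) \<longlonglongrightarrow> - A + \<beta> * z + c * (\<integral>y. levy_kernel z y \<partial>M0)"
      using z by (simp add: L_eq)
  qed
qed

text \<open>Equality above z0 gives equal second differences there, hence equal measures in ln y,
  hence equal second differences for all z > 0. The difference e of the two forms then satisfies
  e(z) = 2 e(z + 1) - e(z + 2), so its vanishing propagates downwards in unit steps.\<close>

lemma levy_kernel_form_unique:
  fixes A\<^sub>1 \<beta>\<^sub>1 c\<^sub>1 A\<^sub>2 \<beta>\<^sub>2 c\<^sub>2 :: real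
  defines "R\<^sub>1 \<equiv> \<lambda>M z. - A\<^sub>1 + \<beta>\<^sub>1 * z + c\<^sub>1 * (\<integral>y. levy_kernel z y \<partial>M)"
    and "R\<^sub>2 \<equiv> \<lambda>M z. - A\<^sub>2 + \<beta>\<^sub>2 * z + c\<^sub>2 * (\<integral>y. levy_kernel z y \<partial>M)"
  assumes M\<^sub>1: "real_distribution M\<^sub>1" "AE y in M\<^sub>1. 0 \<le> y \<and> y \<le> 1" "0 \<le> c\<^sub>1"
    and M\<^sub>2: "real_distribution M\<^sub>2" "AE y in M\<^sub>2. 0 \<le> y \<and> y \<le> 1" "0 \<le> c\<^sub>2"
    and eq: "\<And>z. z0 < z \<Longrightarrow> R\<^sub>1 M\<^sub>1 z = R\<^sub>2 M\<^sub>2 z"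
    and z: "0 < z"
  shows "R\<^sub>1 M\<^sub>1 z = R\<^sub>2 M\<^sub>2 z"
proof -
  define D where "D c M z = c * (\<integral>y. levy_kernel z y \<partial>M) - 2 * (c * (\<integral>y. levy_kernel (z + 1) y \<partial>M))
      + c * (\<integral>y. levy_kernel (z + 2) y \<partial>M)" for c :: real and M z
  \<comment> \<open>The atom at y = 0, where the logarithm has no meaning, is dropped: it does not
    contribute to second differences.\<close>
  define N where "N c M = distr (density M (\<lambda>y. ennreal (c * indicator {0<..} y))) borel ln"
    for c :: real and M :: "real measure"
  have D_N: "ennreal (D c M z) = (\<integral>\<^sup>+s. ennreal (exp (z * s)) \<partial>N c M)" "0 \<le> D c M z"
    if M: "real_distribution M" "AE y in M. 0 \<le> y \<and> y \<le> 1" "0 \<le> c" "0 < z" for c M z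
  proof -
    interpret real_distribution M by (rule M)
    have int_K: "integrable M (levy_kernel z)" if pos: "0 < z" for z
    proof -
      obtain B where "\<And>y. \<bar>levy_kernel z y\<bar> \<le> B" using levy_kernel_bounded[OF pos] by blast
      then show ?thesis by (intro integrable_const_bound[where B=B]) auto
    qed
    let ?f = "\<lambda>y. c * levy_kernel z y - 2 * (c * levy_kernel (z + 1) y) + c * levy_kernel (z + 2) y"
    have f: "?f y = (if y \<le> 0 then 0 else if 1 \<le> y then c else c * y powr z)" for y
    proof -
      have "?f y = c * (levy_kernel z y - 2 * levy_kernel (z + 1) y + levy_kernel (z + 2) y)"
        by (simp add: algebra_simps)
      then show ?thesis by (simp add: levy_kernel_second_difference)
    qed
    have D: "D c M z = (\<integral>y. ?f y \<partial>M)"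
      using int_K[of z] int_K[of "z + 1"] int_K[of "z + 2"] M by (simp add: D_def)
    have f0: "0 \<le> ?f y" for y
      using M(3) by (simp add: f)
    show "0 \<le> D c M z"
      unfolding D by (rule Bochner_Integration.integral_nonneg) (rule f0)
    have "ennreal (D c M z) = (\<integral>\<^sup>+y. ennreal (?f y) \<partial>M)"
      unfolding D using int_K[of z] int_K[of "z + 1"] int_K[of "z + 2"] M f0
      by (intro nn_integral_eq_integral[symmetric]) auto
    also have "\<dots> = (\<integral>\<^sup>+y. ennreal (c * indicator {0<..} y) * ennreal (exp (z * ln y)) \<partial>M)"
      using M(2)
    proof (intro nn_integral_cong_AE, eventually_elim)
      case (elim y)
      then show ?case
        using M(3) by (auto simp: f powr_def ennreal_mult[symmetric] not_le intro: antisym)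
    qed
    also have "\<dots> = (\<integral>\<^sup>+s. ennreal (exp (z * s)) \<partial>N c M)"
      unfolding N_def by (subst nn_integral_distr) (auto simp: nn_integral_density)
    finally show "ennreal (D c M z) = (\<integral>\<^sup>+s. ennreal (exp (z * s)) \<partial>N c M)" .
  qed
  have D_R: "D c\<^sub>1 M\<^sub>1 z = R\<^sub>1 M\<^sub>1 z - 2 * R\<^sub>1 M\<^sub>1 (z + 1) + R\<^sub>1 M\<^sub>1 (z + 2)"
    "D c\<^sub>2 M\<^sub>2 z = R\<^sub>2 M\<^sub>2 z - 2 * R\<^sub>2 M\<^sub>2 (z + 1) + R\<^sub>2 M\<^sub>2 (z + 2)" for z
    by (simp_all add: D_def R\<^sub>1_def R\<^sub>2_def algebra_simps)
  have "N c\<^sub>1 M\<^sub>1 = N c\<^sub>2 M\<^sub>2"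
  proof (rule exp_transform_unique[where a="max 0 z0" and b="max 0 z0 + 1"])
    fix r assume r: "max 0 z0 < r" "r < max 0 z0 + 1"
    have "D c\<^sub>1 M\<^sub>1 r = D c\<^sub>2 M\<^sub>2 r"
      unfolding D_R using r by (simp add: eq)
    then show "(\<integral>\<^sup>+s. ennreal (exp (r * s)) \<partial>N c\<^sub>1 M\<^sub>1) = (\<integral>\<^sup>+s. ennreal (exp (r * s)) \<partial>N c\<^sub>2 M\<^sub>2)"
      using D_N[OF M\<^sub>1, of r] D_N[OF M\<^sub>2, of r] r by simp
    show "(\<integral>\<^sup>+s. ennreal (exp (r * s)) \<partial>N c\<^sub>1 M\<^sub>1) < \<infinity>"
      using D_N[OF M\<^sub>1, of r] r by (simp flip: D_N(1)[OF M\<^sub>1])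
  qed (auto simp: N_def)
  then have "D c\<^sub>1 M\<^sub>1 z = D c\<^sub>2 M\<^sub>2 z" if "0 < z" for z
    using D_N[OF M\<^sub>1 that] D_N[OF M\<^sub>2 that] by (metis ennreal_inj)
  then have rec: "R\<^sub>1 M\<^sub>1 z - R\<^sub>2 M\<^sub>2 z = 2 * (R\<^sub>1 M\<^sub>1 (z + 1) - R\<^sub>2 M\<^sub>2 (z + 1)) - (R\<^sub>1 M\<^sub>1 (z + 2) - R\<^sub>2 M\<^sub>2 (z + 2))"
    if "0 < z" for z
    using that D_R[of z] by fastforce
  have "R\<^sub>1 M\<^sub>1 z - R\<^sub>2 M\<^sub>2 z = 0" if "0 < z" "z0 - of_nat n < z" for n z
    using that
  proof (induction n arbitrary: z)
    case 0
    then show ?case using eq by simp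
  next
    case (Suc n)
    have "R\<^sub>1 M\<^sub>1 (z + 1) - R\<^sub>2 M\<^sub>2 (z + 1) = 0" "R\<^sub>1 M\<^sub>1 (z + 2) - R\<^sub>2 M\<^sub>2 (z + 2) = 0"
      by (rule Suc.IH; use Suc.prems in simp)+
    then show ?case using rec[OF Suc.prems(1)] by simp
  qed
  moreover obtain n :: nat where "z0 - z < of_nat n"
    using reals_Archimedean2 by blast
  ultimately show ?thesis using z by (metis diff_less_eq eq_iff_diff_eq_0 less_diff_eq add.commute)
qed

lemma exp_minus_le_quadratic: "exp (- x) \<le> 1 - x + x\<^sup>2 / 2" if "0 \<le> x" for x :: real
proof -
  let ?f = "\<lambda>x::real. 1 - x + x\<^sup>2 / 2 - exp (- x)"
  have "?f 0 \<le> ?f x"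
  proof (rule DERIV_nonneg_imp_nondecreasing[OF that])
    fix y :: real assume "0 \<le> y"
    have "(?f has_real_derivative - 1 + y + exp (- y)) (at y)"
      by (auto intro!: derivative_eq_intros)
    moreover have "0 \<le> - 1 + y + exp (- y)"
      using exp_ge_add_one_self[of "- y"] by simp
    ultimately show "\<exists>d. (?f has_real_derivative d) (at y) \<and> 0 \<le> d" by blast
  qed
  then show ?thesis by simp
qed

section \<open>Levy-Khintchine exponents with a given jump measure\<close>

locale levy_measure =
  fixes m :: "real measure"
  assumes sets_m [measurable_cong]: "sets m = sets borel"
    and m_pos: "emeasure m {..0} = 0"
    and m_fin: "(\<integral>\<^sup>+ h. ennreal (min 1 (h\<^sup>2)) \<partial>m) < \<infinity>"
begin

abbreviation jump_part :: "real \<Rightarrow> real \<Rightarrow> real" where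
  "jump_part z h \<equiv> exp (- z * h) + z * h * indicator {0<..1} h - 1"

lemma AE_pos: "AE h in m. 0 < h"
proof (rule AE_I')
  show "{..0} \<in> null_sets m" using m_pos by auto
qed (auto simp: not_less)

lemma integrable_le_min:
  fixes f :: "real \<Rightarrow> real"
  assumes [measurable]: "f \<in> borel_measurable borel" and "\<And>h. 0 < h \<Longrightarrow> \<bar>f h\<bar> \<le> C * min 1 (h\<^sup>2)"
  shows "integrable m f"
proof -
  have "integrable m (\<lambda>h. min 1 (h\<^sup>2))"
    using m_fin by (intro integrableI_nonneg) auto
  then have "integrable m (\<lambda>h. C * min 1 (h\<^sup>2))" by simp
  then show ?thesis
  proof (rule Bochner_Integration.integrable_bound)
    show "AE h in m. norm (f h) \<le> norm (C * min 1 (h\<^sup>2))"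
      using AE_pos by eventually_elim (auto intro: order_trans[OF assms(2) abs_ge_self])
  qed simp
qed

text \<open>Second-order Taylor expansion for h <= 1; for h > 1 there is no compensator and the
  integrand lies in [-1, 0].\<close>

lemma jump_part_bound:
  assumes "0 \<le> z" "0 < h"
  shows "\<bar>jump_part z h\<bar> \<le> (1 + z\<^sup>2) * min 1 (h\<^sup>2)"
proof (cases "h \<le> 1")
  case True
  have "1 - z * h \<le> exp (- (z * h))" "exp (- (z * h)) \<le> 1 - z * h + (z * h)\<^sup>2 / 2"
    using exp_ge_add_one_self[of "- (z * h)"] exp_minus_le_quadratic[of "z * h"] assms by auto
  then have "\<bar>jump_part z h\<bar> \<le> (z * h)\<^sup>2 / 2"
    using True assms by simp
  also have "\<dots> \<le> (1 + z\<^sup>2) * h\<^sup>2"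
    by (simp add: power_mult_distrib field_simps)
  also have "h\<^sup>2 = min 1 (h\<^sup>2)"
    using True assms by (simp add: power_le_one)
  finally show ?thesis .
next
  case False
  have "0 \<le> z * h" using assms by simp
  then have "\<bar>jump_part z h\<bar> \<le> 1"
    using False exp_gt_zero[of "- (z * h)"] exp_le_one_iff[of "- (z * h)"] by simp
  also have "\<dots> \<le> 1 + z\<^sup>2" by simp
  also have "\<dots> = (1 + z\<^sup>2) * min 1 (h\<^sup>2)"
    using False by (simp add: min_def power2_eq_square) (smt (verit) mult_le_cancel_left1)
  finally show ?thesis .
qed

lemma integrable_jump_part: "0 \<le> z \<Longrightarrow> integrable m (jump_part z)"
  using jump_part_bound by (intro integrable_le_min[where C="1 + z\<^sup>2"]) auto

definition exponent :: "real \<Rightarrow> real \<Rightarrow> real \<Rightarrow> real" where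
  "exponent \<gamma> \<sigma> z = - \<gamma> * z + \<sigma>\<^sup>2 / 2 * z\<^sup>2 + (\<integral> h. jump_part z h \<partial>m)"

lemma continuous_on_exponent: "continuous_on {0..} (exponent \<gamma> \<sigma>)"
proof -
  have "continuous_on {0..} (\<lambda>z. \<integral> h. jump_part z h \<partial>m)"
    unfolding continuous_on_sequentially
  proof safe
    fix Z :: "nat \<Rightarrow> real" and z assume Z: "0 \<le> z" "\<forall>n. Z n \<in> {0..}" "Z \<longlonglongrightarrow> z"
    obtain K where "\<And>n. norm (Z n) \<le> K"
      using convergent_imp_Bseq[OF convergentI[OF Z(3)]] unfolding Bseq_def by blast
    then have K: "0 \<le> Z n" "Z n \<le> K" for n
      using Z(2) by (auto intro: order_trans[OF abs_ge_self])
    have "(\<lambda>n. \<integral> h. jump_part (Z n) h \<partial>m) \<longlonglongrightarrow> (\<integral> h. jump_part z h \<partial>m)"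
    proof (rule integral_dominated_convergence[where w="\<lambda>h. (1 + K\<^sup>2) * min 1 (h\<^sup>2)"])
      show "integrable m (\<lambda>h. (1 + K\<^sup>2) * min 1 (h\<^sup>2))"
        by (intro integrable_le_min[where C="1 + K\<^sup>2"]) (auto simp: abs_mult)
      show "AE h in m. (\<lambda>n. jump_part (Z n) h) \<longlonglongrightarrow> jump_part z h"
        by (intro AE_I2 tendsto_intros Z)
      show "AE h in m. norm (jump_part (Z n) h) \<le> (1 + K\<^sup>2) * min 1 (h\<^sup>2)" for n
        using AE_pos
      proof eventually_elim
        case (elim h)
        have "(1 + (Z n)\<^sup>2) * min 1 (h\<^sup>2) \<le> (1 + K\<^sup>2) * min 1 (h\<^sup>2)"
          using K[of n] by (intro mult_right_mono add_left_mono power_mono) auto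
        then show ?case using jump_part_bound[OF K(1)[of n] elim] by simp
      qed
    qed auto
    then show "((\<lambda>z. \<integral> h. jump_part z h \<partial>m) \<circ> Z) \<longlonglongrightarrow> (\<integral> h. jump_part z h \<partial>m)"
      by (simp add: comp_def)
  qed
  then show ?thesis
    unfolding exponent_def by (intro continuous_intros)
qed

text \<open>Convexity in z together with the value 0 at z = 0: the graph lies below its chords from
  the origin. This later keeps the exponent at or below p on [0, z0].\<close>

lemma exponent_chord:
  assumes "0 \<le> z" "z \<le> w" "0 < w"
  shows "exponent \<gamma> \<sigma> z \<le> z / w * exponent \<gamma> \<sigma> w"
proof -
  define t where "t = z / w"
  have t: "0 \<le> t" "t \<le> 1" "z = t * w" using assms by (auto simp: t_def)
  have iz: "integrable m (jump_part z)" and iw: "integrable m (jump_part w)"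
    by (rule integrable_jump_part; use assms in simp)+
  have "(\<integral> h. jump_part z h \<partial>m) \<le> (\<integral> h. t * jump_part w h \<partial>m)"
  proof (rule integral_mono[OF iz integrable_mult_right[OF iw]])
    fix h
    have "convex_on UNIV (exp :: real \<Rightarrow> real)" by (rule exp_convex)
    then have "exp ((1 - t) *\<^sub>R 0 + t *\<^sub>R (- w * h)) \<le> (1 - t) * exp 0 + t * exp (- w * h)"
      using t by (intro convex_onD) auto
    then show "jump_part z h \<le> t * jump_part w h"
      unfolding t(3) by (simp add: algebra_simps)
  qed
  then have "(\<integral> h. jump_part z h \<partial>m) \<le> t * (\<integral> h. jump_part w h \<partial>m)"
    by simp
  moreover have "\<sigma>\<^sup>2 / 2 * z\<^sup>2 \<le> t * (\<sigma>\<^sup>2 / 2 * w\<^sup>2)"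
  proof -
    have "t * t \<le> t * 1" using t by (intro mult_left_mono)
    then have "(\<sigma>\<^sup>2 / 2 * w\<^sup>2) * (t * t) \<le> (\<sigma>\<^sup>2 / 2 * w\<^sup>2) * (t * 1)" by (rule mult_left_mono) simp
    then show ?thesis by (simp add: t(3) power2_eq_square mult_ac)
  qed
  moreover have "- \<gamma> * z = t * (- \<gamma> * w)" by (simp add: t(3))
  ultimately show ?thesis
    unfolding exponent_def t_def[symmetric] distrib_left by linarith
qed

text \<open>In this sign convention the exponent of a subordinator is at most 0 on the half-line, so
  a single positive value rules that case out.\<close>

lemma sp_levy_laplace_exponent_exponent:
  assumes "0 < w" "0 < exponent \<gamma> \<sigma> w"
  shows "sp_levy_laplace_exponent (exponent \<gamma> \<sigma>)"
  unfolding sp_levy_laplace_exponent_def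
proof (rule exI[of _ \<gamma>], rule exI[of _ \<sigma>], rule exI[of _ m], intro conjI)
  show "\<not> (\<sigma> = 0 \<and> set_integrable m {0<..1} (\<lambda>h. h) \<and> (LINT h:{0<..1}|m. h) \<le> \<gamma>)"
  proof (rule notI, elim conjE)
    assume s: "\<sigma> = 0" "set_integrable m {0<..1} (\<lambda>h. h)" "(LINT h:{0<..1}|m. h) \<le> \<gamma>"
    have int: "integrable m (\<lambda>h. w * (indicator {0<..1} h * h))"
      using s(2) by (simp add: set_integrable_def)
    have "(\<integral>h. jump_part w h \<partial>m) \<le> (\<integral>h. w * (indicator {0<..1} h * h) \<partial>m)"
    proof (rule integral_mono_AE[OF integrable_jump_part int])
      show "AE h in m. jump_part w h \<le> w * (indicator {0<..1} h * h)"
        using AE_pos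
      proof eventually_elim
        case (elim h)
        then have "exp (- w * h) \<le> 1" using assms by simp
        then show ?case by simp
      qed
    qed (use assms in auto)
    also have "\<dots> = w * (LINT h:{0<..1}|m. h)"
      by (simp add: set_lebesgue_integral_def)
    also have "\<dots> \<le> w * \<gamma>"
      using s assms by (intro mult_left_mono) auto
    finally have "exponent \<gamma> \<sigma> w \<le> 0"
      by (simp add: exponent_def s(1) mult.commute)
    then show False using assms by simp
  qed
qed (use m_fin in \<open>auto simp: exponent_def sets_m m_pos\<close>)

end

text \<open>The dictionary back to Levy-Khintchine form. An atom of M at y = 0 contributes z - 1 per
  unit mass, that is, killing and drift together; an atom at y = 1 contributes (z^2 - z) / 2, a
  Gaussian part and drift. The mass in between, divided by (1 - y)^2 and moved to h = -ln y, is the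
  jump measure.\<close>

lemma levy_kernel_form_exponent:
  assumes M: "real_distribution M" and supp: "AE y in M. 0 \<le> y \<and> y \<le> 1" and c: "0 \<le> c" and A: "0 \<le> A"
  obtains \<gamma> \<sigma> m p where "levy_measure m" "0 \<le> p"
    "\<And>z. 0 < z \<Longrightarrow> - A + \<beta> * z + c * (\<integral>y. levy_kernel z y \<partial>M) = levy_measure.exponent m \<gamma> \<sigma> z - p"
proof -
  interpret real_distribution M by (rule M)
  define dens where "dens y = indicator {0<..<1} y * (c / (1 - y)\<^sup>2)" for y :: real
  have [measurable]: "dens \<in> borel_measurable borel" unfolding dens_def by measurable
  have dens0: "0 \<le> dens y" for y using c by (auto simp: dens_def indicator_def)
  define m where "m = distr (density M dens) borel (\<lambda>y. - ln y)"
  \<comment> \<open>With h = -ln y this reduces to min 1 h <= 2 (1 - exp (-h)); squaring produces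
    the 4.\<close>
  have min_le: "dens y * min 1 ((ln y)\<^sup>2) \<le> 4 * c" for y
  proof (cases "0 < y \<and> y < 1")
    case True
    define h where "h = - ln y"
    have h: "0 < h" "y = exp (- h)" using True by (auto simp: h_def)
    have "min 1 h \<le> 2 * (1 - exp (- h))"
    proof (cases "h \<le> 1")
      case True
      have "h\<^sup>2 \<le> h" using True h by (simp add: power2_eq_square mult_left_le)
      then have "1 - h + h\<^sup>2 / 2 \<le> 1 - h + h / 2"
        by (intro add_left_mono divide_right_mono) auto
      with exp_minus_le_quadratic[OF less_imp_le[OF h(1)]] have "exp (- h) \<le> 1 - h + h / 2"
        by (rule order_trans)
      then have "h \<le> 2 * (1 - exp (- h))"
        by (simp add: field_simps)
      then show ?thesis by (simp add: min.coboundedI2)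
    next
      case False
      then have "exp (- h) \<le> exp (- 1)" by simp
      also have "\<dots> \<le> (1::real) - 1 + 1\<^sup>2 / 2" by (rule exp_minus_le_quadratic) simp
      finally show ?thesis using False by simp
    qed
    then have "(min 1 h)\<^sup>2 \<le> (2 * (1 - exp (- h)))\<^sup>2"
      using h by (intro power_mono) auto
    moreover have "min 1 (h\<^sup>2) = (min 1 h)\<^sup>2"
      using h by (auto simp: min_def power_le_one one_le_power power2_eq_square)
        (smt (verit) mult_le_cancel_left1 mult_le_one)+
    ultimately have "min 1 ((ln y)\<^sup>2) \<le> 4 * (1 - y)\<^sup>2"
      by (simp only: h(2)[symmetric] power_mult_distrib) (simp add: h_def)
    then have "c / (1 - y)\<^sup>2 * min 1 ((ln y)\<^sup>2) \<le> c / (1 - y)\<^sup>2 * (4 * (1 - y)\<^sup>2)"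
      using c by (intro mult_left_mono) auto
    then show ?thesis using True by (simp add: dens_def)
  qed (use c in \<open>auto simp: dens_def indicator_def\<close>)
  have lm: "levy_measure m"
  proof
    show "sets m = sets borel" by (simp add: m_def)
    have "emeasure m {..0} = (\<integral>\<^sup>+y. ennreal (dens y) * indicator ((\<lambda>y. - ln y) -` {..0}) y \<partial>M)"
    proof -
      have "(\<lambda>y::real. - ln y) -` {..0} \<in> sets M"
        using measurable_sets[of "\<lambda>y::real. - ln y" borel borel "{..0}"] by simp
      then show ?thesis
        unfolding m_def by (subst emeasure_distr) (auto simp: emeasure_density)
    qed
    also have "\<dots> = (\<integral>\<^sup>+y. 0 \<partial>M)"
      by (intro nn_integral_cong) (auto simp: dens_def indicator_def ln_ge_zero_iff)
    finally show "emeasure m {..0} = 0" by simp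
    have "(\<integral>\<^sup>+ h. ennreal (min 1 (h\<^sup>2)) \<partial>m) = (\<integral>\<^sup>+y. ennreal (dens y * min 1 ((ln y)\<^sup>2)) \<partial>M)"
      unfolding m_def by (subst nn_integral_distr) (auto simp: nn_integral_density dens0 ennreal_mult)
    also have "\<dots> \<le> (\<integral>\<^sup>+y. ennreal (4 * c) \<partial>M)"
      by (intro nn_integral_mono ennreal_leI min_le)
    also have "\<dots> = ennreal (4 * c)" using emeasure_space_1 by simp
    finally show "(\<integral>\<^sup>+ h. ennreal (min 1 (h\<^sup>2)) \<partial>m) < \<infinity>"
      using ennreal_less_top le_less_trans by fastforce
  qed
  interpret m: levy_measure m by (rule lm)
  \<comment> \<open>The price of exchanging the compensator 1 - exp (-h) for h on (0, 1]. It is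
    minus \<open>jump_part\<close> at z = 1, whence the constant 2.\<close>
  let ?F2 = "\<lambda>h::real. 1 - exp (- h) - h * indicator {0<..1} h"
  have int_F2: "integrable m ?F2"
  proof (rule m.integrable_le_min[where C=2])
    fix h :: real assume "0 < h"
    then show "\<bar>?F2 h\<bar> \<le> 2 * min 1 (h\<^sup>2)"
      using m.jump_part_bound[of 1 h] by (simp add: abs_minus_commute algebra_simps)
  qed simp
  have int_m: "(\<integral>h. f h \<partial>m) = (\<integral>y. dens y * f (- ln y) \<partial>M)"
    "integrable m f \<longleftrightarrow> integrable M (\<lambda>y. dens y * f (- ln y))"
    if "f \<in> borel_measurable borel" for f :: "real \<Rightarrow> real"
    unfolding m_def using that dens0
    by (simp_all add: integral_distr integral_density integrable_distr_eq integrable_density)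
  define p where "p = A + c * prob {0}"
  define \<sigma> where "\<sigma> = sqrt (c * prob {1})"
  \<comment> \<open>The drift collects \<beta>, the linear contributions of the two atoms and the
    change of compensator.\<close>
  define \<gamma> where "\<gamma> = - (\<beta> + c * prob {0} - \<sigma>\<^sup>2 / 2 + (\<integral>h. ?F2 h \<partial>m))"
  have \<sigma>2: "\<sigma>\<^sup>2 = c * prob {1}" using c by (simp add: \<sigma>_def)
  show ?thesis
  proof (rule that[OF lm])
    show "0 \<le> p" using A c by (simp add: p_def)
    fix z :: real assume z: "0 < z"
    have "c * (\<integral>y. levy_kernel z y \<partial>M) = (\<integral>y. c * levy_kernel z y \<partial>M)" by simp
    also have "\<dots> = (\<integral>y. c * (z - 1) * indicator {0} y + c * ((z\<^sup>2 - z) / 2) * indicator {1} y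
        + (dens y * m.jump_part z (- ln y) + z * (dens y * ?F2 (- ln y))) \<partial>M)"
    proof (rule integral_cong_AE)
      show "AE y in M. c * levy_kernel z y = c * (z - 1) * indicator {0} y + c * ((z\<^sup>2 - z) / 2) * indicator {1} y
        + (dens y * m.jump_part z (- ln y) + z * (dens y * ?F2 (- ln y)))"
        using supp
      proof eventually_elim
        case (elim y)
        consider "y = 0" | "y = 1" | "0 < y" "y < 1" using elim by linarith
        then show ?case
        proof cases
          case 3
          have e: "exp (z * ln y) = y powr z" using 3 by (simp add: powr_def)
          have "m.jump_part z (- ln y) + z * ?F2 (- ln y) = y powr z - 1 + z * (1 - y)"
            using 3 by (simp add: e algebra_simps)
          then have "c / (1 - y)\<^sup>2 * (m.jump_part z (- ln y) + z * ?F2 (- ln y)) = c * levy_kernel z y"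
            using 3 by (simp only: levy_kernel_def) simp
          moreover have "dens y = c / (1 - y)\<^sup>2" using 3 by (simp add: dens_def)
          ultimately show ?thesis
            using 3 by (simp only: distrib_left) (simp add: mult.left_commute)
        qed (auto simp: levy_kernel_def dens_def)
      qed
    qed auto
    also have "\<dots> = c * (z - 1) * prob {0} + c * ((z\<^sup>2 - z) / 2) * prob {1}
        + ((\<integral>h. m.jump_part z h \<partial>m) + z * (\<integral>h. ?F2 h \<partial>m))"
    proof -
      have i1: "integrable M (\<lambda>y. dens y * m.jump_part z (- ln y))"
        using m.integrable_jump_part[of z] z by (subst int_m(2)[symmetric]) auto
      have i2: "integrable M (\<lambda>y. dens y * ?F2 (- ln y))"
        using int_F2 by (subst int_m(2)[symmetric]) auto
      have i3: "integrable M (\<lambda>y. c * (z - 1) * indicator {0} y)" "integrable M (\<lambda>y. c * ((z\<^sup>2 - z) / 2) * indicator {1} y)"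
        by (auto intro!: integrable_mult_right integrable_real_indicator simp: emeasure_eq_measure)
      have e1: "(\<integral>h. m.jump_part z h \<partial>m) = (\<integral>y. dens y * m.jump_part z (- ln y) \<partial>M)"
        by (rule int_m(1)) simp
      have e2: "(\<integral>h. ?F2 h \<partial>m) = (\<integral>y. dens y * ?F2 (- ln y) \<partial>M)"
        by (rule int_m(1)) simp
      show ?thesis
        unfolding e1 e2
        by (subst Bochner_Integration.integral_add Bochner_Integration.integral_add[OF i3]
            Bochner_Integration.integral_add[OF i1 integrable_mult_right[OF i2]];
            (intro Bochner_Integration.integrable_add i1 i3 integrable_mult_right[OF i2])?)+
          simp
    qed
    finally show "- A + \<beta> * z + c * (\<integral>y. levy_kernel z y \<partial>M) = m.exponent \<gamma> \<sigma> z - p"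
      by (simp add: m.exponent_def p_def \<gamma>_def \<sigma>2 field_simps)
  qed
qed

section \<open>One-sided derivatives, additive functions, antiderivatives\<close>

text \<open>With right derivatives only, the mean value theorem does not apply. Instead, the times t
  with |E t - E 0| <= \<epsilon> t form a closed set, and at its supremum, if that lies below T, the
  right derivative lets the bound reach further; \<epsilon> is arbitrary.\<close>

lemma zero_right_derivative_imp_const:
  fixes E :: "real \<Rightarrow> real"
  assumes cont: "continuous_on {0..} E"
    and der: "\<And>t. 0 \<le> t \<Longrightarrow> ((\<lambda>h. (E (t + h) - E t) / h) \<longlongrightarrow> 0) (at_right 0)"
    and T: "0 \<le> T"
  shows "E T = E 0"
proof -
  have le: "\<bar>E T - E 0\<bar> \<le> \<epsilon> * T" if \<epsilon>: "0 < \<epsilon>" for \<epsilon>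
  proof -
    define S where "S = {t \<in> {0..T}. \<bar>E t - E 0\<bar> - \<epsilon> * t \<le> 0}"
    have "continuous_on {0..T} (\<lambda>t. \<bar>E t - E 0\<bar> - \<epsilon> * t)"
      by (intro continuous_intros continuous_on_subset[OF cont]) auto
    then have "closed S"
      unfolding S_def by (intro continuous_on_closed_Collect_le continuous_on_const) auto
    moreover have "0 \<in> S" using T by (simp add: S_def)
    moreover have bdd: "bdd_above S" by (auto simp: S_def bdd_above_def)
    ultimately have s: "Sup S \<in> S"
      by (intro closed_contains_Sup) auto
    define s where "s = Sup S"
    have "s = T"
    proof (rule ccontr)
      assume "s \<noteq> T"
      then have sT: "0 \<le> s" "s < T" using s by (auto simp: S_def s_def)
      have "\<forall>\<^sub>F h in at_right 0. \<bar>(E (s + h) - E s) / h\<bar> < \<epsilon>"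
        using tendstoD[OF der[OF sT(1)] \<epsilon>] by simp
      moreover have "\<forall>\<^sub>F h in at_right (0::real). h < T - s"
        by (rule order_tendstoD(2)[OF tendsto_ident_at]) (use sT in simp)
      ultimately have "\<forall>\<^sub>F h in at_right (0::real). \<bar>(E (s + h) - E s) / h\<bar> < \<epsilon> \<and> h < T - s \<and> 0 < h"
        using eventually_at_right_less[of 0] by eventually_elim auto
      from eventually_happens'[OF _ this]
      obtain h where h: "\<bar>(E (s + h) - E s) / h\<bar> < \<epsilon>" "h < T - s" "0 < h"
        by (auto simp del: abs_divide)
      then have "\<bar>E (s + h) - E s\<bar> \<le> \<epsilon> * h"
        by (simp add: abs_divide pos_divide_less_eq)
      moreover have "\<bar>E s - E 0\<bar> \<le> \<epsilon> * s" using s by (simp add: S_def s_def)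
      ultimately have "\<bar>E (s + h) - E 0\<bar> \<le> \<epsilon> * (s + h)"
        by (simp add: distrib_left)
      then have "s + h \<in> S" using h sT by (simp add: S_def)
      then have "s + h \<le> s" unfolding s_def using bdd by (rule cSup_upper)
      then show False using h by simp
    qed
    then show ?thesis using s by (simp add: S_def s_def)
  qed
  have "\<bar>E T - E 0\<bar> \<le> 0"
  proof (rule field_le_epsilon)
    fix e :: real assume e: "0 < e"
    have "\<bar>E T - E 0\<bar> \<le> e / (T + 1) * T" using e T by (intro le) simp
    also have "\<dots> \<le> e" using e T by (simp add: field_simps)
    finally show "\<bar>E T - E 0\<bar> \<le> 0 + e" by simp
  qed
  then show ?thesis by simp
qed

text \<open>A semigroup controls increments to the right only. Subtracting the integral of the
  continuous function r leaves a function with zero right derivative, so the derivative is in fact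
  two-sided.\<close>

lemma has_real_derivative_of_right_derivative:
  fixes \<phi> r :: "real \<Rightarrow> real"
  assumes cont: "continuous_on {0..} \<phi>" and r: "continuous_on {0..} r"
    and der: "\<And>t. 0 \<le> t \<Longrightarrow> ((\<lambda>h. (\<phi> (t + h) - \<phi> t) / h) \<longlongrightarrow> r t) (at_right 0)"
    and t: "0 \<le> t"
  shows "(\<phi> has_real_derivative r t) (at t within {0..})"
proof -
  define \<rho> where "\<rho> t = integral {0..t} r" for t
  have der\<rho>: "(\<rho> has_real_derivative r t) (at t within {0..})" if "0 \<le> t" for t
  proof -
    have "(\<rho> has_real_derivative r t) (at t within {0..t + 1})"
      unfolding \<rho>_def using that
      by (intro integral_has_real_derivative continuous_on_subset[OF r]) auto
    moreover have "at t within {0..t + 1} = at t within {0..}"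
      by (rule at_within_nhd[of _ "{t - 1<..<t + 1}"]) auto
    ultimately show ?thesis by simp
  qed
  have "\<phi> t - \<rho> t = \<phi> 0 - \<rho> 0" if "0 \<le> t" for t
  proof (rule zero_right_derivative_imp_const[OF _ _ that])
    show "continuous_on {0..} (\<lambda>t. \<phi> t - \<rho> t)"
      using der\<rho> by (intro continuous_intros cont DERIV_continuous_on[where D=r]) auto
    fix t :: real assume t: "0 \<le> t"
    have "(\<rho> has_real_derivative r t) (at t within {t<..})"
      by (rule DERIV_subset[OF der\<rho>[OF t]]) (use t in auto)
    then have "((\<lambda>y. (\<rho> y - \<rho> t) / (y - t)) \<longlongrightarrow> r t) (at_right t)"
      by (simp add: has_field_derivative_iff)
    then have "((\<lambda>h. (\<rho> (t + h) - \<rho> t) / h) \<longlongrightarrow> r t) (at_right 0)"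
      by (subst (asm) filterlim_at_right_to_0) (simp add: add.commute)
    from tendsto_diff[OF der[OF t] this]
    show "((\<lambda>h. (\<phi> (t + h) - \<rho> (t + h) - (\<phi> t - \<rho> t)) / h) \<longlongrightarrow> 0) (at_right 0)"
      by (simp add: diff_divide_distrib[symmetric] algebra_simps)
  qed
  then have eq: "\<phi> t = \<rho> t + (\<phi> 0 - \<rho> 0)" if "t \<in> {0..}" for t
    using that by (simp add: algebra_simps)
  have "((\<lambda>t. \<rho> t + (\<phi> 0 - \<rho> 0)) has_real_derivative r t) (at t within {0..})"
    using der\<rho>[OF t] by (auto intro!: derivative_eq_intros)
  then show ?thesis
  proof (rule has_field_derivative_transform_within[where d=1])
    show "\<rho> y + (\<phi> 0 - \<rho> 0) = \<phi> y" if "y \<in> {0..}" for y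
      by (rule eq[OF that, symmetric])
  qed (use t in simp_all)
qed

text \<open>Cauchy's equation: nonnegativity gives monotonicity, which excludes the irregular
  solutions.\<close>

lemma additive_nonneg_imp_linear:
  fixes c :: "real \<Rightarrow> real"
  assumes add: "\<And>x y. 0 < x \<Longrightarrow> 0 < y \<Longrightarrow> c (x + y) = c x + c y"
    and nonneg: "\<And>x. 0 < x \<Longrightarrow> 0 \<le> c x" and x: "0 < x"
  shows "c x = x * c 1"
proof -
  have mult: "c (real (Suc n) * y) = real (Suc n) * c y" if "0 < y" for n y
  proof (induction n)
    case (Suc n)
    have "c (real (Suc (Suc n)) * y) = c (real (Suc n) * y + y)"
      by (simp add: algebra_simps)
    also have "\<dots> = c (real (Suc n) * y) + c y" using that by (intro add) auto
    finally show ?case using Suc by (simp add: algebra_simps)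
  qed simp
  have mono: "c y \<le> c y'" if "0 < y" "y \<le> y'" for y y'
  proof (cases "y = y'")
    case False
    then have "c y' = c y + c (y' - y)" using that add[of y "y' - y"] by simp
    then show ?thesis using nonneg[of "y' - y"] that False by simp
  qed simp
  \<comment> \<open>At y = (n + 1) x, squeezed between consecutive integers, the error is at most c
    1; by additivity it is n + 1 times the error at x.\<close>
  have est: "\<bar>c x - x * c 1\<bar> * real (Suc n) \<le> c 1" for n
  proof -
    define y where "y = real (Suc n) * x"
    have y: "0 < y" using x by (simp add: y_def)
    define k where "k = nat \<lfloor>y\<rfloor>"
    have k: "real k \<le> y" "y \<le> real (Suc k)" using y by (auto simp: k_def) linarith+
    have "c y \<le> real (Suc k) * c 1"
      using mono[OF y k(2)] mult[of 1 k] by simp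
    moreover have "real k * c 1 \<le> c y"
    proof (cases k)
      case 0 then show ?thesis using nonneg[OF y] by simp
    next
      case (Suc j)
      then show ?thesis using mono[of "real k" y] k mult[of 1 j] by simp
    qed
    moreover have "real k * c 1 \<le> y * c 1" "y * c 1 \<le> real (Suc k) * c 1"
      using k nonneg[of 1] by (auto intro!: mult_right_mono)
    ultimately have "\<bar>c y - y * c 1\<bar> \<le> c 1"
      by (simp add: algebra_simps)
    moreover have "c y - y * c 1 = (c x - x * c 1) * real (Suc n)"
      using mult[OF x, of n] by (simp add: y_def algebra_simps)
    ultimately show ?thesis by (simp add: abs_mult)
  qed
  show ?thesis
  proof (rule ccontr)
    assume "c x \<noteq> x * c 1"
    then have d: "0 < \<bar>c x - x * c 1\<bar>" by simp
    obtain n :: nat where "c 1 / \<bar>c x - x * c 1\<bar> < real n" using reals_Archimedean2 by blast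
    then have "c 1 < \<bar>c x - x * c 1\<bar> * real n" using d by (simp add: field_simps)
    also have "\<dots> \<le> \<bar>c x - x * c 1\<bar> * real (Suc n)" by (intro mult_left_mono) auto
    finally show False using est[of n] by simp
  qed
qed

text \<open>Exhaust the half-line by compact intervals; on each of them the fundamental theorem
  gives an increment of H, hence at most K.\<close>

lemma nn_integral_le_antiderivative:
  fixes f h H :: "real \<Rightarrow> real"
  assumes [measurable]: "f \<in> borel_measurable borel" "h \<in> borel_measurable borel"
    and der: "\<And>z. a < z \<Longrightarrow> (H has_real_derivative h z) (at z)"
    and h: "\<And>z. a < z \<Longrightarrow> 0 \<le> h z" and f: "\<And>z. a < z \<Longrightarrow> f z \<le> h z"
    and H: "\<And>z. a < z \<Longrightarrow> 0 \<le> H z" "\<And>z. a < z \<Longrightarrow> H z \<le> K"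
  shows "(\<integral>\<^sup>+z\<in>{a<..}. ennreal (f z) \<partial>lborel) \<le> ennreal K"
proof -
  define I where "I n = {a + 1 / real (Suc n)..a + real (Suc n)}" for n
  have I: "I n \<subseteq> {a<..}" for n
  proof
    fix z assume "z \<in> I n"
    moreover have "a < a + 1 / real (Suc n)" by simp
    ultimately show "z \<in> {a<..}"
      unfolding I_def greaterThan_iff by (meson atLeastAtMost_iff less_le_trans)
  qed
  have "incseq I"
  proof (rule incseq_SucI)
    fix n
    have "1 / real (Suc (Suc n)) \<le> 1 / real (Suc n)" by (rule frac_le) auto
    then show "I n \<subseteq> I (Suc n)" unfolding I_def by (intro atLeastatMost_subset_iff[THEN iffD2]) auto
  qed
  have SUP: "(SUP n. ennreal (f z) * indicator (I n) z) = ennreal (f z) * indicator {a<..} z" for z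
  proof (cases "a < z")
    case True
    obtain n1 where n1: "1 / real (Suc n1) < z - a" using reals_Archimedean[of "z - a"] True by (auto simp: inverse_eq_divide)
    obtain n2 :: nat where n2: "z - a < real n2" using reals_Archimedean2 by blast
    define n where "n = max n1 n2"
    have "1 / real (Suc n) \<le> 1 / real (Suc n1)" by (rule frac_le) (auto simp: n_def)
    then have "z \<in> I n" using n1 n2 by (auto simp: I_def n_def)
    then have "ennreal (f z) \<le> (SUP n. ennreal (f z) * indicator (I n) z)"
      by (intro SUP_upper2[of n]) auto
    moreover have "(SUP n. ennreal (f z) * indicator (I n) z) \<le> ennreal (f z)"
      by (intro SUP_least) (auto simp: indicator_def)
    ultimately show ?thesis using True by (auto intro: antisym)
  next
    case False
    then have "z \<notin> I n" for n using I[of n] by auto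
    then show ?thesis using False by simp
  qed
  have "(\<integral>\<^sup>+z\<in>{a<..}. ennreal (f z) \<partial>lborel) = (SUP n. \<integral>\<^sup>+z. ennreal (f z) * indicator (I n) z \<partial>lborel)"
    unfolding SUP[symmetric]
  proof (rule nn_integral_monotone_convergence_SUP)
    have "indicator (I m) z \<le> (indicator (I n) z :: ennreal)" if "m \<le> n" for m n z
      using monoD[OF \<open>incseq I\<close> that] by (auto simp: indicator_def)
    then show "incseq (\<lambda>n z. ennreal (f z) * indicator (I n) z)"
      by (auto simp: incseq_def le_fun_def intro!: mult_left_mono)
  qed (simp add: I_def)
  also have "\<dots> \<le> ennreal K"
  proof (rule SUP_least)
    fix n
    have le: "a + 1 / real (Suc n) \<le> a + real (Suc n)" by (simp add: field_simps)
    have pos: "a < z" if "z \<in> I n" for z using I[of n] that by auto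
    have "(\<integral>\<^sup>+z. ennreal (f z) * indicator (I n) z \<partial>lborel) \<le> (\<integral>\<^sup>+z. ennreal (h z) * indicator (I n) z \<partial>lborel)"
      using f pos by (intro nn_integral_mono) (auto simp: indicator_def intro!: ennreal_leI)
    also have "\<dots> = ennreal (H (a + real (Suc n)) - H (a + 1 / real (Suc n)))"
      unfolding I_def using pos le by (intro nn_integral_FTC_Icc) (auto simp: I_def intro!: der h)
    also have "\<dots> \<le> ennreal K"
    proof (rule ennreal_leI)
      have "a < a + real (Suc n)" "a < a + 1 / real (Suc n)" by auto
      from H(2)[OF this(1)] H(1)[OF this(2)] show "H (a + real (Suc n)) - H (a + 1 / real (Suc n)) \<le> K" by simp
    qed
    finally show "(\<integral>\<^sup>+z. ennreal (f z) * indicator (I n) z \<partial>lborel) \<le> ennreal K" .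
  qed
  finally show ?thesis .
qed

section \<open>The flow of the branching rate\<close>

locale branching_rate =
  fixes z0 \<theta> :: real and g :: "real \<Rightarrow> real"
  assumes z0: "0 \<le> z0" and \<theta>: "z0 < \<theta>"
    and g_C1: "\<exists>g'. continuous_on {z0..} g' \<and> (\<forall>z\<ge>z0. (g has_real_derivative g' z) (at z within {z0..}))"
    and g_pos: "\<And>z. z0 < z \<Longrightarrow> 0 < g z" and g_z0: "g z0 = 0"
    and g_lim: "filterlim g at_top at_top"
    and g_int: "(\<integral>\<^sup>+ z\<in>{\<theta>..}. ennreal (1 / g z) \<partial>lborel) = \<infinity>"
begin

lemma continuous_on_g: "continuous_on {z0..} g"
  using g_C1 by (auto intro: DERIV_continuous_on)

lemma continuous_on_g': "continuous_on {z0<..} g"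
  by (rule continuous_on_subset[OF continuous_on_g]) auto

lemma g_nonzero: "z0 < z \<Longrightarrow> g z \<noteq> 0"
  using g_pos[of z] by simp

lemma antiderivative:
  fixes h :: "real \<Rightarrow> real"
  assumes h: "continuous_on {z0<..} h" and z: "z0 < z"
  shows "((\<lambda>z. LBINT y=\<theta>..z. h y) has_real_derivative h z) (at z)"
proof -
  define a where "a = (z0 + min z \<theta>) / 2"
  define b where "b = max z \<theta> + 1"
  have ab: "z0 < a" "a < z" "a \<le> \<theta>" "z < b" "\<theta> \<le> b"
    using z \<theta> by (auto simp: a_def b_def min_def)
  have "((\<lambda>u. LBINT y=\<theta>..u. h y) has_vector_derivative h z) (at z within {a..b})"
    using ab by (intro interval_integral_FTC2 continuous_on_subset[OF h]) auto
  then show ?thesis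
    using ab by (simp add: has_real_derivative_iff_has_vector_derivative at_within_Icc_at)
qed

definition G :: "real \<Rightarrow> real" where
  "G z = (LBINT y=\<theta>..z. 1 / g y)"

lemma G_scale: "(LBINT y=\<theta>..z. q / g y) = q * G z"
proof -
  have "(\<lambda>y. q / g y) = (\<lambda>y. q * (1 / g y))" by (simp add: fun_eq_iff)
  then show ?thesis unfolding G_def by (simp only: interval_lebesgue_integral_mult_right)
qed

lemma G_\<theta>: "G \<theta> = 0"
  by (simp add: G_def)

lemma continuous_on_inverse_g: "continuous_on {z0<..} (\<lambda>z. 1 / g z)"
  by (intro continuous_intros continuous_on_g') (auto dest: g_nonzero)

lemma DERIV_G: "z0 < z \<Longrightarrow> (G has_real_derivative 1 / g z) (at z)"
  unfolding G_def[abs_def] by (rule antiderivative[OF continuous_on_inverse_g])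

lemma isCont_G: "z0 < z \<Longrightarrow> isCont G z"
  by (rule DERIV_isCont[OF DERIV_G])

lemma continuous_on_G: "continuous_on {z0<..} G"
  by (intro continuous_at_imp_continuous_on) (auto intro: isCont_G)

lemma G_less:
  assumes "z0 < y" "y < z"
  shows "G y < G z"
proof (rule DERIV_pos_imp_increasing[OF assms(2)])
  fix x assume "y \<le> x"
  then have "z0 < x" using assms by simp
  then show "\<exists>d. (G has_real_derivative d) (at x) \<and> 0 < d"
    using DERIV_G g_pos by (intro exI[of _ "1 / g x"]) auto
qed

lemma G_le_iff: "z0 < y \<Longrightarrow> z0 < z \<Longrightarrow> G y \<le> G z \<longleftrightarrow> y \<le> z"
  using G_less[of y z] G_less[of z y] by (cases y z rule: linorder_cases) auto

lemma G_eq_iff: "z0 < y \<Longrightarrow> z0 < z \<Longrightarrow> G y = G z \<longleftrightarrow> y = z"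
  using G_le_iff[of y z] G_le_iff[of z y] by auto

text \<open>1 / g and G are meaningful only above z0. The cut-offs \<open>dens\<close> and
  \<open>GI\<close> are Borel on the whole line, whatever the values of g elsewhere.\<close>

definition dens :: "real \<Rightarrow> real" where
  "dens z = indicator {z0<..} z *\<^sub>R (1 / g z)"

definition GI :: "real \<Rightarrow> real" where
  "GI z = indicator {z0<..} z *\<^sub>R G z"

lemma dens_measurable [measurable]: "dens \<in> borel_measurable borel"
  unfolding dens_def[abs_def] by (rule borel_measurable_continuous_on_indicator) (auto intro: continuous_on_inverse_g)

lemma GI_measurable [measurable]: "GI \<in> borel_measurable borel"
  unfolding GI_def[abs_def] by (rule borel_measurable_continuous_on_indicator) (auto intro: continuous_on_G)

lemma dens_nonneg: "0 \<le> dens z"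
  by (auto simp: dens_def indicator_def intro: less_imp_le g_pos)

lemma dens_eq: "z0 < z \<Longrightarrow> dens z = 1 / g z"
  by (simp add: dens_def)

lemma GI_eq: "z0 < z \<Longrightarrow> GI z = G z"
  by (simp add: GI_def)

lemma nn_integral_dens_Icc:
  assumes "z0 < a" "a \<le> b"
  shows "(\<integral>\<^sup>+z. ennreal (dens z) * indicator {a..b} z \<partial>lborel) = ennreal (G b - G a)"
proof -
  have "(G has_real_derivative dens z) (at z)" if "a \<le> z" for z
    using that assms DERIV_G[of z] by (simp add: dens_eq)
  then show ?thesis
    using assms by (intro nn_integral_FTC_Icc) (auto simp: dens_nonneg)
qed

lemma G_unbounded_above: "\<exists>z>\<theta>. K < G z"
proof (rule ccontr)
  assume "\<not> ?thesis"
  then have le: "G z \<le> K" if "\<theta> < z" for z using that by (force simp: not_less)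
  have SUP: "(SUP n. ennreal (dens z) * indicator {\<theta>..\<theta> + real n} z) = ennreal (1 / g z) * indicator {\<theta>..} z" for z
  proof (cases "\<theta> \<le> z")
    case True
    obtain n :: nat where "z - \<theta> < real n" using reals_Archimedean2 by blast
    then have "ennreal (dens z) \<le> (SUP n. ennreal (dens z) * indicator {\<theta>..\<theta> + real n} z)"
      using True by (intro SUP_upper2[of n]) auto
    moreover have "(SUP n. ennreal (dens z) * indicator {\<theta>..\<theta> + real n} z) \<le> ennreal (dens z)"
      by (intro SUP_least) (auto simp: indicator_def)
    ultimately show ?thesis using True dens_eq[of z] \<theta> by (auto intro: antisym)
  qed auto
  have "(\<integral>\<^sup>+ z\<in>{\<theta>..}. ennreal (1 / g z) \<partial>lborel)
      = (SUP n. \<integral>\<^sup>+z. ennreal (dens z) * indicator {\<theta>..\<theta> + real n} z \<partial>lborel)"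
    unfolding SUP[symmetric]
    by (intro nn_integral_monotone_convergence_SUP)
      (auto simp: incseq_def le_fun_def indicator_def)
  also have "\<dots> = (SUP n. ennreal (G (\<theta> + real n)))"
    using \<theta> by (simp add: nn_integral_dens_Icc G_\<theta>)
  also have "\<dots> \<le> ennreal (max 0 K)"
  proof (rule SUP_least)
    fix n show "ennreal (G (\<theta> + real n)) \<le> ennreal (max 0 K)"
      using le[of "\<theta> + real n"] by (cases n) (auto simp: G_\<theta> intro!: ennreal_leI)
  qed
  finally show False by (simp add: g_int top_unique)
qed

text \<open>Being C1 and zero at z0, g is at most C (z - z0) up to \<theta>, so G falls at least as
  fast as ln (z - z0) / C. Together with the divergence at infinity this makes G a bijection from
  (z0, infinity) onto the real line.\<close>

lemma G_unbounded_below: "\<exists>z>z0. z < \<theta> \<and> G z < K"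
proof -
  obtain g' where g': "continuous_on {z0..} g'" "\<And>z. z0 \<le> z \<Longrightarrow> (g has_real_derivative g' z) (at z within {z0..})"
    using g_C1 by auto
  have "compact (g' ` {z0..\<theta>})"
    by (intro compact_continuous_image continuous_on_subset[OF g'(1)]) auto
  then obtain C0 where C0: "\<forall>z\<in>{z0..\<theta>}. \<bar>g' z\<bar> \<le> C0"
    by (auto dest!: compact_imp_bounded simp: bounded_iff)
  define C where "C = max 1 C0"
  have C: "0 < C" "\<And>z. z \<in> {z0..\<theta>} \<Longrightarrow> \<bar>g' z\<bar> \<le> C" using C0 by (auto simp: C_def le_max_iff_disj)
  have g_le: "g z \<le> C * (z - z0)" if "z0 \<le> z" "z \<le> \<theta>" for z
  proof -
    have "norm (g z - g z0) \<le> C * norm (z - z0)"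
    proof (rule field_differentiable_bound[where S="{z0..\<theta>}" and f'=g'])
      show "(g has_field_derivative g' x) (at x within {z0..\<theta>})" if "x \<in> {z0..\<theta>}" for x
        by (rule DERIV_subset[OF g'(2)]) (use that in auto)
    qed (use that \<theta> C in auto)
    then show ?thesis using that by (simp add: g_z0)
  qed
  let ?H = "\<lambda>z. G z - ln (z - z0) / C"
  have H: "?H z \<le> ?H \<theta>" if "z0 < z" "z \<le> \<theta>" for z
  proof (rule DERIV_nonneg_imp_nondecreasing[OF that(2)])
    fix x assume x: "z \<le> x" "x \<le> \<theta>"
    then have x0: "z0 < x" using that by simp
    have "(?H has_real_derivative 1 / g x - 1 / (x - z0) / C) (at x)"
      using x0 C(1) by (auto intro!: derivative_eq_intros DERIV_G)
    moreover have "1 / (x - z0) / C \<le> 1 / g x"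
      using g_le[of x] g_pos[OF x0] x x0 C by (simp add: frac_le mult.commute)
    ultimately show "\<exists>d. (?H has_real_derivative d) (at x) \<and> 0 \<le> d"
      by (intro exI[of _ "1 / g x - 1 / (x - z0) / C"]) auto
  qed
  \<comment> \<open>The exponential makes ln (z - z0) / C drop below \<open>K - ?H \<theta>\<close>;
    the minimum keeps z below \<theta>.\<close>
  define z where "z = z0 + min ((\<theta> - z0) / 2) (exp (C * (K - ?H \<theta>) - 1))"
  have "0 < min ((\<theta> - z0) / 2) (exp (C * (K - ?H \<theta>) - 1))" using \<theta> by simp
  moreover have "min ((\<theta> - z0) / 2) (exp (C * (K - ?H \<theta>) - 1)) < \<theta> - z0"
    using \<theta> by (intro min.strict_coboundedI1) (simp add: field_simps)
  ultimately have z: "z0 < z" "z < \<theta>" unfolding z_def by linarith+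
  have "z - z0 \<le> exp (C * (K - ?H \<theta>) - 1)" by (simp add: z_def)
  then have "ln (z - z0) \<le> ln (exp (C * (K - ?H \<theta>) - 1))"
    using z by (subst ln_le_cancel_iff) auto
  then have "ln (z - z0) \<le> C * (K - ?H \<theta>) - 1"
    by (simp only: ln_exp)
  then have "ln (z - z0) / C < K - ?H \<theta>"
    using C(1) unfolding pos_divide_less_eq[OF C(1)] mult.commute[of _ C] by linarith
  then have "G z < K" using H[of z] z by linarith
  then show ?thesis using z by blast
qed

lemma G_surj: "\<exists>z>z0. G z = s"
proof -
  obtain a where a: "z0 < a" "a < \<theta>" "G a < s" using G_unbounded_below by blast
  obtain b where b: "\<theta> < b" "s < G b" using G_unbounded_above by blast
  have "\<exists>z\<ge>a. z \<le> b \<and> G z = s"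
    using a b by (intro IVT') (auto intro: continuous_on_subset[OF continuous_on_G])
  then obtain z where "a \<le> z" "G z = s" by auto
  then show ?thesis using a by (intro exI[of _ z]) auto
qed

definition Ginv :: "real \<Rightarrow> real" where
  "Ginv s = (THE z. z0 < z \<and> G z = s)"

lemma Ginv: "z0 < Ginv s" "G (Ginv s) = s"
proof -
  have "\<exists>!z. z0 < z \<and> G z = s" using G_surj[of s] G_eq_iff by blast
  from theI'[OF this] show "z0 < Ginv s" "G (Ginv s) = s" by (auto simp: Ginv_def)
qed

lemma Ginv_G: "z0 < z \<Longrightarrow> Ginv (G z) = z"
  using Ginv[of "G z"] G_eq_iff by auto

lemma isCont_Ginv: "isCont Ginv s"
proof -
  define d where "d = (Ginv s - z0) / 2"
  have d: "0 < d" using Ginv(1)[of s] by (simp add: d_def)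
  have gt: "z0 < z" if "\<bar>z - Ginv s\<bar> \<le> d" for z
    using abs_le_D2[OF that] Ginv(1)[of s] by (simp add: d_def field_simps)
  have "isCont Ginv (G (Ginv s))"
    by (rule isCont_inverse_function[where d=d and x="Ginv s" and f=G, OF d Ginv_G[OF gt] isCont_G[OF gt]])
  then show ?thesis by (simp add: Ginv)
qed

lemma DERIV_Ginv: "(Ginv has_real_derivative g (Ginv s)) (at s)"
proof -
  have "(Ginv has_real_derivative inverse (1 / g (Ginv s))) (at s)"
    by (rule DERIV_inverse_function[where a="s - 1" and b="s + 1" and f=G])
      (auto intro: DERIV_G isCont_Ginv simp: Ginv g_nonzero)
  then show ?thesis by simp
qed

text \<open>The solution of u' = -g(u) started at z, in closed form: G decreases along it at unit
  speed. Surjectivity of G keeps it above z0 for all times.\<close>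

definition flow :: "real \<Rightarrow> real \<Rightarrow> real" where
  "flow t z = Ginv (G z - t)"

lemma flow_gt: "z0 < flow t z" and G_flow: "G (flow t z) = G z - t"
  by (auto simp: flow_def Ginv)

lemma flow_le: "0 \<le> t \<Longrightarrow> z0 < z \<Longrightarrow> flow t z \<le> z"
  using G_le_iff[of "flow t z" z] flow_gt G_flow by simp

lemma flow_le_mono: "z0 < y \<Longrightarrow> y \<le> z \<Longrightarrow> flow t y \<le> flow t z"
  using G_le_iff[of "flow t y" "flow t z"] G_le_iff[of y z] by (simp add: flow_gt G_flow)

lemma flow_quotient: "z0 < z \<Longrightarrow> ((\<lambda>t. (z - flow t z) / t) \<longlongrightarrow> g z) (at_right 0)"
proof -
  assume z: "z0 < z"
  have "((\<lambda>t. flow t z) has_real_derivative g (flow 0 z) * (0 - 1)) (at 0)"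
    unfolding flow_def by (intro DERIV_chain2[OF DERIV_Ginv] derivative_intros)
  then have "((\<lambda>t. (flow t z - z) / t) \<longlongrightarrow> - g z) (at 0)"
    using z by (simp add: has_field_derivative_iff flow_def Ginv_G)
  then have "((\<lambda>t. - ((flow t z - z) / t)) \<longlongrightarrow> - (- g z)) (at_right 0)"
    by (intro tendsto_minus) (rule tendsto_within_subset[OF _ subset_UNIV])
  then show ?thesis
    by (simp add: minus_divide_left)
qed

lemma DERIV_flow: "z0 < z \<Longrightarrow> ((\<lambda>z. flow t z) has_real_derivative g (flow t z) / g z) (at z)"
proof -
  assume z: "z0 < z"
  have "((\<lambda>z. flow t z) has_real_derivative g (flow t z) * (1 / g z - 0)) (at z)"
    unfolding flow_def by (intro DERIV_chain2[OF DERIV_Ginv] derivative_intros DERIV_G z)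
  then show ?thesis by simp
qed

section \<open>The measure dz / g(z) and its exponential transforms\<close>

definition \<nu> :: "real measure" where
  "\<nu> = density lborel (\<lambda>z. ennreal (dens z))"

lemma sets_\<nu> [measurable_cong]: "sets \<nu> = sets borel"
  by (simp add: \<nu>_def)

lemma AE_\<nu>: "AE z in \<nu>. z0 < z"
  unfolding \<nu>_def by (subst AE_density, measurable) (auto simp: dens_def indicator_def)

lemma sigma_finite_\<nu>: "sigma_finite_measure \<nu>"
  unfolding \<nu>_def by (subst sigma_finite_measure.sigma_finite_iff_density_finite[OF sigma_finite_lborel]) auto

text \<open>G carries \<nu> to Lebesgue measure, so as a function of q this is a two-sided Laplace
  transform. Values in [0, infinity] permit exchanging integrals before finiteness is known.\<close>

definition \<Phi> :: "real \<Rightarrow> real \<Rightarrow> ennreal" where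
  "\<Phi> q x = (\<integral>\<^sup>+z. ennreal (exp (- x * z + q * GI z)) \<partial>\<nu>)"

lemma \<Phi>_lborel: "\<Phi> q x = (\<integral>\<^sup>+z. ennreal (dens z * exp (- x * z + q * GI z)) \<partial>lborel)"
  unfolding \<Phi>_def \<nu>_def by (subst nn_integral_density) (auto simp: ennreal_mult dens_nonneg)

lemma set_lborel_\<Phi>:
  "(LBINT z:{z0<..}. 1 / g z * exp (- x * z + (LBINT y=\<theta>..z. q / g y))) = enn2real (\<Phi> q x)"
proof -
  have "(LBINT z:{z0<..}. 1 / g z * exp (- x * z + (LBINT y=\<theta>..z. q / g y)))
      = (\<integral>z. dens z * exp (- x * z + q * GI z) \<partial>lborel)"
    unfolding set_lebesgue_integral_def G_scale
    by (intro Bochner_Integration.integral_cong) (auto simp: dens_def GI_def indicator_def)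
  also have "\<dots> = enn2real (\<integral>\<^sup>+z. ennreal (dens z * exp (- x * z + q * GI z)) \<partial>lborel)"
    by (rule integral_eq_nn_integral) (auto simp: dens_nonneg)
  finally show ?thesis by (simp add: \<Phi>_lborel)
qed

text \<open>Since g tends to infinity, the slope 1 / g of G is eventually at most
  \<epsilon>.\<close>

lemma G_le_linear:
  assumes "0 < \<epsilon>"
  obtains C where "\<And>z. z0 < z \<Longrightarrow> G z \<le> C + \<epsilon> * z"
proof -
  have "\<forall>\<^sub>F z in at_top. 1 / \<epsilon> \<le> g z" using g_lim by (simp add: filterlim_at_top)
  then obtain N0 where N0: "\<And>z. N0 \<le> z \<Longrightarrow> 1 / \<epsilon> \<le> g z" by (auto simp: eventually_at_top_linorder)
  define N where "N = max N0 \<theta>"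
  have N: "z0 < N" "\<And>z. N \<le> z \<Longrightarrow> 1 / \<epsilon> \<le> g z" using N0 \<theta> by (auto simp: N_def)
  have "G z \<le> \<bar>G N\<bar> + \<epsilon> * z" if "z0 < z" for z
  proof (cases "z \<le> N")
    case True
    have "G z \<le> G N" using True that N by (simp add: G_le_iff)
    moreover have "0 \<le> \<epsilon> * z" using that z0 assms by simp
    ultimately show ?thesis by simp
  next
    case False
    have "G z - \<epsilon> * z \<le> G N - \<epsilon> * N"
    proof (rule DERIV_nonpos_imp_nonincreasing[of N z "\<lambda>z. G z - \<epsilon> * z"])
      fix x assume x: "N \<le> x" "x \<le> z"
      have "((\<lambda>z. G z - \<epsilon> * z) has_real_derivative 1 / g x - \<epsilon>) (at x)"
        using x N by (auto intro!: derivative_eq_intros DERIV_G)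
      moreover have "1 / g x \<le> 1 / (1 / \<epsilon>)"
        using N x assms g_pos[of x] by (intro divide_left_mono) auto
      ultimately show "\<exists>d. ((\<lambda>z. G z - \<epsilon> * z) has_real_derivative d) (at x) \<and> d \<le> 0"
        by (intro exI[of _ "1 / g x - \<epsilon>"]) auto
    qed (use False in simp)
    moreover have "0 \<le> \<epsilon> * N" using N z0 assms by simp
    ultimately show ?thesis by simp
  qed
  then show ?thesis by (rule that)
qed

text \<open>Near z0 the density 1 / g is not integrable and exp (q G) has to compensate; at infinity
  exp (-x z) has to beat exp (q G). One bounded antiderivative handles both ends, a multiple of E /
  (1 + E) with E = exp (q G): its derivative behaves like E / g near z0 and like 1 / (g E) far
  out.\<close>

lemma \<Phi>_finite:
  assumes "0 < q" "0 < x"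
  shows "\<Phi> q x < \<infinity>"
proof -
  \<comment> \<open>The slope x / (2 q) gives exp (q G z) <= exp (q C) exp (x z / 2); the square of
    this, needed for (1 + E)^2, is just absorbed by exp (-x z).\<close>
  obtain C where C: "\<And>z. z0 < z \<Longrightarrow> G z \<le> C + x / (2 * q) * z"
    using G_le_linear[of "x / (2 * q)"] assms by auto
  define K where "K = (1 + exp (q * C))\<^sup>2 / q"
  let ?E = "\<lambda>z. exp (q * G z)"
  let ?h = "\<lambda>z. K * (dens z * q * exp (q * GI z) / (1 + exp (q * GI z))\<^sup>2)"
  have K: "0 \<le> K" using assms by (simp add: K_def)
  have "(\<integral>\<^sup>+z\<in>{z0<..}. ennreal (dens z * exp (- x * z + q * GI z)) \<partial>lborel) \<le> ennreal K"
  proof (rule nn_integral_le_antiderivative[where h="?h" and H="\<lambda>z. K * (?E z / (1 + ?E z))"])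
    fix z assume z: "z0 < z"
    have E: "1 + ?E z \<noteq> 0" using exp_gt_zero[of "q * G z"] by linarith
    have "((\<lambda>z. ?E z / (1 + ?E z)) has_real_derivative
        ((?E z * (q * (1 / g z))) * (1 + ?E z) - ?E z * (?E z * (q * (1 / g z)))) / ((1 + ?E z) * (1 + ?E z))) (at z)"
      using E z by (auto intro!: derivative_eq_intros DERIV_G)
    also have "((?E z * (q * (1 / g z))) * (1 + ?E z) - ?E z * (?E z * (q * (1 / g z)))) / ((1 + ?E z) * (1 + ?E z))
       = dens z * q * exp (q * GI z) / (1 + exp (q * GI z))\<^sup>2"
    proof -
      have "(a * b) * (1 + a) - a * (a * b) = b * a" for a b :: real by (simp add: algebra_simps)
      then show ?thesis using z by (simp only: dens_eq GI_eq power2_eq_square) (simp add: mult_ac)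
    qed
    finally show "((\<lambda>z. K * (?E z / (1 + ?E z))) has_real_derivative ?h z) (at z)"
      by (rule DERIV_cmult)
    show "0 \<le> ?h z" using K assms dens_nonneg[of z] by (intro mult_nonneg_nonneg divide_nonneg_nonneg) auto
    have E_pos: "0 < 1 + ?E z" using exp_gt_zero[of "q * G z"] by linarith
    then have frac: "0 \<le> ?E z / (1 + ?E z)" "?E z / (1 + ?E z) \<le> 1"
      by (auto simp: pos_divide_le_eq intro: divide_nonneg_pos)
    show "0 \<le> K * (?E z / (1 + ?E z))" using K frac by (intro mult_nonneg_nonneg)
    show "K * (?E z / (1 + ?E z)) \<le> K" using K frac by (intro mult_left_le)
    have "q * (C + x / (2 * q) * z) = q * C + x * z / 2" using assms by (simp add: field_simps)
    then have "q * G z \<le> q * C + x * z / 2"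
      using mult_left_mono[OF C[OF z], of q] assms by linarith
    then have "?E z \<le> exp (q * C) * exp (x * z / 2)" by (simp add: exp_add[symmetric])
    moreover have "1 \<le> exp (x * z / 2)" using assms z z0 by simp
    ultimately have "1 + ?E z \<le> (1 + exp (q * C)) * exp (x * z / 2)"
      unfolding distrib_right mult_1_left by (intro add_mono)
    then have "(1 + ?E z)\<^sup>2 \<le> ((1 + exp (q * C)) * exp (x * z / 2))\<^sup>2"
      by (rule power_mono) (simp add: add_nonneg_nonneg)
    also have "\<dots> = (1 + exp (q * C))\<^sup>2 * exp (x * z)"
      by (simp add: power_mult_distrib power2_eq_square exp_add[symmetric])
    finally have "exp (- x * z) * (1 + ?E z)\<^sup>2 \<le> exp (- x * z) * ((1 + exp (q * C))\<^sup>2 * exp (x * z))"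
      by (intro mult_left_mono) auto
    also have "\<dots> = K * q"
    proof -
      have "exp (- x * z) * exp (x * z) = 1" by (simp add: exp_add[symmetric])
      then have "exp (- x * z) * ((1 + exp (q * C))\<^sup>2 * exp (x * z)) = (1 + exp (q * C))\<^sup>2"
        by (simp only: mult.left_commute[of _ "(1 + exp (q * C))\<^sup>2"] mult_1_right)
      then show ?thesis using assms by (simp add: K_def)
    qed
    finally have "exp (- x * z) * (1 + ?E z)\<^sup>2 \<le> K * q" .
    moreover have "0 < (1 + ?E z)\<^sup>2" using E by simp
    ultimately have "exp (- x * z) \<le> K * q / (1 + ?E z)\<^sup>2"
      by (simp only: pos_le_divide_eq)
    then have "dens z * ?E z * exp (- x * z) \<le> dens z * ?E z * (K * q / (1 + ?E z)\<^sup>2)"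
      using dens_nonneg[of z] by (intro mult_left_mono) auto
    then show "dens z * exp (- x * z + q * GI z) \<le> ?h z"
      using z unfolding exp_add by (simp add: GI_eq mult_ac)
  qed auto
  also have "(\<integral>\<^sup>+z\<in>{z0<..}. ennreal (dens z * exp (- x * z + q * GI z)) \<partial>lborel) = \<Phi> q x"
    unfolding \<Phi>_lborel by (intro nn_integral_cong) (auto simp: dens_def indicator_def)
  finally show ?thesis using ennreal_less_top le_less_trans by fastforce
qed

lemma \<Phi>_pos: "0 < \<Phi> q x"
proof (rule ccontr)
  assume "\<not> 0 < \<Phi> q x"
  then have "(\<integral>\<^sup>+z. ennreal (dens z * exp (- x * z + q * GI z)) \<partial>lborel) = 0"
    unfolding \<Phi>_lborel by simp
  then have "AE z in lborel. ennreal (dens z * exp (- x * z + q * GI z)) = 0"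
    by (subst (asm) nn_integral_0_iff_AE) auto
  then have "AE z in lborel. z \<notin> {\<theta>..\<theta> + 1}"
  proof eventually_elim
    case (elim z)
    show ?case
    proof
      assume "z \<in> {\<theta>..\<theta> + 1}"
      then have "0 < dens z" using \<theta> g_pos[of z] by (simp add: dens_eq)
      then have "0 < dens z * exp (- x * z + q * GI z)" by simp
      then show False using elim by (simp add: ennreal_eq_0_iff)
    qed
  qed
  then have "{\<theta>..\<theta> + 1} \<in> null_sets lborel"
    by (subst AE_iff_null_sets) auto
  then have "emeasure lborel {\<theta>..\<theta> + 1} = 0" by auto
  then show False by simp
qed

text \<open>The offset n + 2 keeps the levels at or above l / 2, so the integrand at level l / 2
  dominates.\<close>

lemma \<Phi>_left_continuous:
  assumes "0 < q" "0 < l"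
  shows "(\<lambda>n. \<Phi> q (l * (1 - 1 / real (n + 2)))) \<longlonglongrightarrow> \<Phi> q l"
  unfolding \<Phi>_def
proof (rule nn_integral_dominated_convergence[where w="\<lambda>z. ennreal (exp (- (l / 2) * z + q * GI z))"])
  show "AE z in \<nu>. ennreal (exp (- (l * (1 - 1 / real (n + 2))) * z + q * GI z)) \<le> ennreal (exp (- (l / 2) * z + q * GI z))" for n
    using AE_\<nu>
  proof eventually_elim
    case (elim z)
    have "1 / real (n + 2) \<le> 1 / 2" by (rule frac_le) auto
    then have "l * (1 / 2) * z \<le> l * (1 - 1 / real (n + 2)) * z"
      using assms elim z0 by (intro mult_right_mono mult_left_mono) auto
    then show ?case by (intro ennreal_leI) simp
  qed
  show "(\<integral>\<^sup>+z. ennreal (exp (- (l / 2) * z + q * GI z)) \<partial>\<nu>) < \<infinity>"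
    using \<Phi>_finite[of q "l / 2"] assms by (simp add: \<Phi>_def)
  have "(\<lambda>n. 1 / real (n + 2)) \<longlonglongrightarrow> 0" by real_asymp
  then have "(\<lambda>n. exp (- (l * (1 - 1 / real (n + 2))) * z + q * GI z)) \<longlonglongrightarrow> exp (- (l * (1 - 0)) * z + q * GI z)" for z
    by (intro tendsto_intros)
  then show "AE z in \<nu>. (\<lambda>n. ennreal (exp (- (l * (1 - 1 / real (n + 2))) * z + q * GI z))) \<longlonglongrightarrow> ennreal (exp (- l * z + q * GI z))"
    by (intro AE_I2 tendsto_ennrealI) simp
qed auto

text \<open>Beyond some Z the factor exp ((q' - q) G) is at least 2 / \<epsilon>. The part of the
  integral up to Z stays bounded as l tends to 0, whereas \<open>\<Phi> q' l\<close> grows without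
  bound because the integral of 1 / g diverges.\<close>

lemma \<Phi>_ratio:
  assumes q: "0 < q" "q < q'" and \<epsilon>: "0 < \<epsilon>"
  shows "\<exists>\<delta>>0. \<forall>l. 0 < l \<and> l < \<delta> \<longrightarrow> \<Phi> q l \<le> ennreal \<epsilon> * \<Phi> q' l"
proof -
  obtain Z where Z: "\<theta> < Z" "- ln (\<epsilon> / 2) / (q' - q) < G Z" using G_unbounded_above by blast
  have small: "exp (q * G z) \<le> \<epsilon> / 2 * exp (q' * G z)" if "Z \<le> z" for z
  proof -
    have "G Z \<le> G z" using that Z \<theta> by (simp add: G_le_iff)
    then have "- ln (\<epsilon> / 2) / (q' - q) \<le> G z" using Z by simp
    then have "- ln (\<epsilon> / 2) \<le> (q' - q) * G z" using q by (simp add: field_simps)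
    then have "exp (q * G z) \<le> exp (ln (\<epsilon> / 2) + q' * G z)" by (simp add: algebra_simps)
    then show ?thesis using \<epsilon> by (simp add: exp_add)
  qed
  \<comment> \<open>Bounds the part z <= Z for all l at once, by exp (-l z) <= 1 <= exp Z exp
    (-z).\<close>
  define C where "C = enn2real (\<Phi> q 1) * exp Z"
  have C: "0 \<le> C" "ennreal (exp Z) * \<Phi> q 1 = ennreal C"
    using \<Phi>_finite[of q 1] q by (auto simp: C_def ennreal_mult mult.commute)
  have le: "\<Phi> q l \<le> ennreal C + ennreal (\<epsilon> / 2) * \<Phi> q' l" if l: "0 < l" for l
  proof -
    have "\<Phi> q l \<le> (\<integral>\<^sup>+z. ennreal (exp Z) * ennreal (exp (- 1 * z + q * GI z)) + ennreal (\<epsilon> / 2) * ennreal (exp (- l * z + q' * GI z)) \<partial>\<nu>)"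
      unfolding \<Phi>_def
    proof (rule nn_integral_mono_AE)
      show "AE z in \<nu>. ennreal (exp (- l * z + q * GI z)) \<le>
          ennreal (exp Z) * ennreal (exp (- 1 * z + q * GI z)) + ennreal (\<epsilon> / 2) * ennreal (exp (- l * z + q' * GI z))"
        using AE_\<nu>
      proof eventually_elim
        case (elim z)
        have "exp (- l * z + q * GI z) \<le> exp Z * exp (- 1 * z + q * GI z) + \<epsilon> / 2 * exp (- l * z + q' * GI z)"
        proof (cases "z \<le> Z")
          case True
          have "0 \<le> l * z" using l elim z0 by simp
          then have "exp (- l * z + q * GI z) \<le> exp Z * exp (- 1 * z + q * GI z)"
            using True by (simp add: exp_add[symmetric])
          moreover have "0 \<le> \<epsilon> / 2 * exp (- l * z + q' * GI z)" using \<epsilon> by simp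
          ultimately show ?thesis by linarith
        next
          case False
          have "exp (q * GI z) \<le> \<epsilon> / 2 * exp (q' * GI z)"
            using small[of z] False elim by (simp add: GI_eq)
          then have "exp (- l * z) * exp (q * GI z) \<le> exp (- l * z) * (\<epsilon> / 2 * exp (q' * GI z))"
            by (rule mult_left_mono) simp
          also have "\<dots> = \<epsilon> / 2 * exp (- l * z + q' * GI z)" unfolding exp_add by simp
          finally have "exp (- l * z + q * GI z) \<le> \<epsilon> / 2 * exp (- l * z + q' * GI z)"
            by (simp only: exp_add)
          moreover have "0 \<le> exp Z * exp (- 1 * z + q * GI z)" by simp
          ultimately show ?thesis by linarith
        qed
        then show ?case using \<epsilon> by (simp add: ennreal_mult[symmetric] ennreal_plus[symmetric] del: ennreal_plus)
      qed
    qed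
    also have "\<dots> = ennreal (exp Z) * \<Phi> q 1 + ennreal (\<epsilon> / 2) * \<Phi> q' l"
      unfolding \<Phi>_def by (subst nn_integral_add) (auto simp: nn_integral_cmult)
    finally show ?thesis by (simp add: C)
  qed
  \<comment> \<open>For l < 1 / M the factor exp (-l z) is at least exp (-1) on [\<theta>, M], over
    which 1 / g integrates to \<open>G M\<close>.\<close>
  obtain M where M: "\<theta> < M" "2 * C / \<epsilon> * exp 1 < G M" using G_unbounded_above by blast
  have M0: "0 < M" using M \<theta> z0 by simp
  have big: "ennreal (2 * C / \<epsilon>) \<le> \<Phi> q' l" if l: "0 < l" "l < 1 / M" for l
  proof -
    have "ennreal (2 * C / \<epsilon>) \<le> ennreal (exp (- 1) * G M)"
    proof (rule ennreal_leI)
      have "exp (- 1) * (2 * C / \<epsilon> * exp 1) \<le> exp (- 1) * G M" using M by (intro mult_left_mono) auto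
      moreover have "exp (- 1) * (2 * C / \<epsilon> * exp 1) = 2 * C / \<epsilon>" by (simp add: exp_minus)
      ultimately show "2 * C / \<epsilon> \<le> exp (- 1) * G M" by (simp only:)
    qed
    also have "\<dots> = ennreal (exp (- 1)) * (\<integral>\<^sup>+z. ennreal (dens z) * indicator {\<theta>..M} z \<partial>lborel)"
      using M \<theta> by (simp add: nn_integral_dens_Icc G_\<theta> ennreal_mult')
    also have "\<dots> = (\<integral>\<^sup>+z. ennreal (exp (- 1)) * (ennreal (dens z) * indicator {\<theta>..M} z) \<partial>lborel)"
      by (subst nn_integral_cmult) auto
    also have "\<dots> \<le> \<Phi> q' l"
      unfolding \<Phi>_lborel
    proof (rule nn_integral_mono)
      fix z
      show "ennreal (exp (- 1)) * (ennreal (dens z) * indicator {\<theta>..M} z) \<le> ennreal (dens z * exp (- l * z + q' * GI z))"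
      proof (cases "z \<in> {\<theta>..M}")
        case True
        have "l * z \<le> (1 / M) * M" using True l M0 \<theta> z0 by (intro mult_mono) auto
        then have "l * z \<le> 1" using M0 by simp
        moreover have "0 \<le> q' * GI z" using True \<theta> q G_le_iff[of \<theta> z] by (simp add: GI_eq G_\<theta>)
        ultimately have "exp (- 1) \<le> exp (- l * z + q' * GI z)" by simp
        then have "dens z * exp (- 1) \<le> dens z * exp (- l * z + q' * GI z)" by (intro mult_left_mono dens_nonneg)
        then show ?thesis
          using True dens_nonneg[of z] by (simp add: ennreal_mult[symmetric] mult.commute ennreal_leI)
      qed simp
    qed
    finally show ?thesis .
  qed
  show ?thesis
  proof (intro exI[of _ "1 / M"] conjI allI impI)
    show "0 < 1 / M" using M0 by simp
    fix l assume l: "0 < l \<and> l < 1 / M"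
    have "ennreal C = ennreal (\<epsilon> / 2) * ennreal (2 * C / \<epsilon>)"
      using \<epsilon> C by (simp add: ennreal_mult[symmetric])
    also have "\<dots> \<le> ennreal (\<epsilon> / 2) * \<Phi> q' l" using l by (intro mult_left_mono big) auto
    finally have "\<Phi> q l \<le> ennreal (\<epsilon> / 2) * \<Phi> q' l + ennreal (\<epsilon> / 2) * \<Phi> q' l"
      using le[of l] l by (meson add_right_mono order_trans)
    also have "\<dots> = ennreal \<epsilon> * \<Phi> q' l"
      using \<epsilon> by (simp add: distrib_right[symmetric] ennreal_plus[symmetric] del: ennreal_plus)
    finally show "\<Phi> q l \<le> ennreal \<epsilon> * \<Phi> q' l" .
  qed
qed

text \<open>In the variable G both sides are transforms in q: the left one of the image of f d\<nu>,
  the right one of the image of exp (-x z) d\<nu> shifted by t. Uniqueness equates the two measures.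
  In terms of z the shift is the flow, and differentiating the masses of intervals compares the
  densities pointwise, by continuity of f.\<close>

lemma laplace_from_\<Phi>:
  fixes f :: "real \<Rightarrow> real"
  assumes Q: "0 < Q" and x: "0 < x"
    and f: "continuous_on {z0<..} f" "\<And>z. 0 \<le> f z" and [measurable]: "f \<in> borel_measurable borel"
    and eq: "\<And>q. Q < q \<Longrightarrow> (\<integral>\<^sup>+z. ennreal (f z) * ennreal (exp (q * GI z)) \<partial>\<nu>) = ennreal (exp (q * t)) * \<Phi> q x"
    and z: "z0 < z"
  shows "f z = exp (- x * flow t z)"
proof -
  define M1 where "M1 = distr (density \<nu> (\<lambda>z. ennreal (f z))) borel GI"
  define M2 where "M2 = distr (density \<nu> (\<lambda>z. ennreal (exp (- x * z)))) borel (\<lambda>z. GI z + t)"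
  have M1: "(\<integral>\<^sup>+s. ennreal (exp (q * s)) \<partial>M1) = (\<integral>\<^sup>+z. ennreal (f z) * ennreal (exp (q * GI z)) \<partial>\<nu>)" for q
    unfolding M1_def by (subst nn_integral_distr) (auto simp: nn_integral_density)
  have M2: "(\<integral>\<^sup>+s. ennreal (exp (q * s)) \<partial>M2) = ennreal (exp (q * t)) * \<Phi> q x" for q
  proof -
    have "(\<integral>\<^sup>+s. ennreal (exp (q * s)) \<partial>M2) = (\<integral>\<^sup>+z. ennreal (exp (- x * z)) * ennreal (exp (q * (GI z + t))) \<partial>\<nu>)"
      unfolding M2_def by (subst nn_integral_distr) (auto simp: nn_integral_density)
    also have "\<dots> = (\<integral>\<^sup>+z. ennreal (exp (q * t)) * ennreal (exp (- x * z + q * GI z)) \<partial>\<nu>)"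
      by (intro nn_integral_cong) (simp add: ennreal_mult[symmetric] exp_add[symmetric] algebra_simps)
    also have "\<dots> = ennreal (exp (q * t)) * \<Phi> q x"
      unfolding \<Phi>_def by (rule nn_integral_cmult) simp
    finally show ?thesis .
  qed
  have "M1 = M2"
  proof (rule exp_transform_unique[where a=Q and b="Q + 1"])
    fix r assume r: "Q < r" "r < Q + 1"
    show "(\<integral>\<^sup>+s. ennreal (exp (r * s)) \<partial>M1) = (\<integral>\<^sup>+s. ennreal (exp (r * s)) \<partial>M2)"
      using r by (simp add: M1 M2 eq)
    show "(\<integral>\<^sup>+s. ennreal (exp (r * s)) \<partial>M1) < \<infinity>"
      using r \<Phi>_finite[of r x] Q x by (simp add: M1 eq ennreal_mult_less_top)
  qed (auto simp: M1_def M2_def)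
  define H where "H z = (LBINT y=\<theta>..z. f y * (1 / g y))" for z :: real
  define K where "K z = (LBINT y=\<theta>..z. exp (- x * y) * (1 / g y))" for z :: real
  have DH: "(H has_real_derivative f z * (1 / g z)) (at z)" if "z0 < z" for z
    unfolding H_def[abs_def] using that
    by (intro antiderivative continuous_on_mult f continuous_on_inverse_g)
  have DK: "(K has_real_derivative exp (- x * z) * (1 / g z)) (at z)" if "z0 < z" for z
    unfolding K_def[abs_def] using that
    by (intro antiderivative[where h="\<lambda>y. exp (- x * y) * (1 / g y)"] continuous_on_mult continuous_on_inverse_g continuous_intros)
  \<comment> \<open>The two sides are the masses of [G b, G a] under \<open>M1\<close> and
    \<open>M2\<close>: undoing the shift by t turns [b, a] into [flow t b, flow t a].\<close>
  have int_eq: "H a - H b = K (flow t a) - K (flow t b)" if ba: "z0 < b" "b \<le> a" for a b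
  proof -
    have H_mono: "H b \<le> H a"
    proof (rule DERIV_nonneg_imp_nondecreasing[OF ba(2)])
      fix y assume "b \<le> y"
      then have y: "z0 < y" using ba by simp
      show "\<exists>d. (H has_real_derivative d) (at y) \<and> 0 \<le> d"
        using DH[OF y] f(2)[of y] g_pos[OF y] by (intro exI[of _ "f y * (1 / g y)"]) auto
    qed
    have K_mono: "K (flow t b) \<le> K (flow t a)"
    proof (rule DERIV_nonneg_imp_nondecreasing[OF flow_le_mono[OF ba]])
      fix y assume "flow t b \<le> y"
      then have y: "z0 < y" using flow_gt[of t b] by simp
      show "\<exists>d. (K has_real_derivative d) (at y) \<and> 0 \<le> d"
        using DK[OF y] g_pos[OF y] by (intro exI[of _ "exp (- x * y) * (1 / g y)"]) auto
    qed
    have "emeasure M1 {G b..G a} = (\<integral>\<^sup>+z. ennreal (f z) * indicator (GI -` {G b..G a}) z \<partial>\<nu>)"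
    proof -
      have "GI -` {G b..G a} \<in> sets borel" using measurable_sets[OF GI_measurable, of "{G b..G a}"] by simp
      then show ?thesis
        unfolding M1_def by (subst emeasure_distr) (auto simp: emeasure_density sets_\<nu> \<nu>_def)
    qed
    also have "\<dots> = (\<integral>\<^sup>+z. ennreal (f z) * indicator {b..a} z \<partial>\<nu>)"
    proof (rule nn_integral_cong_AE)
      show "AE z in \<nu>. ennreal (f z) * indicator (GI -` {G b..G a}) z = ennreal (f z) * indicator {b..a} z"
        using AE_\<nu> by eventually_elim (use ba in \<open>auto simp: indicator_def GI_eq G_le_iff\<close>)
    qed
    also have "\<dots> = (\<integral>\<^sup>+z. ennreal (f z * dens z) * indicator {b..a} z \<partial>lborel)"
      unfolding \<nu>_def by (subst nn_integral_density) (auto simp: ennreal_mult f dens_nonneg mult_ac)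
    also have "\<dots> = ennreal (H a - H b)"
    proof -
      have "(H has_real_derivative f z * dens z) (at z)" if "b \<le> z" for z
        using that ba DH[of z] by (simp add: dens_eq)
      then show ?thesis
        using ba by (intro nn_integral_FTC_Icc) (auto simp: f dens_nonneg)
    qed
    finally have 1: "emeasure M1 {G b..G a} = ennreal (H a - H b)" .
    have "emeasure M2 {G b..G a} = (\<integral>\<^sup>+z. ennreal (exp (- x * z)) * indicator ((\<lambda>z. GI z + t) -` {G b..G a}) z \<partial>\<nu>)"
    proof -
      have "(\<lambda>z. GI z + t) -` {G b..G a} \<in> sets borel"
        using measurable_sets[of "\<lambda>z. GI z + t" borel borel "{G b..G a}"] by simp
      then show ?thesis
        unfolding M2_def by (subst emeasure_distr) (auto simp: emeasure_density sets_\<nu> \<nu>_def)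
    qed
    also have "\<dots> = (\<integral>\<^sup>+z. ennreal (exp (- x * z)) * indicator {flow t b..flow t a} z \<partial>\<nu>)"
    proof (rule nn_integral_cong_AE)
      show "AE z in \<nu>. ennreal (exp (- x * z)) * indicator ((\<lambda>z. GI z + t) -` {G b..G a}) z
          = ennreal (exp (- x * z)) * indicator {flow t b..flow t a} z"
        using AE_\<nu>
      proof eventually_elim
        case (elim z)
        have "G (flow t b) \<le> G z \<longleftrightarrow> flow t b \<le> z" "G z \<le> G (flow t a) \<longleftrightarrow> z \<le> flow t a"
          using elim flow_gt by (auto simp: G_le_iff)
        then show ?case using elim by (auto simp: indicator_def GI_eq G_flow)
      qed
    qed
    also have "\<dots> = (\<integral>\<^sup>+z. ennreal (exp (- x * z) * dens z) * indicator {flow t b..flow t a} z \<partial>lborel)"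
      unfolding \<nu>_def by (subst nn_integral_density) (auto simp: ennreal_mult dens_nonneg mult_ac)
    also have "\<dots> = ennreal (K (flow t a) - K (flow t b))"
    proof -
      have "(K has_real_derivative exp (- x * y) * dens y) (at y)" if "flow t b \<le> y" for y
        using DK[of y] less_le_trans[OF flow_gt that] by (simp add: dens_eq)
      then show ?thesis
        using flow_le_mono[OF ba, of t] by (intro nn_integral_FTC_Icc) (auto simp: dens_nonneg)
    qed
    finally have 2: "emeasure M2 {G b..G a} = ennreal (K (flow t a) - K (flow t b))" .
    show ?thesis
      using 1 2 H_mono K_mono by (simp add: \<open>M1 = M2\<close>)
  qed
  define b where "b = (z0 + z) / 2"
  have b: "z0 < b" "b < z" using z by (auto simp: b_def)
  \<comment> \<open>The derivative of the flow trades the density 1 / g at \<open>flow t z\<close>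
    for 1 / g at z, which then cancels against the density on the side of f.\<close>
  have D1: "((\<lambda>a. K (flow t a)) has_real_derivative
      exp (- x * flow t z) * (1 / g (flow t z)) * (g (flow t z) / g z)) (at z)"
    by (rule DERIV_chain2[OF DK[OF flow_gt] DERIV_flow[OF z]])
  have D2: "((\<lambda>a. H a + (K (flow t b) - H b)) has_real_derivative f z * (1 / g z)) (at z)"
    using DH[OF z] by (auto intro!: derivative_eq_intros)
  have "((\<lambda>a. K (flow t a)) has_real_derivative f z * (1 / g z)) (at z)"
  proof (rule has_field_derivative_transform_within_open[OF D2, of "{b<..}"])
    fix a assume "a \<in> {b<..}"
    then show "H a + (K (flow t b) - H b) = K (flow t a)" using int_eq[of b a] b by simp
  qed (use b in auto)
  from DERIV_unique[OF D1 this] show ?thesis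
    using g_nonzero[OF z] g_nonzero[OF flow_gt[of t z]] by simp
qed

end

section \<open>First passage and the Markov property\<close>

abbreviation path_space :: "(ennreal \<Rightarrow> ereal) measure" where
  "path_space \<equiv> PiM UNIV (\<lambda>_. borel)"

text \<open>Closed under adding and, as long as the result is nonnegative, subtracting \<open>t\<close>: passage times read off this
  countable dense set of times are compatible with the shift by \<open>t\<close>.\<close>

definition grid :: "real \<Rightarrow> real set" where
  "grid t = {r. 0 \<le> r \<and> (\<exists>a\<in>\<rat>. \<exists>k::int. r = a + of_int k * t)}"

lemma countable_grid: "countable (grid t)"
proof (rule countable_subset)
  show "grid t \<subseteq> (\<lambda>(a, k::int). a + of_int k * t) ` (\<rat> \<times> UNIV)"
    by (auto simp: grid_def)
  show "countable ((\<lambda>(a, k::int). a + of_int k * t) ` (\<rat> \<times> UNIV))"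
    by (intro countable_image countable_SIGMA countable_rat) auto
qed

lemma grid_dense:
  assumes "0 \<le> a" "a < b"
  obtains r where "r \<in> grid t" "a < r" "r < b"
proof -
  obtain r where "r \<in> \<rat>" "a < r" "r < b" using Rats_dense_in_real[OF assms(2)] by blast
  then show ?thesis
    using assms by (intro that[of r]) (auto simp: grid_def intro!: bexI[of _ r] exI[of _ 0])
qed

lemma grid_nonneg: "r \<in> grid t \<Longrightarrow> 0 \<le> r"
  by (simp add: grid_def)

lemma grid_shift: "0 \<le> t \<Longrightarrow> r \<in> grid t \<Longrightarrow> t + r \<in> grid t"
  unfolding grid_def
proof safe
  fix a :: real and k :: int assume "a \<in> \<rat>" "0 \<le> t" "0 \<le> a + of_int k * t"
  then show "\<exists>a'\<in>\<rat>. \<exists>k'::int. t + (a + of_int k * t) = a' + of_int k' * t"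
    by (intro bexI[of _ a] exI[of _ "k + 1"]) (auto simp: algebra_simps)
qed auto

lemma grid_unshift: "t \<le> r \<Longrightarrow> r \<in> grid t \<Longrightarrow> r - t \<in> grid t"
  unfolding grid_def
proof safe
  fix a :: real and k :: int assume "a \<in> \<rat>"
  then show "\<exists>a'\<in>\<rat>. \<exists>k'::int. a + of_int k * t - t = a' + of_int k' * t"
    by (intro bexI[of _ a] exI[of _ "k - 1"]) (auto simp: algebra_simps)
qed auto

lemma grid_self: "0 \<le> t \<Longrightarrow> t \<in> grid t"
  unfolding grid_def by (auto intro!: bexI[of _ 0] exI[of _ 1])

text \<open>The value of \<open>exp (-q T)\<close> for the passage time \<open>T\<close> strictly below \<open>l\<close>, as a functional of countably many
  coordinates.\<close>

definition passage_discount :: "real set \<Rightarrow> real \<Rightarrow> real \<Rightarrow> (ennreal \<Rightarrow> ereal) \<Rightarrow> ennreal" where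
  "passage_discount D l q \<omega> = (SUP r\<in>D. if \<omega> (ennreal r) < ereal l then ennreal (exp (- q * r)) else 0)"

lemma measurable_passage_discount:
  assumes "countable D"
  shows "passage_discount D l q \<in> borel_measurable path_space"
  unfolding passage_discount_def[abs_def]
  by (intro borel_measurable_SUP assms) measurable

lemma passage_discount_upper:
  "r \<in> D \<Longrightarrow> \<omega> (ennreal r) < ereal l \<Longrightarrow> ennreal (exp (- q * r)) \<le> passage_discount D l q \<omega>"
  unfolding passage_discount_def by (rule SUP_upper2[of r]) auto

lemma passage_discount_least:
  "(\<And>r. r \<in> D \<Longrightarrow> \<omega> (ennreal r) < ereal l \<Longrightarrow> ennreal (exp (- q * r)) \<le> c) \<Longrightarrow> passage_discount D l q \<omega> \<le> c"
  unfolding passage_discount_def by (rule SUP_least) auto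

text \<open>The value at infinity is 0 even for z = 0, so that z = 0 yields the probability of
  survival.\<close>

definition exp_ereal :: "real \<Rightarrow> ereal \<Rightarrow> ennreal" where
  "exp_ereal z y = (if y = \<infinity> then 0 else ennreal (exp (- z * real_of_ereal y)))"

lemma measurable_exp_ereal [measurable]: "exp_ereal z \<in> borel_measurable borel"
  unfolding exp_ereal_def[abs_def] by measurable

locale branching_setting = branching_rate z0 \<theta> g for z0 \<theta> :: real and g :: "real \<Rightarrow> real" +
  fixes \<Omega> :: "'a set" and P :: "real \<Rightarrow> 'a measure" and F :: "ennreal \<Rightarrow> 'a measure"
    and X :: "ennreal \<Rightarrow> 'a \<Rightarrow> real" and \<zeta> :: "'a \<Rightarrow> ennreal" and Q :: real
  assumes setting: "standing_setting \<Omega> P F X \<zeta>"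
    and Q: "0 < Q"
    and laplace: "\<And>l x q. 0 < l \<Longrightarrow> l \<le> x \<Longrightarrow> Q < q \<Longrightarrow>
        (\<integral> w. (if first_passage_below X \<zeta> l w < \<zeta> w
                 then exp (- q * enn2real (first_passage_below X \<zeta> l w)) else 0) \<partial>P x)
        = (LBINT z:{z0<..}. 1 / g z * exp (- x * z + (LBINT y=\<theta>..z. q / g y)))
          / (LBINT z:{z0<..}. 1 / g z * exp (- l * z + (LBINT y=\<theta>..z. q / g y)))"
begin

abbreviation K :: "'a \<Rightarrow> ennreal \<Rightarrow> ereal" where
  "K \<equiv> killed_path X \<zeta>"

lemmas setting_unfolded = setting[unfolded standing_setting_def]
lemmas setting_measures = setting_unfolded[THEN conjunct1]
lemmas setting_filtration = setting_unfolded[THEN conjunct2, THEN conjunct1]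
lemmas setting_adapted = setting_unfolded[THEN conjunct2, THEN conjunct2, THEN conjunct2, THEN conjunct2]
lemmas setting_lifetime = setting_adapted[THEN conjunct2, THEN conjunct2]
lemmas setting_cadlag = setting_lifetime[THEN conjunct2]
lemmas setting_normal = setting_cadlag[THEN conjunct2, THEN conjunct2, THEN conjunct2]
lemmas setting_markov = setting_normal[THEN conjunct2]

lemma prob_P: "0 < x \<Longrightarrow> prob_space (P x)"
  and space_P: "0 < x \<Longrightarrow> space (P x) = \<Omega>"
  and sets_F_P: "0 < x \<Longrightarrow> sets (F \<infinity>) \<subseteq> sets (P x)"
  and filtration_F: "filtration \<Omega> F"
  and adapted: "t < \<infinity> \<Longrightarrow> (\<lambda>w. K w t) \<in> borel_measurable (F t)"
  and \<zeta>_pos: "0 < x \<Longrightarrow> AE w in P x. 0 < \<zeta> w"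
  and normal: "0 < x \<Longrightarrow> AE w in P x. X 0 w = x"
  using setting_measures setting_filtration setting_adapted[THEN conjunct1]
    setting_lifetime[THEN conjunct1] setting_normal[THEN conjunct1] by auto

lemma X_pos: "w \<in> \<Omega> \<Longrightarrow> t < \<zeta> w \<Longrightarrow> 0 < X t w"
  and X_right: "w \<in> \<Omega> \<Longrightarrow> t < \<zeta> w \<Longrightarrow> ((\<lambda>s. X s w) \<longlongrightarrow> X t w) (at_right t)"
  and X_left: "w \<in> \<Omega> \<Longrightarrow> t < \<zeta> w \<Longrightarrow> 0 < t \<Longrightarrow> \<exists>l>0. ((\<lambda>s. X s w) \<longlongrightarrow> l) (at_left t)"
  using setting_cadlag[THEN conjunct1, rule_format] by auto

lemma strong_markov:
  "stopping_time F S \<Longrightarrow> 0 < x \<Longrightarrow> H \<in> borel_measurable path_space \<Longrightarrow>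
    (AE w in P x. S w < \<zeta> w \<longrightarrow>
       nn_cond_exp (P x) (filtration.pre_sigma \<Omega> F S) (\<lambda>w'. H (\<lambda>t. K w' (S w' + t))) w
         = (\<integral>\<^sup>+ w'. H (K w') \<partial>P (X (S w) w)))"
  using setting_markov[THEN conjunct1, rule_format] .

sublocale filtration \<Omega> F by (rule filtration_F)

lemma F_measurable_P: "0 < x \<Longrightarrow> f \<in> borel_measurable (F t) \<Longrightarrow> f \<in> borel_measurable (P x)"
  using sets_F_P[of x] sets_F_mono[of t \<infinity>] space_F[of t] space_P[of x]
  by (auto simp: measurable_def)

lemma F_sets_P: "0 < x \<Longrightarrow> A \<in> sets (F t) \<Longrightarrow> A \<in> sets (P x)"
  using sets_F_P[of x] sets_F_mono[of t \<infinity>] by auto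

lemma K_measurable: "0 < x \<Longrightarrow> (\<lambda>w. K w t) \<in> borel_measurable (P x)"
proof (cases "t < \<infinity>")
  case True
  then show "0 < x \<Longrightarrow> ?thesis" using F_measurable_P[OF _ adapted] by blast
next
  case False
  then have "(\<lambda>w. K w t) = (\<lambda>w. \<infinity>)" by (auto simp: killed_path_def fun_eq_iff top_unique not_less)
  then show "0 < x \<Longrightarrow> ?thesis" by simp
qed

lemma K_shift_measurable:
  "0 < x \<Longrightarrow> (\<lambda>w r. K w (t + r)) \<in> measurable (P x) path_space"
  by (rule measurable_PiM_single') (auto intro: K_measurable)

lemma K_path_measurable:
  "0 < x \<Longrightarrow> (\<lambda>w. K w) \<in> measurable (P x) path_space"
  using K_shift_measurable[of x 0] by simp

lemma K_eq: "t < \<zeta> w \<Longrightarrow> K w t = ereal (X t w)"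
  by (simp add: killed_path_def)

lemma K_infinity_iff: "K w t = \<infinity> \<longleftrightarrow> \<zeta> w \<le> t"
  by (auto simp: killed_path_def not_less)

lemma K_less_iff: "K w t < ereal l \<longleftrightarrow> t < \<zeta> w \<and> X t w < l"
  by (simp add: killed_path_def)

lemma markov_property:
  assumes x: "0 < x" and A: "A \<in> sets (F (ennreal t))" "\<And>w. w \<in> A \<Longrightarrow> ennreal t < \<zeta> w"
    and H: "H \<in> borel_measurable path_space"
  shows "(\<integral>\<^sup>+w. indicator A w * H (\<lambda>r. K w (ennreal t + r)) \<partial>P x)
    = (\<integral>\<^sup>+w. indicator A w * (\<integral>\<^sup>+ w'. H (K w') \<partial>P (X (ennreal t) w)) \<partial>P x)"
proof -
  interpret prob_space "P x" by (rule prob_P[OF x])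
  let ?S = "\<lambda>w::'a. ennreal t"
  have S: "stopping_time F ?S" by (rule stopping_time_const)
  have sub: "subalgebra (P x) (pre_sigma ?S)"
    unfolding subalgebra_def
  proof
    show "space (pre_sigma ?S) = space (P x)" using space_P[OF x] by (simp add: space_pre_sigma)
    show "sets (pre_sigma ?S) \<subseteq> sets (P x)"
    proof
      fix B assume "B \<in> sets (pre_sigma ?S)"
      then have "{w \<in> B. ennreal t \<le> \<infinity>} \<in> sets (F \<infinity>)" using S by (rule sets_pre_sigmaD[rotated])
      then show "B \<in> sets (P x)" using F_sets_P[OF x] by simp
    qed
  qed
  interpret finite_measure_subalgebra "P x" "pre_sigma ?S"
    by unfold_locales (rule sub)
  have A': "A \<in> sets (pre_sigma ?S)"
  proof (rule sets_pre_sigmaI[OF S])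
    fix s show "{w \<in> A. ennreal t \<le> s} \<in> sets (F s)"
      using A(1) sets_F_mono[of "ennreal t" s] by (cases "ennreal t \<le> s") auto
  qed
  have [measurable]: "(\<lambda>w. H (\<lambda>r. K w (ennreal t + r))) \<in> borel_measurable (P x)"
    using measurable_compose[OF K_shift_measurable[OF x] H] by simp
  have "(\<integral>\<^sup>+w. indicator A w * H (\<lambda>r. K w (ennreal t + r)) \<partial>P x)
      = (\<integral>\<^sup>+w. indicator A w * nn_cond_exp (P x) (pre_sigma ?S) (\<lambda>w'. H (\<lambda>r. K w' (ennreal t + r))) w \<partial>P x)"
    using A' by (intro nn_cond_exp_intg[symmetric]) auto
  also have "\<dots> = (\<integral>\<^sup>+w. indicator A w * (\<integral>\<^sup>+ w'. H (K w') \<partial>P (X (ennreal t) w)) \<partial>P x)"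
    using strong_markov[OF S x H]
    by (intro nn_integral_cong_AE, elim eventually_mono) (auto simp: indicator_def A(2))
  finally show ?thesis .
qed

text \<open>Values and left limits on [0, t] are positive, so every time has a neighbourhood with a
  positive lower bound; compactness provides a common one.\<close>

lemma positive_infimum:
  assumes w: "w \<in> \<Omega>" and t: "ennreal t < \<zeta> w" "0 \<le> t"
  shows "\<exists>l>0. \<forall>s. 0 \<le> s \<and> s \<le> t \<longrightarrow> l \<le> X (ennreal s) w"
proof -
  have loc: "\<exists>c>0. \<forall>\<^sub>F s' in nhds s. c \<le> X (ennreal s') w" if s: "s \<in> {0..t}" for s
  proof -
    let ?s = "ennreal s"
    have sz: "?s < \<zeta> w" using s t by (auto intro: le_less_trans[OF ennreal_leI])
    have pos: "0 < X ?s w" by (rule X_pos[OF w sz])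
    have right: "\<forall>\<^sub>F r in at_right ?s. X ?s w / 2 < X r w"
      using pos by (intro order_tendstoD(1)[OF X_right[OF w sz]]) simp
    obtain c where c: "0 < c" "\<forall>\<^sub>F r in at_left ?s. c \<le> X r w"
    proof (cases "0 < ?s")
      case True
      then obtain l where l: "0 < l" "((\<lambda>s. X s w) \<longlongrightarrow> l) (at_left ?s)" using X_left[OF w sz] by blast
      have "\<forall>\<^sub>F r in at_left ?s. l / 2 < X r w"
        using l by (intro order_tendstoD(1)[OF l(2)]) simp
      then show ?thesis using l by (intro that[of "l / 2"]) (auto elim: eventually_mono)
    next
      case False
      then have "?s = 0" by (metis not_gr_zero)
      \<comment> \<open>No time precedes 0, so any positive constant serves.\<close>
      then show ?thesis by (intro that[of 1]) (auto simp: eventually_at_filter)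
    qed
    define d where "d = min c (X ?s w / 2)"
    have "\<forall>\<^sub>F r in at ?s. d \<le> X r w"
      unfolding eventually_at_split using right c
      by (auto simp: d_def elim!: eventually_mono intro: min.coboundedI2 min.coboundedI1 less_imp_le)
    moreover have "d \<le> X ?s w" using pos by (simp add: d_def)
    ultimately have "\<forall>\<^sub>F r in nhds ?s. d \<le> X r w"
      unfolding eventually_at_filter by (auto elim!: eventually_mono)
    moreover have "filterlim ennreal (nhds ?s) (nhds s)"
      by (intro tendsto_ennrealI filterlim_ident)
    ultimately have "\<forall>\<^sub>F s' in nhds s. d \<le> X (ennreal s') w"
      unfolding filterlim_iff by blast
    moreover have "0 < d" using c pos by (simp add: d_def)
    ultimately show ?thesis by blast
  qed
  then obtain c where c: "\<And>s. s \<in> {0..t} \<Longrightarrow> 0 < c s"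
    "\<And>s. s \<in> {0..t} \<Longrightarrow> \<forall>\<^sub>F s' in nhds s. c s \<le> X (ennreal s') w"
    by metis
  then have "\<forall>s\<in>{0..t}. \<exists>U. open U \<and> s \<in> U \<and> (\<forall>s'\<in>U. c s \<le> X (ennreal s') w)"
    by (auto simp: eventually_nhds)
  then obtain U where U: "\<And>s. s \<in> {0..t} \<Longrightarrow> open (U s)" "\<And>s. s \<in> {0..t} \<Longrightarrow> s \<in> U s"
    "\<And>s s'. s \<in> {0..t} \<Longrightarrow> s' \<in> U s \<Longrightarrow> c s \<le> X (ennreal s') w"
    by metis
  have "{0..t} \<subseteq> (\<Union>s\<in>{0..t}. U s)" using U(2) by blast
  then obtain J where J: "J \<subseteq> {0..t}" "finite J" "{0..t} \<subseteq> (\<Union>s\<in>J. U s)"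
    using compactE_image[of "{0..t}" "{0..t}" U] U(1) by auto
  then have "J \<noteq> {}" using t by auto
  define l where "l = Min (c ` J)"
  have "0 < l" unfolding l_def using J \<open>J \<noteq> {}\<close> c(1) by (subst Min_gr_iff) auto
  moreover have "l \<le> X (ennreal s) w" if s: "0 \<le> s" "s \<le> t" for s
  proof -
    have "s \<in> (\<Union>s\<in>J. U s)" using J(3) s by auto
    then obtain j where j: "j \<in> J" "s \<in> U j" by blast
    have "l \<le> c j" unfolding l_def using J j by (intro Min_le) auto
    also have "\<dots> \<le> X (ennreal s) w" using U(3)[of j s] j J by auto
    finally show ?thesis .
  qed
  ultimately show ?thesis by blast
qed

definition W :: "real \<Rightarrow> real \<Rightarrow> 'a \<Rightarrow> real" where
  "W l q w = (if first_passage_below X \<zeta> l w < \<zeta> w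
                 then exp (- q * enn2real (first_passage_below X \<zeta> l w)) else 0)"

lemma passage_discount_le_W:
  assumes "\<And>r. r \<in> D \<Longrightarrow> 0 \<le> r" "0 \<le> q"
  shows "passage_discount D l q (K w) \<le> ennreal (W l q w)"
proof (rule passage_discount_least)
  fix r assume r: "r \<in> D" "K w (ennreal r) < ereal l"
  then have r': "ennreal r < \<zeta> w" "X (ennreal r) w \<le> l" "0 \<le> r" by (auto simp: K_less_iff assms)
  have le: "first_passage_below X \<zeta> l w \<le> ennreal r"
    unfolding first_passage_below_def using r' by (intro Inf_lower) auto
  then have "enn2real (first_passage_below X \<zeta> l w) \<le> r"
    using r' enn2real_mono[OF le] by simp
  then have "q * enn2real (first_passage_below X \<zeta> l w) \<le> q * r" using assms by (intro mult_left_mono)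
  then show "ennreal (exp (- q * r)) \<le> ennreal (W l q w)"
    using le_less_trans[OF le r'(1)] by (auto simp: W_def intro!: ennreal_leI)
qed

text \<open>By right continuity, a time with X <= l' < l is followed by an interval of times with X
  < l, which contains a grid time. Letting e tend to 0 reaches the passage time itself.\<close>

lemma W_le_passage_discount:
  assumes w: "w \<in> \<Omega>" and l: "l' < l" and q: "0 \<le> q"
  shows "ennreal (W l' q w) \<le> passage_discount (grid t) l q (K w)"
proof (cases "first_passage_below X \<zeta> l' w < \<zeta> w")
  case True
  define T where "T = enn2real (first_passage_below X \<zeta> l' w)"
  have "first_passage_below X \<zeta> l' w < top" using True by (rule less_le_trans) simp
  then have T: "first_passage_below X \<zeta> l' w = ennreal T" "0 \<le> T" by (auto simp: T_def)
  have le: "ennreal (exp (- q * (T + e))) \<le> passage_discount (grid t) l q (K w)" if e: "0 < e" for e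
  proof -
    have "Inf {s. s < \<zeta> w \<and> X s w \<le> l'} < ennreal (T + e)"
      using T e unfolding first_passage_below_def by (simp add: ennreal_less_iff)
    then obtain s where s: "s < \<zeta> w" "X s w \<le> l'" "s < ennreal (T + e)"
      by (auto simp: Inf_less_iff)
    have "\<forall>\<^sub>F r in at_right s. X r w < l"
      using s l by (intro order_tendstoD(2)[OF X_right[OF w s(1)]]) simp
    then obtain b where b: "s < b" "\<And>r. s < r \<Longrightarrow> r < b \<Longrightarrow> X r w < l"
      using s(1) by (auto simp: eventually_at_right)
    \<comment> \<open>Keeps the grid time in the neighbourhood, before the lifetime and before T + e
      at once.\<close>
    define b' where "b' = min b (min (\<zeta> w) (ennreal (T + e)))"
    have "s < b'" using b s by (simp add: b'_def)
    then obtain u where u: "s < u" "u < b'" using dense by blast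
    have "s < top" "u < top" using u(1) u(2) by (auto intro: less_le_trans)
    then obtain s0 u0 where s0: "s = ennreal s0" "0 \<le> s0" and u0: "u = ennreal u0" "0 \<le> u0"
      by (metis enn2real_nonneg ennreal_enn2real)
    have "s0 < u0" using u(1) s0 u0 by (simp add: ennreal_less_iff)
    then obtain r where r: "r \<in> grid t" "s0 < r" "r < u0" using grid_dense[OF s0(2)] by blast
    have sr: "s < ennreal r" using r s0 by (simp add: ennreal_less_iff)
    have "ennreal r < u" using r s0 u0 by (simp add: ennreal_less_iff)
    then have rb: "ennreal r < b'" using u(2) by (rule less_trans)
    have "K w (ennreal r) < ereal l"
      unfolding K_less_iff using sr rb b by (auto simp: b'_def)
    then have "ennreal (exp (- q * r)) \<le> passage_discount (grid t) l q (K w)"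
      using r(1) by (rule passage_discount_upper[rotated])
    moreover have "ennreal r < ennreal (T + e)" using rb by (simp add: b'_def del: ennreal_plus)
    then have "r \<le> T + e" using s0 r by (subst (asm) ennreal_less_iff) auto
    then have "exp (- q * (T + e)) \<le> exp (- q * r)" using q by (simp add: mult_left_mono)
    ultimately show ?thesis using ennreal_leI order_trans by blast
  qed
  have "(\<lambda>n. ennreal (exp (- q * (T + 1 / real (Suc n))))) \<longlonglongrightarrow> ennreal (exp (- q * (T + 0)))"
    by (intro tendsto_ennrealI tendsto_intros LIMSEQ_Suc lim_1_over_n)
  then have "ennreal (exp (- q * (T + 0))) \<le> passage_discount (grid t) l q (K w)"
    by (rule LIMSEQ_le_const2) (intro exI[of _ 0] allI impI le, simp)
  then show ?thesis using True by (simp add: W_def T_def)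
qed (simp add: W_def)

definition \<phi> :: "real \<Rightarrow> real \<Rightarrow> real" where
  "\<phi> q x = enn2real (\<Phi> q x)"

lemma \<Phi>_eq_\<phi>: "0 < q \<Longrightarrow> 0 < x \<Longrightarrow> \<Phi> q x = ennreal (\<phi> q x)"
  using \<Phi>_finite[of q x] by (simp add: \<phi>_def)

lemma \<phi>_pos: "0 < q \<Longrightarrow> 0 < x \<Longrightarrow> 0 < \<phi> q x"
  using \<Phi>_finite[of q x] \<Phi>_pos[of q x] by (simp add: \<phi>_def enn2real_positive_iff)

lemma nn_integral_W:
  assumes "0 < l" "l \<le> x" "Q < q"
  shows "(\<integral>\<^sup>+w. ennreal (W l q w) \<partial>P x) = ennreal (\<phi> q x / \<phi> q l)"
proof -
  have eq: "(\<integral>w. W l q w \<partial>P x) = \<phi> q x / \<phi> q l"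
    using laplace[OF assms] by (simp only: W_def[abs_def] set_lborel_\<Phi> \<phi>_def)
  have "0 < \<phi> q x / \<phi> q l" using assms Q by (intro divide_pos_pos \<phi>_pos) auto
  \<comment> \<open>The Bochner integral of a non-integrable function is 0 by convention, so the
    positive value forces integrability, and with it measurability, of \<open>W l q\<close>.\<close>
  then have "integrable (P x) (W l q)"
    using not_integrable_integral_eq[of "P x" "W l q"] eq by fastforce
  then show ?thesis
    unfolding eq[symmetric] by (rule nn_integral_eq_integral) (simp add: W_def)
qed

text \<open>Strict passage below l lies between passage at or below l and passage at or below any
  smaller level; left continuity of \<open>\<Phi> q\<close> in the level closes the gap.\<close>

lemma nn_integral_passage_discount:
  assumes "0 < l" "l \<le> x" "Q < q"
  shows "(\<integral>\<^sup>+w. passage_discount (grid t) l q (K w) \<partial>P x) = ennreal (\<phi> q x / \<phi> q l)"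
proof (rule antisym)
  have q: "0 < q" using assms Q by simp
  show "(\<integral>\<^sup>+w. passage_discount (grid t) l q (K w) \<partial>P x) \<le> ennreal (\<phi> q x / \<phi> q l)"
    unfolding nn_integral_W[OF assms, symmetric] using q
    by (intro nn_integral_mono passage_discount_le_W) (auto intro: grid_nonneg)
  let ?l = "\<lambda>n. l * (1 - 1 / real (n + 2))"
  have l: "0 < ?l n" "?l n < l" for n
  proof -
    have "1 / real (n + 2) < 1" "0 < 1 / real (n + 2)" by auto
    then have "0 < 1 - 1 / real (n + 2)" "1 - 1 / real (n + 2) < 1" by linarith+
    then show "0 < ?l n" "?l n < l" using assms mult_strict_left_mono[of "1 - 1 / real (n + 2)" 1 l] by simp_all
  qed
  have "(\<lambda>n. \<phi> q (?l n)) \<longlonglongrightarrow> \<phi> q l"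
    unfolding \<phi>_def using \<Phi>_left_continuous[OF q assms(1)] \<Phi>_finite[OF q assms(1)]
    by (intro tendsto_enn2real) auto
  then have "(\<lambda>n. ennreal (\<phi> q x / \<phi> q (?l n))) \<longlonglongrightarrow> ennreal (\<phi> q x / \<phi> q l)"
    using \<phi>_pos[OF q assms(1)] by (intro tendsto_ennrealI tendsto_intros) auto
  then show "ennreal (\<phi> q x / \<phi> q l) \<le> (\<integral>\<^sup>+w. passage_discount (grid t) l q (K w) \<partial>P x)"
  proof (rule LIMSEQ_le_const2, intro exI allI impI)
    fix n
    have "ennreal (\<phi> q x / \<phi> q (?l n)) = (\<integral>\<^sup>+w. ennreal (W (?l n) q w) \<partial>P x)"
      using l[of n] assms by (intro nn_integral_W[symmetric]) (linarith+)
    also have "\<dots> \<le> (\<integral>\<^sup>+w. passage_discount (grid t) l q (K w) \<partial>P x)"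
      using l[of n] q assms space_P[of x] by (intro nn_integral_mono W_le_passage_discount) auto
    finally show "ennreal (\<phi> q x / \<phi> q (?l n)) \<le> (\<integral>\<^sup>+w. passage_discount (grid t) l q (K w) \<partial>P x)" .
  qed
qed

end

section \<open>The eigenfunction equation for \<open>\<Phi> q\<close>\<close>

context branching_setting
begin

lemma measurable_\<Phi> [measurable]: "\<Phi> q \<in> borel_measurable borel"
proof -
  interpret sigma_finite_measure \<nu> by (rule sigma_finite_\<nu>)
  show ?thesis unfolding \<Phi>_def[abs_def] by measurable
qed

text \<open>Survival to t without a grid passage below l up to and including t. Testing countably
  many times makes this an event of \<open>F (ennreal t)\<close>, so that the Markov property at t
  can be used on it.\<close>

definition above :: "real \<Rightarrow> real \<Rightarrow> 'a set" where
  "above t l = {w \<in> \<Omega>. (K w (ennreal t) \<noteq> \<infinity> \<and> ereal l \<le> K w (ennreal t)) \<and>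
     (\<forall>r\<in>grid t \<inter> {..<t}. ereal l \<le> K w (ennreal r))}"

lemma sets_above: "above t l \<in> sets (F (ennreal t))"
proof -
  have K_F: "{w \<in> \<Omega>. Q (K w (ennreal r))} \<in> sets (F (ennreal t))"
    if r: "r \<le> t" and Q: "{y. Q y} \<in> sets borel" for r and Q :: "ereal \<Rightarrow> bool"
  proof -
    have "{w \<in> space (F (ennreal r)). K w (ennreal r) \<in> {y. Q y}} \<in> sets (F (ennreal r))"
      using Q measurable_sets[OF adapted[of "ennreal r"], of "{y. Q y}"]
      by (simp add: vimage_def Int_def conj_commute)
    then show ?thesis
      using sets_F_mono[OF ennreal_leI[OF r]] by (auto simp: space_F)
  qed
  have "above t l = {w \<in> \<Omega>. K w (ennreal t) \<noteq> \<infinity> \<and> ereal l \<le> K w (ennreal t)}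
      \<inter> (space (F (ennreal t)) - (\<Union>r\<in>grid t \<inter> {..<t}. {w \<in> \<Omega>. \<not> ereal l \<le> K w (ennreal r)}))"
    by (auto simp: above_def space_F)
  also have "\<dots> \<in> sets (F (ennreal t))"
  proof (intro sets.Int sets.Diff sets.top sets.countable_UN')
    show "countable (grid t \<inter> {..<t})" using countable_grid by blast
    show "{w \<in> \<Omega>. K w (ennreal t) \<noteq> \<infinity> \<and> ereal l \<le> K w (ennreal t)} \<in> sets (F (ennreal t))"
      by (rule K_F[of t "\<lambda>y. y \<noteq> \<infinity> \<and> ereal l \<le> y"]) auto
    show "(\<lambda>r. {w \<in> \<Omega>. \<not> ereal l \<le> K w (ennreal r)}) ` (grid t \<inter> {..<t}) \<subseteq> sets (F (ennreal t))"
      using K_F[of _ "\<lambda>y. \<not> ereal l \<le> y"] by auto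
  qed
  finally show ?thesis .
qed

lemma above_iff:
  "w \<in> above t l \<longleftrightarrow> w \<in> \<Omega> \<and> ennreal t < \<zeta> w \<and> l \<le> X (ennreal t) w \<and>
     (\<forall>r\<in>grid t. r < t \<longrightarrow> ereal l \<le> K w (ennreal r))"
  unfolding above_def K_infinity_iff by (auto simp: K_eq not_le)

text \<open>On this event no grid passage precedes t, so translation by t matches the grid passages
  of the path with those of the shifted path. Each inequality uses one of the two closure properties
  of the grid.\<close>

lemma passage_discount_shift:
  assumes w: "w \<in> above t l" and t: "0 \<le> t"
  shows "passage_discount (grid t) l q (K w)
    = ennreal (exp (- q * t)) * passage_discount (grid t) l q (\<lambda>r. K w (ennreal t + r))"
    (is "?L = _ * ?R")
proof (rule antisym)
  show "?L \<le> ennreal (exp (- q * t)) * ?R"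
  proof (rule passage_discount_least)
    fix r assume r: "r \<in> grid t" "K w (ennreal r) < ereal l"
    then have "t \<le> r" using w by (force simp: above_iff not_le)
    then have "K w (ennreal t + ennreal (r - t)) < ereal l" using r t by (simp flip: ennreal_plus)
    with grid_unshift[OF \<open>t \<le> r\<close> r(1)] have "ennreal (exp (- q * (r - t))) \<le> ?R"
      by (rule passage_discount_upper)
    then have "ennreal (exp (- q * t)) * ennreal (exp (- q * (r - t))) \<le> ennreal (exp (- q * t)) * ?R"
      by (rule mult_left_mono) simp
    also have "ennreal (exp (- q * t)) * ennreal (exp (- q * (r - t))) = ennreal (exp (- q * r))"
      by (simp add: ennreal_mult[symmetric] exp_add[symmetric] algebra_simps)
    finally show "ennreal (exp (- q * r)) \<le> ennreal (exp (- q * t)) * ?R" .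
  qed
  have "?R \<le> ennreal (exp (q * t)) * ?L"
  proof (rule passage_discount_least)
    fix r assume r: "r \<in> grid t" "K w (ennreal t + ennreal r) < ereal l"
    then have "K w (ennreal (t + r)) < ereal l" using t grid_nonneg[OF r(1)] by simp
    with grid_shift[OF t r(1)] have "ennreal (exp (- q * (t + r))) \<le> ?L"
      by (rule passage_discount_upper)
    then have "ennreal (exp (q * t)) * ennreal (exp (- q * (t + r))) \<le> ennreal (exp (q * t)) * ?L"
      by (rule mult_left_mono) simp
    also have "ennreal (exp (q * t)) * ennreal (exp (- q * (t + r))) = ennreal (exp (- q * r))"
      by (simp add: ennreal_mult[symmetric] exp_add[symmetric] algebra_simps)
    finally show "ennreal (exp (- q * r)) \<le> ennreal (exp (q * t)) * ?L" .
  qed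
  then have "ennreal (exp (- q * t)) * ?R \<le> ennreal (exp (- q * t)) * (ennreal (exp (q * t)) * ?L)"
    by (rule mult_left_mono) simp
  also have "\<dots> = ?L"
    by (simp add: mult.assoc[symmetric] ennreal_mult[symmetric] exp_add[symmetric])
  finally show "ennreal (exp (- q * t)) * ?R \<le> ?L" .
qed

text \<open>Off the event, any grid passage is accompanied by one no later than t: a passage after t
  entails survival to t, so the event can only have failed through a passage up to t. At such a time
  s one has exp (-q s) <= exp ((q' - q) t) exp (-q' s).\<close>

lemma passage_discount_off_above:
  assumes w: "w \<in> \<Omega>" "w \<notin> above t l" and t: "0 \<le> t" and q: "0 < q" "q < q'"
  shows "passage_discount (grid t) l q (K w)
    \<le> ennreal (exp ((q' - q) * t)) * passage_discount (grid t) l q' (K w)"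
proof (rule passage_discount_least)
  fix r assume r: "r \<in> grid t" "K w (ennreal r) < ereal l"
  obtain s where s: "s \<in> grid t" "K w (ennreal s) < ereal l" "s \<le> t" "s \<le> r"
  proof (cases "r \<le> t")
    case True
    then show ?thesis using r by (intro that[of r]) auto
  next
    case False
    have "ennreal r < \<zeta> w" using r by (simp add: K_less_iff)
    then have tz: "ennreal t < \<zeta> w" using False by (intro le_less_trans[OF ennreal_leI[of t r]]) auto
    show ?thesis
    proof (cases "X (ennreal t) w < l")
      case True
      then show ?thesis using False tz t by (intro that[of t]) (auto simp: K_less_iff grid_self)
    next
      case nl: False
      then obtain s where "s \<in> grid t" "s < t" "K w (ennreal s) < ereal l"
        using w tz unfolding above_iff by (auto simp: not_less not_le)
      then show ?thesis using False by (intro that[of s]) auto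
    qed
  qed
  have "q * s \<le> q * r" using s q by (intro mult_left_mono) auto
  moreover have "(q' - q) * s \<le> (q' - q) * t" using s q by (intro mult_left_mono) auto
  ultimately have "- q * r \<le> (q' - q) * t + - q' * s" by (simp add: algebra_simps)
  then have "ennreal (exp (- q * r)) \<le> ennreal (exp ((q' - q) * t)) * ennreal (exp (- q' * s))"
    by (simp add: ennreal_mult[symmetric] exp_add[symmetric] ennreal_leI)
  also have "\<dots> \<le> ennreal (exp ((q' - q) * t)) * passage_discount (grid t) l q' (K w)"
    by (intro mult_left_mono passage_discount_upper s) simp
  finally show "ennreal (exp (- q * r)) \<le> \<dots>" .
qed

lemma above_mono:
  assumes "l' \<le> l"
  shows "above t l \<subseteq> above t l'"
proof
  fix w assume w: "w \<in> above t l"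
  have "ereal l' \<le> K w (ennreal r)" if "r \<in> grid t" "r < t" for r
    using w that assms order_trans[of "ereal l'" "ereal l"] by (simp add: above_iff)
  then show "w \<in> above t l'" using w assms by (auto simp: above_iff)
qed

lemma above_exhausts:
  assumes "w \<in> \<Omega>" "ennreal t < \<zeta> w" "0 \<le> t"
  shows "\<exists>l>0. w \<in> above t l"
proof -
  obtain l where l: "0 < l" "\<And>s. 0 \<le> s \<Longrightarrow> s \<le> t \<Longrightarrow> l \<le> X (ennreal s) w"
    using positive_infimum[OF assms] by blast
  have "w \<in> above t l"
    unfolding above_iff
  proof (intro conjI ballI impI assms l)
    fix r assume r: "r \<in> grid t" "r < t"
    then have "ennreal r < \<zeta> w" using assms by (intro le_less_trans[OF ennreal_leI[of r t]]) auto
    then show "ereal l \<le> K w (ennreal r)" using l(2)[of r] r grid_nonneg[OF r(1)] by (simp add: K_eq)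
  qed (use assms in auto)
  then show ?thesis using l by blast
qed

lemma measurable_above_\<Phi>:
  assumes x: "0 < x"
  shows "(\<lambda>w. indicator (above t l) w * \<Phi> q (X (ennreal t) w)) \<in> borel_measurable (P x)"
proof -
  have [measurable]: "above t l \<in> sets (P x)" by (rule F_sets_P[OF x sets_above])
  have "(\<lambda>w. indicator (above t l) w * \<Phi> q (real_of_ereal (K w (ennreal t)))) \<in> borel_measurable (P x)"
    using K_measurable[OF x, of "ennreal t"] by measurable
  also have "(\<lambda>w. indicator (above t l) w * \<Phi> q (real_of_ereal (K w (ennreal t))))
      = (\<lambda>w. indicator (above t l) w * \<Phi> q (X (ennreal t) w))"
    by (auto simp: fun_eq_iff indicator_def above_iff K_eq)
  finally show ?thesis .
qed

text \<open>The discounted passage below l is split over \<open>above t l\<close>, where the Markov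
  property produces \<open>\<Phi> q\<close> at X_t divided by \<open>\<Phi> q l\<close>, and the
  complement, where the exponent q' bounds the rest by a multiple of 1 / \<open>\<Phi> q' l\<close>.
  Multiplying by \<open>\<Phi> q l\<close> isolates the ratio that vanishes with l.\<close>

lemma passage_decomposition:
  assumes x: "0 < x" and l: "0 < l" "l \<le> x" and q: "Q < q" "q < q'" and t: "0 \<le> t"
  defines "B \<equiv> (\<integral>\<^sup>+w. indicator (above t l) w * \<Phi> q (X (ennreal t) w) \<partial>P x)"
  shows "ennreal (exp (- q * t)) * B \<le> \<Phi> q x"
    and "\<Phi> q x \<le> ennreal (exp (- q * t)) * B + ennreal (exp ((q' - q) * t) * \<phi> q' x * (\<phi> q l / \<phi> q' l))"
proof -
  interpret prob_space "P x" by (rule prob_P[OF x])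
  let ?V = "\<lambda>q w. passage_discount (grid t) l q (K w)"
  let ?A = "above t l"
  have q0: "0 < q" "0 < q'" using q Q by auto
  have \<phi>0: "0 < \<phi> q l" "0 < \<phi> q x" "0 < \<phi> q' l" "0 < \<phi> q' x" using \<phi>_pos q0 l x by auto
  have [measurable]: "?A \<in> sets (P x)" by (rule F_sets_P[OF x sets_above])
  have [measurable]: "?V q \<in> borel_measurable (P x)" for q
    using measurable_compose[OF K_path_measurable[OF x] measurable_passage_discount[OF countable_grid]] by simp
  have "(\<integral>\<^sup>+w. indicator ?A w * ?V q w \<partial>P x)
     = (\<integral>\<^sup>+w. ennreal (exp (- q * t)) * (indicator ?A w * passage_discount (grid t) l q (\<lambda>r. K w (ennreal t + r))) \<partial>P x)"
    by (intro nn_integral_cong) (auto simp: indicator_def passage_discount_shift t)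
  also have "\<dots> = ennreal (exp (- q * t)) * (\<integral>\<^sup>+w. indicator ?A w * passage_discount (grid t) l q (\<lambda>r. K w (ennreal t + r)) \<partial>P x)"
    using measurable_compose[OF K_shift_measurable[OF x] measurable_passage_discount[OF countable_grid]]
    by (intro nn_integral_cmult) auto
  also have "(\<integral>\<^sup>+w. indicator ?A w * passage_discount (grid t) l q (\<lambda>r. K w (ennreal t + r)) \<partial>P x)
      = (\<integral>\<^sup>+w. indicator ?A w * (\<integral>\<^sup>+w'. ?V q w' \<partial>P (X (ennreal t) w)) \<partial>P x)"
    by (rule markov_property[OF x sets_above _ measurable_passage_discount[OF countable_grid]]) (simp add: above_iff)
  also have "\<dots> = (\<integral>\<^sup>+w. (indicator ?A w * \<Phi> q (X (ennreal t) w)) * ennreal (1 / \<phi> q l) \<partial>P x)"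
  proof (intro nn_integral_cong)
    fix w
    show "indicator ?A w * (\<integral>\<^sup>+w'. ?V q w' \<partial>P (X (ennreal t) w))
        = (indicator ?A w * \<Phi> q (X (ennreal t) w)) * ennreal (1 / \<phi> q l)"
    proof (cases "w \<in> ?A")
      case True
      then have Xl: "l \<le> X (ennreal t) w" by (simp add: above_iff)
      have "(\<integral>\<^sup>+w'. ?V q w' \<partial>P (X (ennreal t) w)) = ennreal (\<phi> q (X (ennreal t) w) / \<phi> q l)"
        by (rule nn_integral_passage_discount[OF l(1) Xl q(1)])
      moreover have "\<Phi> q (X (ennreal t) w) = ennreal (\<phi> q (X (ennreal t) w))"
        using Xl l q0 by (intro \<Phi>_eq_\<phi>) auto
      moreover have "0 \<le> \<phi> q (X (ennreal t) w)" by (simp add: \<phi>_def)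
      ultimately show ?thesis using True \<phi>0 by (simp add: ennreal_mult[symmetric])
    qed simp
  qed
  also have "\<dots> = B * ennreal (1 / \<phi> q l)"
    unfolding B_def by (rule nn_integral_multc[OF measurable_above_\<Phi>[OF x]])
  finally have on: "(\<integral>\<^sup>+w. indicator ?A w * ?V q w \<partial>P x) = ennreal (exp (- q * t)) * (B * ennreal (1 / \<phi> q l))" .
  define E where "E = (\<integral>\<^sup>+w. indicator (\<Omega> - ?A) w * ?V q w \<partial>P x)"
  have "E \<le> (\<integral>\<^sup>+w. ennreal (exp ((q' - q) * t)) * ?V q' w \<partial>P x)"
    unfolding E_def using q q0 t passage_discount_off_above
    by (intro nn_integral_mono) (auto simp: indicator_def)
  also have "\<dots> = ennreal (exp ((q' - q) * t)) * ennreal (\<phi> q' x / \<phi> q' l)"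
    using q l by (subst nn_integral_cmult) (auto simp: nn_integral_passage_discount)
  also have "\<dots> = ennreal (exp ((q' - q) * t) * (\<phi> q' x / \<phi> q' l))"
    using \<phi>0 by (intro ennreal_mult[symmetric]) auto
  finally have E: "E \<le> ennreal (exp ((q' - q) * t) * (\<phi> q' x / \<phi> q' l))" .
  have [measurable]: "\<Omega> - ?A \<in> sets (P x)" using space_P[OF x] sets.compl_sets[of ?A "P x"] by simp
  have split: "ennreal (\<phi> q x / \<phi> q l) = ennreal (exp (- q * t)) * (B * ennreal (1 / \<phi> q l)) + E"
  proof -
    have "ennreal (\<phi> q x / \<phi> q l) = (\<integral>\<^sup>+w. ?V q w \<partial>P x)"
      by (rule nn_integral_passage_discount[OF l q(1), symmetric])
    also have "\<dots> = (\<integral>\<^sup>+w. indicator ?A w * ?V q w + indicator (\<Omega> - ?A) w * ?V q w \<partial>P x)"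
      using space_P[OF x] by (intro nn_integral_cong) (auto simp: indicator_def)
    also have "\<dots> = (\<integral>\<^sup>+w. indicator ?A w * ?V q w \<partial>P x) + E"
      unfolding E_def by (rule nn_integral_add) auto
    finally show ?thesis by (simp only: on)
  qed
  have \<Phi>: "\<Phi> q x = ennreal (exp (- q * t)) * B + ennreal (\<phi> q l) * E"
  proof -
    have "\<Phi> q x = ennreal (\<phi> q l) * ennreal (\<phi> q x / \<phi> q l)"
      using \<phi>0 q0 x by (simp add: \<Phi>_eq_\<phi> ennreal_mult[symmetric])
    also have "\<dots> = ennreal (exp (- q * t)) * B * (ennreal (\<phi> q l) * ennreal (1 / \<phi> q l)) + ennreal (\<phi> q l) * E"
      unfolding split by (simp add: distrib_left mult_ac)
    also have "ennreal (\<phi> q l) * ennreal (1 / \<phi> q l) = 1"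
      using \<phi>0 by (simp add: ennreal_mult[symmetric])
    finally show ?thesis by simp
  qed
  show "ennreal (exp (- q * t)) * B \<le> \<Phi> q x" by (simp add: \<Phi>)
  have "ennreal (\<phi> q l) * E \<le> ennreal (\<phi> q l) * ennreal (exp ((q' - q) * t) * (\<phi> q' x / \<phi> q' l))"
    by (intro mult_left_mono E) simp
  also have "\<dots> = ennreal (exp ((q' - q) * t) * \<phi> q' x * (\<phi> q l / \<phi> q' l))"
    using \<phi>0 by (subst ennreal_mult[symmetric]) (auto simp: mult_ac)
  finally show "\<Phi> q x \<le> ennreal (exp (- q * t)) * B + ennreal (exp ((q' - q) * t) * \<phi> q' x * (\<phi> q l / \<phi> q' l))"
    unfolding \<Phi> by (rule add_left_mono)
qed

text \<open>Let l tend to 0 in the decomposition: a path alive at t stays away from 0 on [0, t], so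
  the events \<open>above t l\<close> increase to survival, and the error vanishes by
  \<open>\<Phi>_ratio\<close>. The choice q + 1 is an arbitrary larger exponent.\<close>

lemma \<Phi>_eigenfunction:
  assumes x: "0 < x" and q: "Q < q" and t: "0 \<le> t"
  shows "(\<integral>\<^sup>+w. (if ennreal t < \<zeta> w then \<Phi> q (X (ennreal t) w) else 0) \<partial>P x) = ennreal (exp (q * t)) * \<Phi> q x"
proof -
  define q' where "q' = q + 1"
  have q': "q < q'" "0 < q" "0 < q'" using q Q by (auto simp: q'_def)
  let ?f = "\<lambda>w. if ennreal t < \<zeta> w then \<Phi> q (X (ennreal t) w) else 0"
  let ?B = "\<integral>\<^sup>+w. ?f w \<partial>P x"
  let ?g = "\<lambda>l w. indicator (above t l) w * \<Phi> q (X (ennreal t) w)"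
  have g_le: "?g l w \<le> ?f w" for l w by (auto simp: indicator_def above_iff)
  let ?l = "\<lambda>n. x / real (Suc n)"
  have l: "0 < ?l n" "?l n \<le> x" for n using x by (auto simp: field_simps)
  have l_dec: "?l n \<le> ?l m" if "m \<le> n" for m n using x that by (intro divide_left_mono) auto
  have "(SUP n. ?g (?l n) w) = ?f w" if w: "w \<in> space (P x)" for w
  proof (rule antisym)
    show "(SUP n. ?g (?l n) w) \<le> ?f w" by (intro SUP_least g_le)
    show "?f w \<le> (SUP n. ?g (?l n) w)"
    proof (cases "ennreal t < \<zeta> w")
      case True
      then obtain l where l: "0 < l" "w \<in> above t l" using above_exhausts[of w t] w space_P[OF x] t by auto
      obtain n :: nat where "x / l < real n" using reals_Archimedean2 by blast
      then have "?l n \<le> l" using l x by (simp add: field_simps) 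
      then have "w \<in> above t (?l n)" using above_mono l by blast
      then show ?thesis using True by (intro SUP_upper2[of n]) auto
    qed simp
  qed
  then have "?B = (\<integral>\<^sup>+w. (SUP n. ?g (?l n) w) \<partial>P x)"
    by (intro nn_integral_cong) simp
  also have "\<dots> = (SUP n. \<integral>\<^sup>+w. ?g (?l n) w \<partial>P x)"
  proof (rule nn_integral_monotone_convergence_SUP[OF _ measurable_above_\<Phi>[OF x]])
    have "indicator (above t (?l m)) w \<le> (indicator (above t (?l n)) w :: ennreal)" if "m \<le> n" for m n w
      using above_mono[OF l_dec[OF that], of t] by (auto simp: indicator_def)
    then show "incseq (\<lambda>n. ?g (?l n))"
      unfolding incseq_def le_fun_def by (auto intro!: mult_right_mono)
  qed
  finally have B: "?B = (SUP n. \<integral>\<^sup>+w. ?g (?l n) w \<partial>P x)" .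
  have upper: "ennreal (exp (- q * t)) * ?B \<le> \<Phi> q x"
    unfolding B SUP_mult_left_ennreal using l q q' t x
    by (intro SUP_least passage_decomposition(1)[where q'=q']) auto
  have lower: "\<Phi> q x \<le> ennreal (exp (- q * t)) * ?B"
  proof (rule ennreal_le_epsilon)
    fix e :: real assume e: "0 < e"
    \<comment> \<open>The factors of the error term that do not depend on l.\<close>
    define C where "C = exp ((q' - q) * t) * \<phi> q' x"
    have C: "0 < C" using \<phi>_pos q' x by (simp add: C_def)
    obtain \<delta> where \<delta>: "0 < \<delta>" "\<And>l. 0 < l \<Longrightarrow> l < \<delta> \<Longrightarrow> \<Phi> q l \<le> ennreal (e / C) * \<Phi> q' l"
      using \<Phi>_ratio[of q q' "e / C"] q' e C by auto
    define l where "l = min x (\<delta> / 2)"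
    have l: "0 < l" "l < \<delta>" "l \<le> x" using \<delta> x by (auto simp: l_def)
    have "ennreal (\<phi> q l) \<le> ennreal (e / C) * ennreal (\<phi> q' l)"
      using \<delta>(2)[OF l(1,2)] q' l by (simp only: \<Phi>_eq_\<phi>)
    also have "\<dots> = ennreal (e / C * \<phi> q' l)"
      using e C \<phi>_pos[of q' l] q' l by (intro ennreal_mult[symmetric]) auto
    finally have "ennreal (\<phi> q l) \<le> ennreal (e / C * \<phi> q' l)" .
    then have "\<phi> q l \<le> e / C * \<phi> q' l"
      using \<phi>_pos[of q' l] q' l e C by (subst (asm) ennreal_le_iff) auto
    then have "\<phi> q l / \<phi> q' l \<le> e / C" using \<phi>_pos[of q' l] q' l by (simp add: pos_divide_le_eq)
    then have "C * (\<phi> q l / \<phi> q' l) \<le> C * (e / C)" using C by (intro mult_left_mono) auto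
    then have eC: "C * (\<phi> q l / \<phi> q' l) \<le> e" using C by simp
    have "\<Phi> q x \<le> ennreal (exp (- q * t)) * (\<integral>\<^sup>+w. ?g l w \<partial>P x) + ennreal (C * (\<phi> q l / \<phi> q' l))"
      unfolding C_def using l q q' t x by (intro passage_decomposition(2)) auto
    also have "\<dots> \<le> ennreal (exp (- q * t)) * ?B + ennreal e"
      using eC by (intro add_mono mult_left_mono nn_integral_mono g_le ennreal_leI) auto
    finally show "\<Phi> q x \<le> ennreal (exp (- q * t)) * ?B + ennreal e" .
  qed
  have "ennreal (exp (q * t)) * \<Phi> q x = ennreal (exp (q * t)) * (ennreal (exp (- q * t)) * ?B)"
    using upper lower by (simp add: antisym)
  also have "\<dots> = ?B"
    by (simp add: mult.assoc[symmetric] ennreal_mult[symmetric] exp_add[symmetric])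
  finally show ?thesis by simp
qed

section \<open>Laplace transforms of X at a fixed time\<close>

definition La :: "real \<Rightarrow> real \<Rightarrow> real \<Rightarrow> real" where
  "La x t z = (\<integral> w. (if ennreal t < \<zeta> w then exp (- z * X (ennreal t) w) else 0) \<partial>P x)"

lemma exp_ereal_K: "exp_ereal z (K w t) = ennreal (if t < \<zeta> w then exp (- z * X t w) else 0)"
  by (simp add: exp_ereal_def killed_path_def)

lemma La_integrand_eq: "(if t < \<zeta> w then exp (- z * X t w) else 0) = enn2real (exp_ereal z (K w t))"
  by (simp add: exp_ereal_K)

lemma La_integrable:
  assumes "0 < x" "0 \<le> z"
  shows "integrable (P x) (\<lambda>w. if ennreal t < \<zeta> w then exp (- z * X (ennreal t) w) else 0)"
proof -
  interpret prob_space "P x" by (rule prob_P[OF assms(1)])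
  have "0 \<le> z * X (ennreal t) w" if "w \<in> space (P x)" "ennreal t < \<zeta> w" for w
    using X_pos[of w "ennreal t"] that space_P[OF assms(1)] assms by simp
  moreover have "(\<lambda>w. if ennreal t < \<zeta> w then exp (- z * X (ennreal t) w) else 0) \<in> borel_measurable (P x)"
    unfolding La_integrand_eq using K_measurable[OF assms(1), of "ennreal t"] by measurable
  ultimately show ?thesis
    by (intro integrable_const_bound[where B=1] AE_I2) auto
qed

lemma La_nn_integral:
  assumes "0 < x" "0 \<le> z"
  shows "(\<integral>\<^sup>+w. exp_ereal z (K w (ennreal t)) \<partial>P x) = ennreal (La x t z)"
  unfolding La_def exp_ereal_K by (rule nn_integral_eq_integral[OF La_integrable[OF assms]]) simp

lemma La_nonneg: "0 \<le> La x t z"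
  unfolding La_def by (rule Bochner_Integration.integral_nonneg) simp

lemma La_antimono: "0 < x \<Longrightarrow> 0 \<le> y \<Longrightarrow> y \<le> z \<Longrightarrow> La x t z \<le> La x t y"
  unfolding La_def
proof (rule integral_mono)
  fix w assume "0 < x" "0 \<le> y" "y \<le> z" "w \<in> space (P x)"
  then show "(if ennreal t < \<zeta> w then exp (- z * X (ennreal t) w) else 0)
      \<le> (if ennreal t < \<zeta> w then exp (- y * X (ennreal t) w) else 0)"
    using X_pos[of w "ennreal t"] space_P[of x] by (auto intro!: mult_right_mono)
qed (auto intro: La_integrable)

lemma La_le_1: "0 < x \<Longrightarrow> 0 \<le> z \<Longrightarrow> La x t z \<le> 1"
proof -
  assume x: "0 < x" and z: "0 \<le> z"
  interpret prob_space "P x" by (rule prob_P[OF x])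
  have "La x t z \<le> (\<integral>w. 1 \<partial>P x)"
    unfolding La_def
  proof (rule integral_mono[OF La_integrable[OF x z]])
    fix w assume "w \<in> space (P x)"
    then have "0 \<le> z * X (ennreal t) w" if "ennreal t < \<zeta> w"
      using X_pos[OF _ that] space_P[OF x] z by (intro mult_nonneg_nonneg) (auto intro: less_imp_le)
    then show "(if ennreal t < \<zeta> w then exp (- z * X (ennreal t) w) else 0) \<le> 1" by simp
  qed simp
  then show ?thesis by (simp add: prob_space)
qed

text \<open>From v exp (-y v) <= 1 / y. The bound does not depend on t, which later yields
  continuity in time.\<close>

lemma La_lipschitz:
  assumes x: "0 < x" and y: "0 < y" "y \<le> z"
  shows "\<bar>La x t z - La x t y\<bar> \<le> (z - y) / y"
proof -
  interpret prob_space "P x" by (rule prob_P[OF x])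
  let ?f = "\<lambda>z w. if ennreal t < \<zeta> w then exp (- z * X (ennreal t) w) else 0"
  have z: "0 \<le> z" "0 \<le> y" using y by auto
  have "La x t y - La x t z = (\<integral>w. ?f y w - ?f z w \<partial>P x)"
    unfolding La_def by (subst Bochner_Integration.integral_diff) (auto intro!: La_integrable x z)
  also have "\<dots> \<le> (\<integral>w. (z - y) / y \<partial>P x)"
  proof (rule integral_mono)
    show "integrable (P x) (\<lambda>w. ?f y w - ?f z w)"
      by (intro Bochner_Integration.integrable_diff La_integrable x z)
    fix w assume w: "w \<in> space (P x)"
    show "?f y w - ?f z w \<le> (z - y) / y"
    proof (cases "ennreal t < \<zeta> w")
      case True
      define v where "v = X (ennreal t) w"
      have v: "0 < v" using X_pos[of w "ennreal t"] True w space_P[OF x] by (simp add: v_def)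
      have "exp (- y * v) - exp (- z * v) = exp (- y * v) * (1 - exp (- ((z - y) * v)))"
        by (simp add: right_diff_distrib exp_add[symmetric] algebra_simps)
      also have "\<dots> \<le> exp (- y * v) * ((z - y) * v)"
        using exp_ge_add_one_self[of "- ((z - y) * v)"] by (intro mult_left_mono) auto
      also have "\<dots> = (y * v * exp (- (y * v))) * ((z - y) / y)" using y by simp
      also have "\<dots> \<le> 1 * ((z - y) / y)"
      proof (rule mult_right_mono)
        have "y * v \<le> exp (y * v)" using exp_ge_add_one_self[of "y * v"] by linarith
        then show "y * v * exp (- (y * v)) \<le> 1" by (simp add: exp_minus divide_inverse[symmetric])
      qed (use y in auto)
      finally show ?thesis using True by (simp add: v_def)
    qed (use y in simp)
  qed simp
  also have "\<dots> = (z - y) / y" by (simp add: prob_space)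
  finally show ?thesis using La_antimono[OF x, of y z t] y by simp
qed

lemma continuous_on_La:
  assumes x: "0 < x"
  shows "continuous_on {0<..} (La x t)"
proof (rule continuous_at_imp_continuous_on, rule ballI)
  fix z :: real assume "z \<in> {0<..}"
  then have z: "0 < z" by simp
  have ev: "\<forall>\<^sub>F y in at z. \<bar>La x t y - La x t z\<bar> \<le> \<bar>y - z\<bar> / (z / 2)"
  proof -
    have "\<forall>\<^sub>F y in at z. z / 2 < y" using z by (intro order_tendstoD(1)[OF tendsto_ident_at]) simp
    then show ?thesis
    proof eventually_elim
      case (elim y)
      show ?case
      proof (cases "y \<le> z")
        case True
        then have "\<bar>La x t z - La x t y\<bar> \<le> (z - y) / y" using elim z by (intro La_lipschitz x) auto
        also have "\<dots> \<le> (z - y) / (z / 2)" using elim z True by (intro divide_left_mono) auto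
        finally show ?thesis using True by (simp add: abs_minus_commute)
      next
        case False
        then have "\<bar>La x t y - La x t z\<bar> \<le> (y - z) / z" using z by (intro La_lipschitz x) auto
        also have "\<dots> \<le> (y - z) / (z / 2)" using z False by (intro divide_left_mono) auto
        finally show ?thesis using False by simp
      qed
    qed
  qed
  have "((\<lambda>y. \<bar>y - z\<bar> / (z / 2)) \<longlongrightarrow> \<bar>z - z\<bar> / (z / 2)) (at z)"
    using z by (intro tendsto_intros) auto
  then have "((\<lambda>y. \<bar>y - z\<bar> / (z / 2)) \<longlongrightarrow> 0) (at z)" by simp
  then have "((\<lambda>y. La x t y - La x t z) \<longlongrightarrow> 0) (at z)"
    by (rule Lim_null_comparison[rotated]) (use ev in simp)
  then show "isCont (La x t) z" unfolding isCont_def by (simp add: LIM_zero_iff)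
qed

lemma La_measurable [measurable]:
  assumes x: "0 < x"
  shows "La x t \<in> borel_measurable borel"
proof -
  interpret prob_space "P x" by (rule prob_P[OF x])
  have [measurable]: "(\<lambda>w. K w (ennreal t)) \<in> borel_measurable (P x)" by (rule K_measurable[OF x])
  show ?thesis unfolding La_def[abs_def] La_integrand_eq exp_ereal_def by measurable
qed

text \<open>Integrating the transform against exp (q G) d\<nu> and exchanging the integrals produces
  the eigenfunction equation, so \<open>laplace_from_\<Phi>\<close> applies.\<close>

lemma La_flow:
  assumes x: "0 < x" and t: "0 \<le> t" and z: "z0 < z"
  shows "La x t z = exp (- x * flow t z)"
proof (rule laplace_from_\<Phi>[OF Q x _ La_nonneg La_measurable[OF x] _ z])
  show "continuous_on {z0<..} (La x t)"
    by (rule continuous_on_subset[OF continuous_on_La[OF x]]) (use z0 in auto)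
  fix q assume q: "Q < q"
  interpret prob_space "P x" by (rule prob_P[OF x])
  interpret N: sigma_finite_measure \<nu> by (rule sigma_finite_\<nu>)
  interpret PN: pair_sigma_finite "P x" \<nu> ..
  have [measurable]: "(\<lambda>w. K w (ennreal t)) \<in> borel_measurable (P x)" by (rule K_measurable[OF x])
  let ?f = "\<lambda>w z. exp_ereal z (K w (ennreal t)) * ennreal (exp (q * GI z))"
  have f_meas: "case_prod ?f \<in> borel_measurable (P x \<Otimes>\<^sub>M \<nu>)"
    unfolding exp_ereal_def by measurable
  have "(\<integral>\<^sup>+z. ennreal (La x t z) * ennreal (exp (q * GI z)) \<partial>\<nu>) = (\<integral>\<^sup>+z. \<integral>\<^sup>+w. ?f w z \<partial>P x \<partial>\<nu>)"
  proof (rule nn_integral_cong_AE)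
    show "AE z in \<nu>. ennreal (La x t z) * ennreal (exp (q * GI z)) = (\<integral>\<^sup>+w. ?f w z \<partial>P x)"
      using AE_\<nu>
    proof eventually_elim
      case (elim z)
      then have "0 \<le> z" using z0 by simp
      then show ?case
        by (subst nn_integral_multc) (auto simp: La_nn_integral[OF x])
    qed
  qed
  also have "\<dots> = (\<integral>\<^sup>+w. \<integral>\<^sup>+z. ?f w z \<partial>\<nu> \<partial>P x)"
    by (rule PN.Fubini'[OF f_meas])
  also have "\<dots> = (\<integral>\<^sup>+w. (if ennreal t < \<zeta> w then \<Phi> q (X (ennreal t) w) else 0) \<partial>P x)"
  proof (rule nn_integral_cong)
    fix w
    have "?f w z = (if ennreal t < \<zeta> w then ennreal (exp (- X (ennreal t) w * z + q * GI z)) else 0)" for z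
      unfolding exp_add by (simp add: exp_ereal_K ennreal_mult[symmetric] mult.commute)
    then show "(\<integral>\<^sup>+z. ?f w z \<partial>\<nu>) = (if ennreal t < \<zeta> w then \<Phi> q (X (ennreal t) w) else 0)"
      by (simp add: \<Phi>_def)
  qed
  also have "\<dots> = ennreal (exp (q * t)) * \<Phi> q x" by (rule \<Phi>_eigenfunction[OF x q t])
  finally show "(\<integral>\<^sup>+z. ennreal (La x t z) * ennreal (exp (q * GI z)) \<partial>\<nu>) = ennreal (exp (q * t)) * \<Phi> q x" .
qed

end

section \<open>Branching property and small time limit\<close>

context branching_setting
begin

text \<open>Monotonicity in z reduces this to a point above z0, where \<open>La\<close> is an
  explicit exponential. It makes the logarithm in \<open>u\<close> meaningful down to z = 0.\<close>

lemma La_pos: "0 < x \<Longrightarrow> 0 \<le> t \<Longrightarrow> 0 \<le> z \<Longrightarrow> 0 < La x t z"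
  using La_flow[of x t "max z (z0 + 1)"] La_antimono[of x z "max z (z0 + 1)" t]
  by (simp add: less_max_iff_disj less_le_trans[OF exp_gt_zero])

text \<open>A sub-probability: the density discards the paths killed by time t, so that nothing is
  placed at the default value of \<open>real_of_ereal\<close> at infinity.\<close>

definition law :: "real \<Rightarrow> real \<Rightarrow> real measure" where
  "law x t = distr (density (P x) (\<lambda>w. if K w (ennreal t) = \<infinity> then 0 else 1)) borel
     (\<lambda>w. real_of_ereal (K w (ennreal t)))"

lemma sets_law [measurable_cong]: "sets (law x t) = sets borel"
  by (simp add: law_def)

lemma nn_integral_law:
  assumes x: "0 < x" and [measurable]: "f \<in> borel_measurable borel"
  shows "(\<integral>\<^sup>+y. f y \<partial>law x t) = (\<integral>\<^sup>+w. (if ennreal t < \<zeta> w then f (X (ennreal t) w) else 0) \<partial>P x)"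
proof -
  have [measurable]: "(\<lambda>w. K w (ennreal t)) \<in> borel_measurable (P x)" by (rule K_measurable[OF x])
  have "(\<integral>\<^sup>+y. f y \<partial>law x t) = (\<integral>\<^sup>+w. (if K w (ennreal t) = \<infinity> then 0 else 1) * f (real_of_ereal (K w (ennreal t))) \<partial>P x)"
    unfolding law_def by (subst nn_integral_distr) (auto simp: nn_integral_density)
  also have "\<dots> = (\<integral>\<^sup>+w. (if ennreal t < \<zeta> w then f (X (ennreal t) w) else 0) \<partial>P x)"
    by (intro nn_integral_cong) (auto simp: K_infinity_iff K_eq not_le)
  finally show ?thesis .
qed

lemma nn_integral_law_exp:
  assumes x: "0 < x" and z: "0 \<le> z"
  shows "(\<integral>\<^sup>+y. ennreal (exp (- z * y)) \<partial>law x t) = ennreal (La x t z)"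
  unfolding La_nn_integral[OF assms, symmetric] exp_ereal_K using x
  by (subst nn_integral_law) (auto intro!: nn_integral_cong)

lemma finite_law: "0 < x \<Longrightarrow> finite_measure (law x t)"
  using nn_integral_law_exp[of x 0 t] by (intro finite_measureI) simp

lemma AE_law: "0 < x \<Longrightarrow> AE y in law x t. 0 < y"
proof -
  assume x: "0 < x"
  have "emeasure (law x t) {..0} = (\<integral>\<^sup>+y. indicator {..0} y \<partial>law x t)" by simp
  also have "\<dots> = (\<integral>\<^sup>+w. 0 \<partial>P x)"
    using X_pos[of _ "ennreal t"] space_P[OF x]
    by (subst nn_integral_law[OF x], measurable, intro nn_integral_cong) (force simp: not_le indicator_def)
  finally have "{..0} \<in> null_sets (law x t)" by auto
  then show ?thesis by (rule AE_I') (auto simp: not_less)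
qed

text \<open>Above z0 this is visible from the flow formula. The transforms on (z0, z0 + 1) determine
  the measures, so the law from x + y is a convolution, and the product formula then holds down to z
  = 0.\<close>

lemma La_mult:
  assumes x: "0 < x" and y: "0 < y" and t: "0 \<le> t" and z: "0 \<le> z"
  shows "La (x + y) t z = La x t z * La y t z"
proof -
  have conv: "(\<integral>\<^sup>+s. ennreal (exp (- z * s)) \<partial>(law x t \<star> law y t)) = ennreal (La x t z * La y t z)" if z: "0 \<le> z" for z
  proof -
    have "(\<integral>\<^sup>+s. ennreal (exp (- z * s)) \<partial>(law x t \<star> law y t))
        = (\<integral>\<^sup>+s. \<integral>\<^sup>+s'. ennreal (exp (- z * (s + s'))) \<partial>law y t \<partial>law x t)"
      using x y by (intro nn_integral_convolution finite_law) (auto simp: sets_law)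
    also have "\<dots> = (\<integral>\<^sup>+s. \<integral>\<^sup>+s'. ennreal (exp (- z * s)) * ennreal (exp (- z * s')) \<partial>law y t \<partial>law x t)"
      by (intro nn_integral_cong) (simp add: ennreal_mult[symmetric] exp_add[symmetric] algebra_simps)
    also have "\<dots> = (\<integral>\<^sup>+s. ennreal (exp (- z * s)) * (\<integral>\<^sup>+s'. ennreal (exp (- z * s')) \<partial>law y t) \<partial>law x t)"
      by (intro nn_integral_cong nn_integral_cmult) simp
    also have "\<dots> = (\<integral>\<^sup>+s. ennreal (exp (- z * s)) \<partial>law x t) * (\<integral>\<^sup>+s'. ennreal (exp (- z * s')) \<partial>law y t)"
      by (intro nn_integral_multc) simp
    also have "\<dots> = ennreal (La x t z) * ennreal (La y t z)"
      by (simp only: nn_integral_law_exp[OF x z] nn_integral_law_exp[OF y z])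
    finally show ?thesis by (simp add: ennreal_mult La_nonneg)
  qed
  have "law (x + y) t = (law x t \<star> law y t)"
  proof (rule exp_transform_unique[where a="- (z0 + 1)" and b="- z0"])
    fix r assume r: "- (z0 + 1) < r" "r < - z0"
    have z: "z0 < - r" "0 \<le> - r" using r z0 by auto
    have "La (x + y) t (- r) = La x t (- r) * La y t (- r)"
      using x y t z by (simp add: La_flow exp_add[symmetric] algebra_simps)
    moreover have "(\<integral>\<^sup>+s. ennreal (exp (r * s)) \<partial>law (x + y) t) = ennreal (La (x + y) t (- r))"
      using nn_integral_law_exp[of "x + y" "- r" t] x y z by simp
    moreover have "(\<integral>\<^sup>+s. ennreal (exp (r * s)) \<partial>(law x t \<star> law y t)) = ennreal (La x t (- r) * La y t (- r))"
      using conv[OF z(2)] by simp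
    ultimately show "(\<integral>\<^sup>+s. ennreal (exp (r * s)) \<partial>law (x + y) t) = (\<integral>\<^sup>+s. ennreal (exp (r * s)) \<partial>(law x t \<star> law y t))"
      "(\<integral>\<^sup>+s. ennreal (exp (r * s)) \<partial>law (x + y) t) < \<infinity>"
      by simp_all
  qed (auto simp: sets_law)
  then have "ennreal (La (x + y) t z) = ennreal (La x t z * La y t z)"
    using nn_integral_law_exp[of "x + y" z t] conv[OF z] x y z by simp
  then show ?thesis by (simp add: La_nonneg)
qed

definition u :: "real \<Rightarrow> real \<Rightarrow> real" where
  "u t z = - ln (La 1 t z)"

text \<open>As a function of x, minus the logarithm of the transform is additive and nonnegative,
  hence linear.\<close>

lemma La_u: "0 < x \<Longrightarrow> 0 \<le> t \<Longrightarrow> 0 \<le> z \<Longrightarrow> La x t z = exp (- x * u t z)"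
proof -
  assume x: "0 < x" and t: "0 \<le> t" and z: "0 \<le> z"
  have "- ln (La x t z) = x * - ln (La 1 t z)"
  proof (rule additive_nonneg_imp_linear[of "\<lambda>x. - ln (La x t z)", OF _ _ x])
    fix x y :: real assume xy: "0 < x" "0 < y"
    then show "- ln (La (x + y) t z) = - ln (La x t z) + - ln (La y t z)"
      using La_pos[of x t z] La_pos[of y t z] t z by (simp add: La_mult ln_mult)
  next
    fix x :: real assume "0 < x"
    then show "0 \<le> - ln (La x t z)" using La_le_1[of x z t] La_pos[of x t z] t z by simp
  qed
  then have "ln (La x t z) = - x * u t z" by (simp add: u_def)
  then show ?thesis using exp_ln[OF La_pos[OF x t z]] by simp
qed

lemma u_nonneg: "0 \<le> t \<Longrightarrow> 0 \<le> z \<Longrightarrow> 0 \<le> u t z"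
  using La_le_1[of 1 z t] La_pos[of 1 t z] by (simp add: u_def)

lemma u_mono: "0 \<le> t \<Longrightarrow> 0 \<le> y \<Longrightarrow> y \<le> z \<Longrightarrow> u t y \<le> u t z"
  using La_antimono[of 1 y z t] La_pos[of 1 t z] La_pos[of 1 t y] by (simp add: u_def)

lemma u_flow: "0 \<le> t \<Longrightarrow> z0 < z \<Longrightarrow> u t z = flow t z"
  using La_flow[of 1 t z] by (simp add: u_def)

lemma u_le: "0 \<le> t \<Longrightarrow> 0 \<le> z \<Longrightarrow> u t z \<le> max z (z0 + 1)"
  using u_mono[of t z "max z (z0 + 1)"] u_flow[of t "max z (z0 + 1)"] flow_le[of t "max z (z0 + 1)"]
  by (simp add: less_max_iff_disj)

lemma u_0: "0 \<le> z \<Longrightarrow> u 0 z = z"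
proof -
  assume z: "0 \<le> z"
  interpret prob_space "P 1" by (rule prob_P) simp
  have "La 1 0 z = (\<integral>w. exp (- z) \<partial>P 1)"
    unfolding La_def
  proof (rule integral_cong_AE)
    show "AE w in P 1. (if ennreal 0 < \<zeta> w then exp (- z * X (ennreal 0) w) else 0) = exp (- z)"
      using \<zeta>_pos[of 1] normal[of 1] by (auto elim!: eventually_elim2)
  qed (use La_integrable[of 1 z 0] z in auto)
  then have "La 1 0 z = exp (- z)" by (simp add: prob_space)
  then show ?thesis by (simp add: u_def)
qed

text \<open>X is strictly positive while alive, so the integrand is below 1 everywhere. This keeps
  \<open>u t z\<close> in the open half-line, where the small-time limit will be known.\<close>

lemma u_pos: "0 \<le> t \<Longrightarrow> 0 < z \<Longrightarrow> 0 < u t z"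
proof -
  assume t: "0 \<le> t" and z: "0 < z"
  interpret prob_space "P 1" by (rule prob_P) simp
  define f where "f w = (if ennreal t < \<zeta> w then exp (- z * X (ennreal t) w) else 0)" for w
  have La_f: "La 1 t z = (\<integral>w. f w \<partial>P 1)" by (simp add: La_def f_def)
  have int: "integrable (P 1) f" unfolding f_def[abs_def] using z by (intro La_integrable) auto
  have lt: "f w < 1" if "w \<in> space (P 1)" for w
    using X_pos[of w "ennreal t"] that space_P[of 1] z by (auto simp: f_def)
  have "La 1 t z \<noteq> 1"
  proof
    assume "La 1 t z = 1"
    then have "(\<integral>w. 1 - f w \<partial>P 1) = 0"
      using int by (subst Bochner_Integration.integral_diff) (auto simp: La_f prob_space)
    moreover have "AE w in P 1. 0 \<le> 1 - f w" using lt by (intro AE_I2) (simp add: less_imp_le)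
    moreover have "integrable (P 1) (\<lambda>w. 1 - f w)" using int by simp
    ultimately have "AE w in P 1. 1 - f w = 0"
      using integral_nonneg_eq_0_iff_AE[of "P 1" "\<lambda>w. 1 - f w"] by blast
    then have "AE w in P 1. False"
    proof (rule AE_mp, intro AE_I2 impI)
      fix w assume "w \<in> space (P 1)" "1 - f w = 0"
      then show False using lt[of w] by simp
    qed
    then show False by simp
  qed
  then show ?thesis using La_le_1[of 1 z t] La_pos[of 1 t z] t z by (simp add: u_def)
qed

text \<open>Markov property at time t: the inner expectation started from X_t is again an
  exponential in X_t, with exponent \<open>u s z\<close>.\<close>

lemma u_semigroup:
  assumes t: "0 \<le> t" and s: "0 \<le> s" and z: "0 \<le> z"
  shows "u (t + s) z = u t (u s z)"
proof -
  define A where "A = {w \<in> \<Omega>. ennreal t < \<zeta> w}"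
  have "{w \<in> space (F (ennreal t)). K w (ennreal t) \<in> - {\<infinity>}} \<in> sets (F (ennreal t))"
    using measurable_sets[OF adapted[of "ennreal t"], of "- {\<infinity>}"] by (simp add: vimage_def Int_def conj_commute)
  then have A: "A \<in> sets (F (ennreal t))"
    by (simp add: A_def K_infinity_iff space_F not_le)
  define H where "H \<omega> = exp_ereal z (\<omega> (ennreal s))" for \<omega> :: "ennreal \<Rightarrow> ereal"
  have H: "H \<in> borel_measurable path_space"
    unfolding H_def[abs_def] by measurable
  have us: "0 \<le> u s z" by (rule u_nonneg[OF s z])
  have "ennreal (La 1 (t + s) z) = (\<integral>\<^sup>+w. exp_ereal z (K w (ennreal (t + s))) \<partial>P 1)"
    using z by (simp add: La_nn_integral)
  also have "\<dots> = (\<integral>\<^sup>+w. indicator A w * H (\<lambda>r. K w (ennreal t + r)) \<partial>P 1)"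
  proof (rule nn_integral_cong)
    fix w assume w: "w \<in> space (P 1)"
    show "exp_ereal z (K w (ennreal (t + s))) = indicator A w * H (\<lambda>r. K w (ennreal t + r))"
    proof (cases "ennreal t < \<zeta> w")
      case True
      then show ?thesis using w space_P[of 1] t s by (simp add: A_def H_def)
    next
      case False
      then have "\<zeta> w \<le> ennreal (t + s)" using s by (intro order_trans[OF _ ennreal_leI[of t "t + s"]]) auto
      then have "K w (ennreal (t + s)) = \<infinity>" unfolding K_infinity_iff .
      then show ?thesis using False by (simp add: A_def exp_ereal_def del: ennreal_plus)
    qed
  qed
  also have "\<dots> = (\<integral>\<^sup>+w. indicator A w * (\<integral>\<^sup>+w'. H (K w') \<partial>P (X (ennreal t) w)) \<partial>P 1)"
    by (rule markov_property[OF _ A _ H]) (auto simp: A_def)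
  also have "\<dots> = (\<integral>\<^sup>+w. exp_ereal (u s z) (K w (ennreal t)) \<partial>P 1)"
  proof (rule nn_integral_cong)
    fix w assume w: "w \<in> space (P 1)"
    show "indicator A w * (\<integral>\<^sup>+w'. H (K w') \<partial>P (X (ennreal t) w)) = exp_ereal (u s z) (K w (ennreal t))"
    proof (cases "ennreal t < \<zeta> w")
      case True
      then have Xp: "0 < X (ennreal t) w" using X_pos w space_P[of 1] by auto
      then have "(\<integral>\<^sup>+w'. H (K w') \<partial>P (X (ennreal t) w)) = ennreal (exp (- X (ennreal t) w * u s z))"
        using La_u[OF Xp s z] by (simp add: H_def La_nn_integral[OF Xp z])
      then show ?thesis using True w space_P[of 1] by (simp add: A_def exp_ereal_K mult.commute)
    qed (simp add: A_def exp_ereal_K)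
  qed
  also have "\<dots> = ennreal (La 1 t (u s z))" using us by (simp add: La_nn_integral)
  finally have "La 1 (t + s) z = La 1 t (u s z)" by (simp add: La_nonneg)
  then show ?thesis by (simp add: u_def)
qed

lemma u_quotient_flow_limit:
  assumes T: "\<And>n. 0 < T n" "T \<longlonglongrightarrow> 0" and z: "z0 < z"
  shows "(\<lambda>n. (z - u (T n) z) / T n) \<longlonglongrightarrow> g z"
proof -
  have "filterlim T (at_right 0) sequentially"
    using T(2) T(1)[THEN less_imp_neq] T(1) by (auto simp: filterlim_at intro!: always_eventually)
  from filterlim_compose[OF flow_quotient[OF z] this] show ?thesis
    using T(1) z by (simp add: u_flow less_imp_le)
qed

text \<open>For small x, u is close to (1 - La) / x. With this replacement (z - u) / T becomes a
  drift 1 / T, a killing rate \<open>a\<close> and a finite jump measure \<open>N\<close>, so that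
  \<open>levy_exponent_sequence_compact\<close> applies.\<close>

lemma u_quotient_sequence:
  fixes T :: "nat \<Rightarrow> real"
  assumes T: "\<And>n. 0 < T n" "T \<longlonglongrightarrow> 0"
  obtains r A \<beta> c M where "strict_mono (r :: nat \<Rightarrow> nat)" "0 \<le> A" "0 \<le> c" "real_distribution M"
    "AE y in M. 0 \<le> y \<and> y \<le> 1"
    "\<And>z. 0 < z \<Longrightarrow> (\<lambda>n. (z - u (T (r n)) z) / T (r n)) \<longlonglongrightarrow> - A + \<beta> * z + c * (\<integral>y. levy_kernel z y \<partial>M)"
proof -
  \<comment> \<open>Replacing x u by 1 - exp (-x u) and dividing by T x costs at most x u^2 / (2 T).
    With x = T^2 this is T u^2 / 2, which tends to 0.\<close>
  define x where "x n = (T n)\<^sup>2" for n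
  have x: "0 < x n" for n using T(1)[of n] by (simp add: x_def)
  define a where "a n = (1 - La (x n) (T n) 0) / (T n * x n)" for n
  define b where "b n = 1 / T n" for n
  define N where "N n = density (law (x n) (T n)) (\<lambda>_. ennreal (1 / (T n * x n)))" for n
  define L where "L n z = - a n + b n * z + (\<integral>h. exp (- z * h) - 1 \<partial>N n)" for n z
  have Tx: "0 < T n * x n" for n using T x by simp
  have L_eq: "L n z = z / T n - (1 - La (x n) (T n) z) / (T n * x n)" if z: "0 \<le> z" for n z
  proof -
    interpret finite_measure "law (x n) (T n)" by (rule finite_law[OF x])
    have int: "integrable (law (x n) (T n)) (\<lambda>h. exp (- z * h))" if "0 \<le> z" for z
      using AE_law[OF x, of n "T n"] that
      by (intro integrable_const_bound[where B=1]) (auto elim!: eventually_mono)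
    have val: "(\<integral>h. exp (- z * h) \<partial>law (x n) (T n)) = La (x n) (T n) z" if "0 \<le> z" for z
      using nn_integral_law_exp[OF x that, of n "T n"] by (subst integral_eq_nn_integral) (auto simp: La_nonneg)
    have "(\<integral>h. exp (- z * h) - 1 \<partial>N n) = (\<integral>h. (1 / (T n * x n)) *\<^sub>R (exp (- z * h) - exp (- 0 * h)) \<partial>law (x n) (T n))"
      unfolding N_def using Tx[of n] by (subst integral_density) auto
    also have "\<dots> = (1 / (T n * x n)) *\<^sub>R (La (x n) (T n) z - La (x n) (T n) 0)"
      using int[of z] int[of 0] val[of z] val[of 0] z
      by (subst integral_scaleR_right, subst Bochner_Integration.integral_diff) auto
    finally show ?thesis
      by (simp add: L_def a_def b_def diff_divide_distrib)
  qed
  have near: "(\<lambda>n. L n z - (z - u (T n) z) / T n) \<longlonglongrightarrow> 0" if z: "0 \<le> z" for z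
  proof (rule Lim_null_comparison)
    define C where "C = max z (z0 + 1)"
    show "(\<lambda>n. T n * (C\<^sup>2 / 2)) \<longlonglongrightarrow> 0" using T(2) by (rule tendsto_mult_left_zero)
    show "\<forall>\<^sub>F n in sequentially. norm (L n z - (z - u (T n) z) / T n) \<le> T n * (C\<^sup>2 / 2)"
    proof (rule always_eventually, rule allI)
      fix n
      define v where "v = u (T n) z"
      have v: "0 \<le> v" "v \<le> C" using u_nonneg[of "T n" z] u_le[of "T n" z] T(1)[of n] z by (auto simp: v_def C_def)
      define y where "y = x n * v"
      have y: "0 \<le> y" using x[of n] v by (simp add: y_def)
      have e: "0 \<le> y - (1 - exp (- y))" "y - (1 - exp (- y)) \<le> y\<^sup>2 / 2"
        using exp_ge_add_one_self[of "- y"] exp_minus_le_quadratic[OF y] by auto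
      have "La (x n) (T n) z = exp (- y)" using La_u[OF x, of "T n" z n] T(1)[of n] z by (simp add: y_def v_def)
      then have "L n z - (z - v) / T n = (y - (1 - exp (- y))) / (T n * x n)"
        unfolding L_eq[OF z] using T(1)[of n] x[of n] by (simp add: y_def field_simps)
      then have "norm (L n z - (z - v) / T n) = (y - (1 - exp (- y))) / (T n * x n)"
        using e(1) Tx[of n] by simp
      also have "\<dots> \<le> (y\<^sup>2 / 2) / (T n * x n)" using e(2) Tx[of n] by (intro divide_right_mono) auto
      also have "\<dots> = T n * (v\<^sup>2 / 2)"
        using T(1)[of n] by (simp add: y_def x_def power2_eq_square field_simps)
      also have "\<dots> \<le> T n * (C\<^sup>2 / 2)"
        using v T(1)[of n] by (intro mult_left_mono divide_right_mono power_mono) auto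
      finally show "norm (L n z - (z - u (T n) z) / T n) \<le> T n * (C\<^sup>2 / 2)" by (simp add: v_def)
    qed
  qed
  have conv: "(\<lambda>n. L n z) \<longlonglongrightarrow> g z" if "z0 < z" for z
  proof -
    have "0 \<le> z" using that z0 by simp
    from tendsto_add[OF near[OF this] u_quotient_flow_limit[OF T that]] show ?thesis by simp
  qed
  have fin_N: "finite_measure (N n)" for n
  proof (rule finite_measureI)
    interpret finite_measure "law (x n) (T n)" by (rule finite_law[OF x])
    show "emeasure (N n) (space (N n)) \<noteq> \<infinity>"
      unfolding N_def by (simp add: emeasure_density nn_integral_cmult_indicator ennreal_mult_eq_top_iff emeasure_finite)
  qed
  have sets_N: "sets (N n) = sets borel" for n by (simp add: N_def sets_law)
  have pos_N: "AE h in N n. 0 < h" for n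
    unfolding N_def using AE_law[OF x, of n "T n"] by (subst AE_density) auto
  have a_nonneg: "0 \<le> a n" for n
    using La_le_1[OF x, of 0 n "T n"] Tx[of n] by (simp add: a_def)
  obtain r A \<beta> c M where res: "strict_mono (r :: nat \<Rightarrow> nat)" "0 \<le> A" "0 \<le> c" "real_distribution M"
    "AE y in M. 0 \<le> y \<and> y \<le> 1"
    "\<And>z. 0 < z \<Longrightarrow> (\<lambda>n. - a (r n) + b (r n) * z + (\<integral>h. exp (- z * h) - 1 \<partial>N (r n)))
        \<longlonglongrightarrow> - A + \<beta> * z + c * (\<integral>y. levy_kernel z y \<partial>M)"
    by (rule levy_exponent_sequence_compact[where N=N and a=a and ?z0.0=z0 and b=b and g=g,
        OF fin_N sets_N pos_N a_nonneg conv[unfolded L_def]], assumption, rule that)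
  show ?thesis
  proof (rule that[OF res(1-5)])
    fix z :: real assume z: "0 < z"
    have "(\<lambda>n. L (r n) z - (z - u (T (r n)) z) / T (r n)) \<longlonglongrightarrow> 0"
      using LIMSEQ_subseq_LIMSEQ[OF near[of z] res(1)] z by (simp add: comp_def)
    from tendsto_diff[OF res(6)[OF z, folded L_def] this]
    show "(\<lambda>n. (z - u (T (r n)) z) / T (r n)) \<longlonglongrightarrow> - A + \<beta> * z + c * (\<integral>y. levy_kernel z y \<partial>M)"
      by simp
  qed
qed

text \<open>Every sequence of times tending to 0 has a subsequence along which the quotients
  converge for all z > 0 to a kernel form. All these forms equal g above z0, so they coincide for z
  > 0 and the full limit exists.\<close>

lemma u_quotient_limit:
  obtains \<gamma> \<sigma> m p where "levy_measure m" "0 \<le> p"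
    "\<And>z. 0 < z \<Longrightarrow> ((\<lambda>t. (z - u t z) / t) \<longlongrightarrow> levy_measure.exponent m \<gamma> \<sigma> z - p) (at_right 0)"
proof -
  \<comment> \<open>One fixed sequence supplies the candidate for the limit.\<close>
  let ?T = "\<lambda>n. 1 / real (Suc n)"
  have T: "0 < ?T n" for n by simp
  have T0: "?T \<longlonglongrightarrow> 0" using LIMSEQ_Suc[OF lim_1_over_n] by simp
  obtain r A \<beta> c M where R: "strict_mono (r :: nat \<Rightarrow> nat)" "0 \<le> A" "0 \<le> c" "real_distribution M"
    "AE y in M. 0 \<le> y \<and> y \<le> 1"
    "\<And>z. 0 < z \<Longrightarrow> (\<lambda>n. (z - u (?T (r n)) z) / ?T (r n)) \<longlonglongrightarrow> - A + \<beta> * z + c * (\<integral>y. levy_kernel z y \<partial>M)"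
    by (rule u_quotient_sequence[of ?T, OF T T0], rule that)
  have Rg: "- A + \<beta> * z + c * (\<integral>y. levy_kernel z y \<partial>M) = g z" if z: "z0 < z" for z
  proof (rule LIMSEQ_unique[OF R(6)])
    show "0 < z" using z z0 by simp
    show "(\<lambda>n. (z - u (?T (r n)) z) / ?T (r n)) \<longlonglongrightarrow> g z"
      using LIMSEQ_subseq_LIMSEQ[OF T0 R(1)] by (intro u_quotient_flow_limit z) (auto simp: comp_def)
  qed
  obtain \<gamma> \<sigma> m p where m: "levy_measure m" "0 \<le> p"
    "\<And>z. 0 < z \<Longrightarrow> - A + \<beta> * z + c * (\<integral>y. levy_kernel z y \<partial>M) = levy_measure.exponent m \<gamma> \<sigma> z - p"
    by (rule levy_kernel_form_exponent[where \<beta>=\<beta>, OF R(4,5,3,2)], rule that)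
  show ?thesis
  proof (rule that[OF m(1,2)])
    fix z :: real assume z: "0 < z"
    show "((\<lambda>t. (z - u t z) / t) \<longlongrightarrow> levy_measure.exponent m \<gamma> \<sigma> z - p) (at_right 0)"
      unfolding m(3)[OF z, symmetric]
    proof (rule tendstoI)
      fix e :: real assume e: "0 < e"
      let ?R = "- A + \<beta> * z + c * (\<integral>y. levy_kernel z y \<partial>M)"
      let ?near = "\<lambda>t. dist ((z - u t z) / t) ?R < e"
      show "eventually ?near (at_right 0)"
      proof (rule sequentially_imp_eventually_within, safe)
        fix S :: "nat \<Rightarrow> real" assume S: "\<forall>n. S n \<in> {0<..} \<and> S n \<noteq> 0" "S \<longlonglongrightarrow> 0"
        show "\<forall>\<^sub>F n in sequentially. ?near (S n)"
        proof (rule ccontr)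
          assume "\<not> (\<forall>\<^sub>F n in sequentially. ?near (S n))"
          then obtain s where s: "strict_mono (s :: nat \<Rightarrow> nat)" "\<And>n. \<not> ?near (S (s n))"
            using not_eventually_sequentiallyD by blast
          define T' where "T' n = S (s n)" for n
          have T': "0 < T' n" for n using S by (simp add: T'_def)
          have T'0: "T' \<longlonglongrightarrow> 0" using LIMSEQ_subseq_LIMSEQ[OF S(2) s(1)] by (simp add: comp_def T'_def[abs_def])
          obtain r' A' \<beta>' c' M' where R': "strict_mono (r' :: nat \<Rightarrow> nat)" "0 \<le> A'" "0 \<le> c'" "real_distribution M'"
            "AE y in M'. 0 \<le> y \<and> y \<le> 1"
            "\<And>z. 0 < z \<Longrightarrow> (\<lambda>n. (z - u (T' (r' n)) z) / T' (r' n)) \<longlonglongrightarrow> - A' + \<beta>' * z + c' * (\<integral>y. levy_kernel z y \<partial>M')"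
            by (rule u_quotient_sequence[of T', OF T' T'0], rule that)
          have R'g: "- A' + \<beta>' * z + c' * (\<integral>y. levy_kernel z y \<partial>M') = g z" if z: "z0 < z" for z
          proof (rule LIMSEQ_unique[OF R'(6)])
            show "0 < z" using z z0 by simp
            show "(\<lambda>n. (z - u (T' (r' n)) z) / T' (r' n)) \<longlonglongrightarrow> g z"
              using LIMSEQ_subseq_LIMSEQ[OF T'0 R'(1)] T' by (intro u_quotient_flow_limit z) (auto simp: comp_def)
          qed
          have "?R = - A' + \<beta>' * z + c' * (\<integral>y. levy_kernel z y \<partial>M')"
            by (rule levy_kernel_form_unique[OF R(4,5,3) R'(4,5,3) _ z, of z0]) (simp only: Rg R'g)
          then have "(\<lambda>n. (z - u (T' (r' n)) z) / T' (r' n)) \<longlonglongrightarrow> ?R" using R'(6)[OF z] by simp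
          from tendstoD[OF this e] obtain n where "?near (T' (r' n))"
            by (auto simp: eventually_sequentially)
          then show False using s(2) by (simp add: T'_def)
        qed
      qed
    qed
  qed
qed

end

section \<open>The backward equation\<close>

context branching_setting
begin

lemma u_small_time:
  assumes z: "0 < z" and lim: "((\<lambda>t. (z - u t z) / t) \<longlongrightarrow> R) (at_right 0)"
  shows "((\<lambda>t. u t z) \<longlongrightarrow> z) (at_right 0)"
proof -
  have "((\<lambda>t. z - t * ((z - u t z) / t)) \<longlongrightarrow> z - 0 * R) (at_right 0)"
    by (intro tendsto_intros lim)
  moreover have "\<forall>\<^sub>F t in at_right 0. z - t * ((z - u t z) / t) = u t z"
    using eventually_at_right_less[of 0] by eventually_elim simp
  ultimately show ?thesis by (simp add: tendsto_cong)
qed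

text \<open>By the semigroup property a time step h moves the argument from z to
  \<open>u h z\<close>. The Lipschitz bound, uniform in the current time, turns the small-time limit
  into a modulus of continuity valid at all times.\<close>

lemma continuous_on_u_time:
  assumes z: "0 < z" and lim: "((\<lambda>t. (z - u t z) / t) \<longlongrightarrow> R) (at_right 0)"
  shows "continuous_on {0..} (\<lambda>t. u t z)"
proof -
  \<comment> \<open>The minimum lets the Lipschitz bound cover both orders of z and
    \<open>u h z\<close>.\<close>
  define \<eta> where "\<eta> h = \<bar>u h z - z\<bar> / min z (u h z)" for h
  have \<eta>: "(\<eta> \<longlongrightarrow> 0) (at_right 0)"
  proof -
    have "(\<eta> \<longlongrightarrow> \<bar>z - z\<bar> / min z z) (at_right 0)"
      unfolding \<eta>_def[abs_def] using z by (intro tendsto_intros u_small_time[OF z lim]) auto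
    then show ?thesis by simp
  qed
  have step: "\<bar>La 1 (s + h) z - La 1 s z\<bar> \<le> \<eta> h" if "0 \<le> s" "0 < h" for s h
  proof -
    have eq: "La 1 (s + h) z = La 1 s (u h z)"
      using La_u[of 1 "s + h" z] La_u[of 1 s "u h z"] u_semigroup[of s h z] u_nonneg[of h z] that z by simp
    have uh: "0 < u h z" using u_pos[of h z] that z by simp
    show ?thesis
    proof (cases "u h z \<le> z")
      case True
      have "\<bar>La 1 s z - La 1 s (u h z)\<bar> \<le> (z - u h z) / u h z" by (rule La_lipschitz) (use uh True in auto)
      then show ?thesis unfolding eq \<eta>_def using True by (simp add: abs_minus_commute min_def split: if_splits)
    next
      case False
      have "\<bar>La 1 s (u h z) - La 1 s z\<bar> \<le> (u h z - z) / z" by (rule La_lipschitz) (use z False in auto)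
      then show ?thesis unfolding eq \<eta>_def using False by simp
    qed
  qed
  have sym: "\<bar>La 1 s' z - La 1 s z\<bar> \<le> \<eta> \<bar>s' - s\<bar>" if "0 \<le> s" "0 \<le> s'" "s' \<noteq> s" for s s'
  proof (cases "s < s'")
    case True
    then show ?thesis using step[of s "s' - s"] that by simp
  next
    case False
    then show ?thesis using step[of s' "s - s'"] that by (simp add: abs_minus_commute)
  qed
  have "continuous_on {0..} (\<lambda>t. La 1 t z)"
    unfolding continuous_on_def
  proof
    fix s :: real assume s: "s \<in> {0..}"
    have "((\<lambda>s'. \<bar>s' - s\<bar>) \<longlongrightarrow> \<bar>s - s\<bar>) (at s within {0..})"
      by (intro tendsto_intros)
    moreover have "\<forall>\<^sub>F s' in at s within {0..}. \<bar>s' - s\<bar> \<in> {0<..} \<and> \<bar>s' - s\<bar> \<noteq> 0"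
      by (simp add: eventually_at_filter)
    ultimately have "filterlim (\<lambda>s'. \<bar>s' - s\<bar>) (at_right 0) (at s within {0..})"
      by (simp add: filterlim_at)
    from filterlim_compose[OF \<eta> this]
    have "((\<lambda>s'. \<eta> \<bar>s' - s\<bar>) \<longlongrightarrow> 0) (at s within {0..})" .
    moreover have "\<forall>\<^sub>F s' in at s within {0..}. norm (La 1 s' z - La 1 s z) \<le> \<eta> \<bar>s' - s\<bar>"
      using s sym[of s] by (auto simp: eventually_at_filter)
    ultimately have "((\<lambda>s'. La 1 s' z - La 1 s z) \<longlongrightarrow> 0) (at s within {0..})"
      by (rule Lim_null_comparison[rotated])
    then show "((\<lambda>t. La 1 t z) \<longlongrightarrow> La 1 s z) (at s within {0..})"
      by (simp add: LIM_zero_iff)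
  qed
  then show ?thesis
    unfolding u_def using La_pos[of 1 _ z] z by (intro continuous_intros) (auto simp: less_imp_neq[symmetric])
qed

text \<open>The increment from t to t + h is the small-time increment started at
  \<open>u t z\<close>, which gives the right derivative; continuity in time makes it
  two-sided.\<close>

lemma u_ode:
  assumes lim: "\<And>z. 0 < z \<Longrightarrow> ((\<lambda>t. (z - u t z) / t) \<longlongrightarrow> \<psi> z - p) (at_right 0)"
    and \<psi>: "continuous_on {0..} \<psi>" and z: "0 < z" and t: "0 \<le> t"
  shows "((\<lambda>s. u s z) has_real_derivative (p - \<psi> (u t z))) (at t within {0..})"
proof (rule has_real_derivative_of_right_derivative[OF continuous_on_u_time[OF z lim[OF z]] _ _ t])
  show "continuous_on {0..} (\<lambda>s. p - \<psi> (u s z))"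
    using u_nonneg z
    by (intro continuous_intros continuous_on_compose2[OF \<psi> continuous_on_u_time[OF z lim[OF z]]]) auto
  fix t :: real assume t: "0 \<le> t"
  define v where "v = u t z"
  have v: "0 < v" using u_pos[OF t z] by (simp add: v_def)
  have "((\<lambda>h. - ((v - u h v) / h)) \<longlongrightarrow> - (\<psi> v - p)) (at_right 0)"
    by (intro tendsto_minus lim v)
  moreover have "\<forall>\<^sub>F h in at_right 0. - ((v - u h v) / h) = (u (t + h) z - u t z) / h"
    using eventually_at_right_less[of 0]
  proof eventually_elim
    case (elim h)
    then have "u (t + h) z = u h v" using u_semigroup[of h t z] t z by (simp add: v_def add.commute)
    then show ?case by (simp add: v_def minus_divide_left)
  qed
  ultimately show "((\<lambda>h. (u (t + h) z - u t z) / h) \<longlongrightarrow> p - \<psi> (u t z)) (at_right 0)"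
    by (simp add: tendsto_cong v_def)
qed

lemma u_tendsto_0:
  assumes t: "0 \<le> t"
  shows "(\<lambda>n. u t (1 / real (Suc n))) \<longlonglongrightarrow> u t 0"
proof -
  interpret prob_space "P 1" by (rule prob_P) simp
  have "(\<lambda>n. La 1 t (1 / real (Suc n))) \<longlonglongrightarrow> La 1 t 0"
    unfolding La_def
  proof (rule integral_dominated_convergence[where w="\<lambda>_. 1"])
    show "(\<lambda>w. if ennreal t < \<zeta> w then exp (- 0 * X (ennreal t) w) else 0) \<in> borel_measurable (P 1)"
      using La_integrable[of 1 0 t] by auto
    show "(\<lambda>w. if ennreal t < \<zeta> w then exp (- (1 / real (Suc n)) * X (ennreal t) w) else 0) \<in> borel_measurable (P 1)" for n
      using La_integrable[of 1 "1 / real (Suc n)" t] by auto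
    have "(\<lambda>n. 1 / real (Suc n)) \<longlonglongrightarrow> 0" using LIMSEQ_Suc[OF lim_1_over_n] by simp
    then have "(\<lambda>n. exp (- (1 / real (Suc n)) * y)) \<longlonglongrightarrow> exp (- 0 * y)" for y :: real
      by (intro tendsto_intros)
    then show "AE w in P 1. (\<lambda>n. if ennreal t < \<zeta> w then exp (- (1 / real (Suc n)) * X (ennreal t) w) else 0)
        \<longlonglongrightarrow> (if ennreal t < \<zeta> w then exp (- 0 * X (ennreal t) w) else 0)"
      by (intro AE_I2) (auto simp del: of_nat_Suc)
    show "AE w in P 1. norm (if ennreal t < \<zeta> w then exp (- (1 / real (Suc n)) * X (ennreal t) w) else 0) \<le> 1" for n
    proof (rule AE_I2)
      fix w assume "w \<in> space (P 1)"
      then have "0 \<le> 1 / real (Suc n) * X (ennreal t) w" if "ennreal t < \<zeta> w"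
        using X_pos[OF _ that] space_P[of 1] by (intro mult_nonneg_nonneg) (auto intro: less_imp_le)
      then show "norm (if ennreal t < \<zeta> w then exp (- (1 / real (Suc n)) * X (ennreal t) w) else 0) \<le> 1"
        by (simp del: of_nat_Suc)
    qed
  qed simp
  then show ?thesis
    unfolding u_def using La_pos[of 1 t 0] t by (intro tendsto_intros) auto
qed

text \<open>Without a small-time limit at z = 0, the integrated equation at z = 1 / (n + 1) is
  carried to the limit. The resulting identity shows that \<open>u t 0\<close> is continuous in t,
  and only then can it be differentiated.\<close>

lemma u_ode_0:
  assumes lim: "\<And>z. 0 < z \<Longrightarrow> ((\<lambda>t. (z - u t z) / t) \<longlongrightarrow> \<psi> z - p) (at_right 0)"
    and \<psi>: "continuous_on {0..} \<psi>" and t: "0 \<le> t"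
  shows "((\<lambda>s. u s 0) has_real_derivative (p - \<psi> (u t 0))) (at t within {0..})"
proof -
  let ?z = "\<lambda>n. 1 / real (Suc n)"
  let ?r = "\<lambda>s. p - \<psi> (u s 0)"
  have cont: "continuous_on {0..} (\<lambda>s. p - \<psi> (u s z))" if z: "0 < z" for z
    using u_nonneg z
    by (intro continuous_intros continuous_on_compose2[OF \<psi> continuous_on_u_time[OF z lim[OF z]]]) auto
  \<comment> \<open>For arguments at most 1, u stays in [0, z0 + 1] at all times; this bound serves
    for dominated convergence.\<close>
  have "compact ((\<lambda>v. p - \<psi> v) ` {0..z0 + 1})"
    by (intro compact_continuous_image continuous_intros continuous_on_subset[OF \<psi>]) auto
  then obtain B where B: "\<forall>v\<in>{0..z0 + 1}. \<bar>p - \<psi> v\<bar> \<le> B"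
    by (auto dest!: compact_imp_bounded simp: bounded_iff)
  have int_eq: "?r integrable_on {0..T}" "u T 0 = integral {0..T} ?r" if T: "0 \<le> T" for T
  proof -
    have fund: "((\<lambda>s. p - \<psi> (u s (?z n))) has_integral u T (?z n) - u 0 (?z n)) {0..T}" for n
    proof (rule fundamental_theorem_of_calculus[OF T])
      fix s assume s: "s \<in> {0..T}"
      have "((\<lambda>s. u s (?z n)) has_real_derivative (p - \<psi> (u s (?z n)))) (at s within {0..})"
        using s by (intro u_ode[OF lim \<psi>]) auto
      then have "((\<lambda>s. u s (?z n)) has_real_derivative (p - \<psi> (u s (?z n)))) (at s within {0..T})"
        by (rule DERIV_subset) auto
      then show "((\<lambda>s. u s (?z n)) has_vector_derivative p - \<psi> (u s (?z n))) (at s within {0..T})"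
        by (simp add: has_real_derivative_iff_has_vector_derivative)
    qed
    have bound: "norm (p - \<psi> (u s (?z n))) \<le> B" if "s \<in> {0..T}" for s n
    proof -
      have "?z n \<le> 1" by simp
      then have "max (?z n) (z0 + 1) = z0 + 1" using z0 by linarith
      then have "u s (?z n) \<in> {0..z0 + 1}"
        using u_nonneg[of s "?z n"] u_le[of s "?z n"] that by simp
      then show ?thesis using B by simp
    qed
    have ptw: "(\<lambda>n. p - \<psi> (u s (?z n))) \<longlonglongrightarrow> ?r s" if "s \<in> {0..T}" for s
    proof -
      have s: "0 \<le> s" using that by simp
      have "(\<lambda>n. \<psi> (u s (?z n))) \<longlonglongrightarrow> \<psi> (u s 0)"
        using u_nonneg[OF s] by (intro continuous_on_tendsto_compose[OF \<psi> u_tendsto_0[OF s]]) auto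
      then show ?thesis by (intro tendsto_intros)
    qed
    have dc: "?r integrable_on {0..T}" "(\<lambda>n. integral {0..T} (\<lambda>s. p - \<psi> (u s (?z n)))) \<longlonglongrightarrow> integral {0..T} ?r"
      using dominated_convergence[of "\<lambda>n s. p - \<psi> (u s (?z n))" "{0..T}" "\<lambda>_. B" ?r] fund bound ptw
      by (auto simp: has_integral_integrable simp del: of_nat_Suc)
    show "?r integrable_on {0..T}" by (rule dc)
    have "integral {0..T} (\<lambda>s. p - \<psi> (u s (?z n))) = u T (?z n) - ?z n" for n
      using integral_unique[OF fund[of n]] u_0[of "?z n"] by simp
    moreover have "(\<lambda>n. u T (?z n) - ?z n) \<longlonglongrightarrow> u T 0 - 0"
      by (intro tendsto_diff u_tendsto_0[OF T]) (use LIMSEQ_Suc[OF lim_1_over_n] in simp)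
    ultimately have "(\<lambda>n. integral {0..T} (\<lambda>s. p - \<psi> (u s (?z n)))) \<longlonglongrightarrow> u T 0" by simp
    from LIMSEQ_unique[OF this dc(2)] show "u T 0 = integral {0..T} ?r" .
  qed
  have "continuous_on {0..t + 1} (\<lambda>s. integral {0..s} ?r)"
    using t by (intro indefinite_integral_continuous_1 int_eq) simp
  then have "continuous_on {0..t + 1} (\<lambda>s. u s 0)"
    by (rule continuous_on_eq) (use int_eq(2) in auto)
  then have "continuous_on {0..t + 1} ?r"
    using u_nonneg by (intro continuous_intros continuous_on_compose2[OF \<psi>]) auto
  then have "((\<lambda>s. integral {0..s} ?r) has_real_derivative ?r t) (at t within {0..t + 1})"
    using t by (intro integral_has_real_derivative) auto
  moreover have "at t within {0..t + 1} = at t within {0..}"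
    by (rule at_within_nhd[of _ "{t - 1<..<t + 1}"]) auto
  ultimately have "((\<lambda>s. integral {0..s} ?r) has_real_derivative ?r t) (at t within {0..})" by simp
  then show ?thesis
  proof (rule has_field_derivative_transform_within[where d=1])
    show "integral {0..s} ?r = u s 0" if "s \<in> {0..}" for s
      using int_eq(2)[of s] that by simp
  qed (use t in simp_all)
qed

lemma is_CSBP_u:
  assumes lim: "\<And>z. 0 < z \<Longrightarrow> ((\<lambda>t. (z - u t z) / t) \<longlongrightarrow> \<psi> z - p) (at_right 0)"
    and \<psi>: "continuous_on {0..} \<psi>"
  shows "is_CSBP P X \<zeta> \<psi> p"
  unfolding is_CSBP_def
proof (rule exI[of _ u], intro conjI allI impI)
  fix t lam :: real assume lam: "0 \<le> lam" and t: "0 \<le> t"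
  show "((\<lambda>s. u s lam) has_real_derivative (p - \<psi> (u t lam))) (at t within {0..})"
  proof (cases "lam = 0")
    case True
    then show ?thesis using u_ode_0[OF lim \<psi> t] by simp
  next
    case False
    then show ?thesis using lam by (intro u_ode[OF lim \<psi> _ t]) auto
  qed
next
  fix x t lam :: real assume "0 < x" "0 \<le> t" "0 \<le> lam"
  then show "(\<integral> w. (if ennreal t < \<zeta> w then exp (- lam * X (ennreal t) w) else 0) \<partial>P x) = exp (- x * u t lam)"
    using La_u[of x t lam] by (simp only: La_def)
qed (auto intro: u_0 u_nonneg)

text \<open>For z > z0 the quotient (z - u t z) / t tends both to g z and to \<psi> z - p, and
  continuity extends the equality to z0. Since the chord bound keeps \<psi> at or below p on
  [0, z0], the point z0 is the right-continuous inverse of \<psi> at p.\<close>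

theorem branching_characterization:
  "\<exists>\<psi> p. sp_levy_laplace_exponent \<psi> \<and> 0 \<le> p \<and>
     (\<integral>\<^sup>+ z\<in>{rc_inverse \<psi> 0 + 1..}. ennreal (1 / \<psi> z) \<partial>lborel) = \<infinity> \<and>
     is_CSBP P X \<zeta> \<psi> p \<and> z0 = rc_inverse \<psi> p \<and> (\<forall>z\<ge>rc_inverse \<psi> p. g z = \<psi> z - p)"
proof -
  obtain \<gamma> \<sigma> m p where m: "levy_measure m" and p: "0 \<le> p"
    and lim: "\<And>z. 0 < z \<Longrightarrow> ((\<lambda>t. (z - u t z) / t) \<longlongrightarrow> levy_measure.exponent m \<gamma> \<sigma> z - p) (at_right 0)"
    by (rule u_quotient_limit, rule that)
  interpret m: levy_measure m by (rule m)
  define \<psi> where "\<psi> = m.exponent \<gamma> \<sigma>"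
  have \<psi>_cont: "continuous_on {0..} \<psi>" unfolding \<psi>_def by (rule m.continuous_on_exponent)
  have lim\<psi>: "((\<lambda>t. (z - u t z) / t) \<longlongrightarrow> \<psi> z - p) (at_right 0)" if "0 < z" for z
    using lim[OF that] by (simp add: \<psi>_def)
  have g_gt: "g z = \<psi> z - p" if z: "z0 < z" for z
  proof (rule tendsto_unique[OF _ _ lim\<psi>])
    have "\<forall>\<^sub>F t in at_right 0. (z - flow t z) / t = (z - u t z) / t"
      using eventually_at_right_less[of 0] by eventually_elim (use z in \<open>simp add: u_flow\<close>)
    then show "((\<lambda>t. (z - u t z) / t) \<longlongrightarrow> g z) (at_right 0)"
      using flow_quotient[OF z] by (rule Lim_transform_eventually[rotated])
    show "0 < z" using z z0 by simp
  qed simp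
  have g_z0': "g z0 = \<psi> z0 - p"
  proof (rule tendsto_unique[of "at_right z0"])
    have "(g \<longlongrightarrow> g z0) (at z0 within {z0..})" using continuous_on_g by (simp add: continuous_on_def)
    then show "(g \<longlongrightarrow> g z0) (at_right z0)" by (rule tendsto_within_subset) auto
    have "(\<psi> \<longlongrightarrow> \<psi> z0) (at z0 within {0..})" using \<psi>_cont z0 by (simp add: continuous_on_def)
    then have "(\<psi> \<longlongrightarrow> \<psi> z0) (at_right z0)" by (rule tendsto_within_subset) (use z0 in auto)
    then have "((\<lambda>z. \<psi> z - p) \<longlongrightarrow> \<psi> z0 - p) (at_right z0)" by (intro tendsto_intros)
    moreover have "\<forall>\<^sub>F z in at_right z0. \<psi> z - p = g z"
      using eventually_at_right_less[of z0] by eventually_elim (simp add: g_gt)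
    ultimately show "(g \<longlongrightarrow> \<psi> z0 - p) (at_right z0)" by (simp add: tendsto_cong)
  qed simp
  have g_eq: "g z = \<psi> z - p" if "z0 \<le> z" for z
    using that g_gt[of z] g_z0' by (cases "z = z0") auto
  have \<psi>_z0: "\<psi> z0 = p" using g_z0' g_z0 by simp
  have le: "\<psi> z \<le> p" if z: "0 \<le> z" "z \<le> z0" for z
  proof (cases "z0 = 0")
    case True
    then show ?thesis using z \<psi>_z0 by simp
  next
    case False
    then have "\<psi> z \<le> z / z0 * \<psi> z0" unfolding \<psi>_def using z z0 by (intro m.exponent_chord) auto
    also have "\<dots> \<le> 1 * p" unfolding \<psi>_z0 using z z0 False p by (intro mult_right_mono) auto
    finally show ?thesis by simp
  qed
  have gt: "p < \<psi> z" if "z0 < z" for z using g_gt[OF that] g_pos[OF that] by simp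
  have "{z. 0 \<le> z \<and> p < \<psi> z} = {z0<..}"
    using le gt z0 by (force simp: not_less[symmetric])
  then have rc: "rc_inverse \<psi> p = z0" by (simp add: rc_inverse_def cInf_greaterThan)
  have sp: "sp_levy_laplace_exponent \<psi>"
    unfolding \<psi>_def
    using gt[of "z0 + 1"] p z0 by (intro m.sp_levy_laplace_exponent_exponent[of "z0 + 1"]) (auto simp: \<psi>_def)
  have integral: "(\<integral>\<^sup>+ z\<in>{rc_inverse \<psi> 0 + 1..}. ennreal (1 / \<psi> z) \<partial>lborel) = \<infinity>"
  proof -
    have "\<forall>\<^sub>F z in at_top. max p 1 \<le> g z" using g_lim unfolding filterlim_at_top by blast
    \<comment> \<open>Once g >= max p 1, \<psi> = g + p is positive and at most 2 g, so divergence
      passes from 1 / g to 1 / \<psi>; the piece from \<theta> to b has a finite integral.\<close>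
    then obtain N where N: "\<And>z. N \<le> z \<Longrightarrow> max p 1 \<le> g z" by (auto simp: eventually_at_top_linorder)
    define b where "b = max N (max \<theta> (rc_inverse \<psi> 0 + 1))"
    have b: "\<theta> \<le> b" "z0 < b" "N \<le> b" "rc_inverse \<psi> 0 + 1 \<le> b" using \<theta> by (auto simp: b_def)
    have "\<infinity> = (\<integral>\<^sup>+ z\<in>{\<theta>..}. ennreal (1 / g z) \<partial>lborel)" by (simp add: g_int)
    also have "\<dots> \<le> (\<integral>\<^sup>+ z. ennreal (dens z) * indicator {\<theta>..b} z + ennreal (dens z) * indicator {b..} z \<partial>lborel)"
      using \<theta> by (intro nn_integral_mono) (auto simp: indicator_def dens_eq)
    also have "\<dots> = (\<integral>\<^sup>+ z. ennreal (dens z) * indicator {\<theta>..b} z \<partial>lborel) + (\<integral>\<^sup>+ z. ennreal (dens z) * indicator {b..} z \<partial>lborel)"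
      by (rule nn_integral_add) auto
    also have "(\<integral>\<^sup>+ z. ennreal (dens z) * indicator {\<theta>..b} z \<partial>lborel) = ennreal (G b - G \<theta>)"
      using \<theta> b by (intro nn_integral_dens_Icc) auto
    finally have "(\<integral>\<^sup>+ z. ennreal (dens z) * indicator {b..} z \<partial>lborel) = \<infinity>"
      by (simp add: top_unique)
    then have "\<infinity> = (\<integral>\<^sup>+ z. ennreal (1 / 2) * (ennreal (dens z) * indicator {b..} z) \<partial>lborel)"
      by (subst nn_integral_cmult) (auto simp: ennreal_mult_eq_top_iff)
    also have "\<dots> \<le> (\<integral>\<^sup>+ z\<in>{rc_inverse \<psi> 0 + 1..}. ennreal (1 / \<psi> z) \<partial>lborel)"
    proof (rule nn_integral_mono)
      fix z
      show "ennreal (1 / 2) * (ennreal (dens z) * indicator {b..} z) \<le> ennreal (1 / \<psi> z) * indicator {rc_inverse \<psi> 0 + 1..} z"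
      proof (cases "b \<le> z")
        case True
        then have z: "z0 < z" "max p 1 \<le> g z" using b N[of z] by auto
        have "\<psi> z \<le> 2 * g z" "0 < \<psi> z" using g_gt[OF z(1)] z(2) p by auto
        then have "1 / (2 * g z) \<le> 1 / \<psi> z" by (intro divide_left_mono) auto
        then have "1 / 2 * dens z \<le> 1 / \<psi> z" using z by (simp add: dens_eq)
        then have "ennreal (1 / 2 * dens z) \<le> ennreal (1 / \<psi> z)" by (rule ennreal_leI)
        then have "ennreal (1 / 2) * ennreal (dens z) \<le> ennreal (1 / \<psi> z)"
          using ennreal_mult[of "1 / 2" "dens z"] dens_nonneg[of z] by simp
        then show ?thesis using True b by simp
      qed simp
    qed
    finally show ?thesis by (simp add: top_unique)
  qed
  show ?thesis
    using sp p integral is_CSBP_u[OF lim\<psi> \<psi>_cont] rc g_eq by (intro exI[of _ \<psi>] exI[of _ p]) auto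
qed

end

theorem mainTheorem9:
  fixes \<Omega> :: "'a set" and P :: "real \<Rightarrow> 'a measure" and F :: "ennreal \<Rightarrow> 'a measure"
    and X :: "ennreal \<Rightarrow> 'a \<Rightarrow> real" and \<zeta> :: "'a \<Rightarrow> ennreal"
    and Q z0 \<theta> :: real and g :: "real \<Rightarrow> real"
  assumes setting: "standing_setting \<Omega> P F X \<zeta>"
    and nnj: "no_negative_jumps P X \<zeta>"
    and Q: "0 < Q" and z0: "0 \<le> z0" and \<theta>: "z0 < \<theta>"
    and g_C1: "\<exists>g'. continuous_on {z0..} g' \<and>
                 (\<forall>z\<ge>z0. (g has_real_derivative g' z) (at z within {z0..}))"
    and g_nonneg: "\<forall>z\<ge>z0. 0 \<le> g z"
    and g_pos: "\<forall>z>z0. 0 < g z" and g_z0: "g z0 = 0"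
    and g_lim: "filterlim g at_top at_top"
    and g_int: "(\<integral>\<^sup>+ z\<in>{\<theta>..}. ennreal (1 / g z) \<partial>lborel) = \<infinity>"
    and laplace: "\<forall>l x q. 0 < l \<longrightarrow> l \<le> x \<longrightarrow> Q < q \<longrightarrow>
        (\<integral> w. (if first_passage_below X \<zeta> l w < \<zeta> w
                 then exp (- q * enn2real (first_passage_below X \<zeta> l w)) else 0) \<partial>P x)
        = (LBINT z:{z0<..}. 1 / g z * exp (- x * z + (LBINT y=\<theta>..z. q / g y)))
          / (LBINT z:{z0<..}. 1 / g z * exp (- l * z + (LBINT y=\<theta>..z. q / g y)))"
  shows "\<exists>\<psi> p. sp_levy_laplace_exponent \<psi> \<and> 0 \<le> p \<and>
           (\<integral>\<^sup>+ z\<in>{rc_inverse \<psi> 0 + 1..}. ennreal (1 / \<psi> z) \<partial>lborel) = \<infinity> \<and>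
           is_CSBP P X \<zeta> \<psi> p \<and>
           z0 = rc_inverse \<psi> p \<and>
           (\<forall>z\<ge>rc_inverse \<psi> p. g z = \<psi> z - p)"
proof -
  interpret branching_setting z0 \<theta> g \<Omega> P F X \<zeta> Q
  proof
    show "0 < g z" if "z0 < z" for z using g_pos that by blast
  qed (fact assms | rule laplace[rule_format], assumption+)+
  show ?thesis by (rule branching_characterization)
qed

end
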